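(* Let $\mathscr{P}$ be a $C^*$-planar algebra and let $x\in\mathscr{P}_{2,\pm}$ be $\mathfrak{F}$-positive. Suppose that there exists a right PF eigenvector $y_1\in\mathscr{P}_{1,\mp}$ of $x$ such that $p_{\max}\wedge\overline{\mathcal{R}(y_1)}^{\perp}=0$. Then $$\mathcal{E}^+=\zeta^{1/2}\,\mathcal{C}_\zeta^+\,\zeta^{1/2},$$ where $\mathcal{E}^+$, $p_{\max}$, $\zeta$ and $\mathcal{C}_\zeta$ are associated with $x$ as defined in the context, and $\mathcal{C}_\zeta^+$ is the set of positive elements of $\mathcal{C}_\zeta$.
   Context: $C^*$-planar algebra: a (shaded) planar algebra in the sense of Jones is a family $\mathscr{P}=\{\mathscr{P}_{n,\pm}\}_{n\ge 0}$ of complex vector spaces on which shaded planar tangles act multilinearly, compatibly with isotopy and composition of tangles. Elements of $\mathscr{P}_{n,\pm}$ are boxes with $n$ strings attached on top and $n$ on the bottom; the region at the left (marked) side is unshaded for $+$ and shaded for $-$. It is a $C^*$-planar algebra if each $\mathscr{P}_{n,\pm}$ is a finite-dimensional unital $C^*$-algebra (unit $I$ or $1$) for the vertical stacking product ($xy$ is drawn with $y$ above $x$), the involution $*$ is compatible with reflection of tangles in a horizontal line, and there are positive faithful traces $tr_{n,\pm}$ with $tr_{n,\pm}(x)=tr_{0,\pm}$(closure of $x$), the closure joining each top string to the corresponding bottom string. Fourier transform: $\mathfrak{F}:\mathscr{P}_{2,\pm}\to\mathscr{P}_{2,\mp}$, $\widehat{x}=\mathfrak{F}(x)$, is the $90^\circ$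 rotation: the top-left, top-right, bottom-left, bottom-right boundary points of $\widehat{x}$ are connected respectively to the bottom-left, top-left, bottom-right, top-right points of $x$. $x\in\mathscr{P}_{2,\pm}$ is $\mathfrak{F}$-positive if $\widehat{x}$ is positive in $\mathscr{P}_{2,\mp}$. Convolution: for $u,v\in\mathscr{P}_{2,\mp}$, $u*v$ is obtained by placing $u$ to the left of $v$ and joining the top-right (bottom-right) point of $u$ to the top-left (bottom-left) point of $v$. For $y\in\mathscr{P}_{1,\pm}$, $u\in\mathscr{P}_{2,\mp}$, $y*u\in\mathscr{P}_{1,\pm}$ is obtained by placing $y$ to the left of $u$ and joining the top (bottom) end of $y$ to the top-left (bottom-left) point of $u$; for $z\in\mathscr{P}_{1,\mp}$, $u*z\in\mathscr{P}_{1,\mp}$ is obtained by placing $z$ to the right of $u$ and joining its ends to the right points of $u$. $u^{( *j)}$ is the $j$-fold convolution power, and $y*u^{( *0)}=y$. $\overline{y}$ is the $180^\circ$ rotation of $y$ ($\mathscr{P}_{1,\pm}\to\mathscr{P}_{1,\mp}$); $a\otimes b$ is horizontal juxtaposition; $\mathcal{R}(a)$ is the range projection of $a$; $q^\perp=I-q$ for a projection $q$. PF data of $x$: $r$ is the spectral radius of $x$; $\mathcal{E}=\{y\in\mathscr{P}_{1,\pm}:y*\widehat{x}=ry\}$; $\mathcal{E}^+$ is its set of positive elements; $p_{\max}$ is the largest element of $\mathscr{Q}=\{\mathcal{R}(y):y\in\mathcal{E}^+\}$. A right PF eigenvector of $x$ is a nonzero positive $y_1\in\mathscr{P}_{1,\mp}$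 with $\widehat{x}*y_1=ry_1$. The maximal-support PF eigenvector is $\zeta=\lim_{\mathbb{R}\ni z\to r^+}(z-r)\sum_{j=0}^\infty \frac{p_{\max}*\widehat{x}^{( *j)}}{z^{j+1}}$ (the limit exists, $\zeta\in\mathcal{E}^+$, $\mathcal{R}(\zeta)=p_{\max}$). $\zeta^{-1/2}$ is the inverse of $\zeta^{1/2}$ on its support $p_{\max}$ (and $0$ on the complement). Put $x_\zeta=(\zeta^{1/2}\otimes\overline{\zeta^{1/2}})\,x\,(\zeta^{-1/2}\otimes\overline{\zeta^{-1/2}})\in\mathscr{P}_{2,\pm}$. Then $\mathcal{C}_\zeta$ is the $C^*$-algebra $\mathcal{C}_\zeta=\{y\in\mathscr{P}_{1,\pm}: x_\zeta(1\otimes\overline{y})=(1\otimes\overline{y})x_\zeta,\ x_\zeta(y\otimes 1)=(y\otimes 1)x_\zeta\}$. *)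

theory Defs
  imports Complex_Main
begin

section \<open>Finite-dimensional unital C*-algebras\<close>

text \<open>
  Algebras are carried by complex subspaces of one ambient vector space; every family of vector
  spaces is of this form (inside its direct sum).
\<close>

record 'a star_algebra =
  carr :: "'a set"
  smul :: "complex \<Rightarrow> 'a \<Rightarrow> 'a"
  mul :: "'a \<Rightarrow> 'a \<Rightarrow> 'a"
  unit :: "'a"
  adj :: "'a \<Rightarrow> 'a"
  nrm :: "'a \<Rightarrow> real"

text \<open>Completeness with respect to the norm is automatic in finite dimension.\<close>

locale fd_cstar_algebra =
  fixes A :: "'a::ab_group_add star_algebra"
  assumes vector_space_smul: "vector_space (smul A)"
    and finite_dim: "\<exists>B. finite B \<and> carr A = module.span (smul A) B"
    and mul_closed: "\<lbrakk>a \<in> carr A; b \<in> carr A\<rbrakk> \<Longrightarrow> mul A a b \<in> carr A"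
    and mul_assoc: "\<lbrakk>a \<in> carr A; b \<in> carr A; c \<in> carr A\<rbrakk> \<Longrightarrow>
      mul A (mul A a b) c = mul A a (mul A b c)"
    and mul_add_left: "\<lbrakk>a \<in> carr A; b \<in> carr A; c \<in> carr A\<rbrakk> \<Longrightarrow>
      mul A (a + b) c = mul A a c + mul A b c"
    and mul_add_right: "\<lbrakk>a \<in> carr A; b \<in> carr A; c \<in> carr A\<rbrakk> \<Longrightarrow>
      mul A a (b + c) = mul A a b + mul A a c"
    and mul_smul_left: "\<lbrakk>a \<in> carr A; b \<in> carr A\<rbrakk> \<Longrightarrow>
      mul A (smul A l a) b = smul A l (mul A a b)"
    and mul_smul_right: "\<lbrakk>a \<in> carr A; b \<in> carr A\<rbrakk> \<Longrightarrow>
      mul A a (smul A l b) = smul A l (mul A a b)"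
    and unit_closed: "unit A \<in> carr A"
    and unit_left: "a \<in> carr A \<Longrightarrow> mul A (unit A) a = a"
    and unit_right: "a \<in> carr A \<Longrightarrow> mul A a (unit A) = a"
    and adj_closed: "a \<in> carr A \<Longrightarrow> adj A a \<in> carr A"
    and adj_adj: "a \<in> carr A \<Longrightarrow> adj A (adj A a) = a"
    and adj_add: "\<lbrakk>a \<in> carr A; b \<in> carr A\<rbrakk> \<Longrightarrow> adj A (a + b) = adj A a + adj A b"
    and adj_smul: "a \<in> carr A \<Longrightarrow> adj A (smul A l a) = smul A (cnj l) (adj A a)"
    and adj_mul: "\<lbrakk>a \<in> carr A; b \<in> carr A\<rbrakk> \<Longrightarrow> adj A (mul A a b) = mul A (adj A b) (adj A a)"
    and nrm_nonneg: "a \<in> carr A \<Longrightarrow> 0 \<le> nrm A a"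
    and nrm_eq_0: "a \<in> carr A \<Longrightarrow> nrm A a = 0 \<longleftrightarrow> a = 0"
    and nrm_add: "\<lbrakk>a \<in> carr A; b \<in> carr A\<rbrakk> \<Longrightarrow> nrm A (a + b) \<le> nrm A a + nrm A b"
    and nrm_smul: "a \<in> carr A \<Longrightarrow> nrm A (smul A l a) = cmod l * nrm A a"
    and nrm_mul: "\<lbrakk>a \<in> carr A; b \<in> carr A\<rbrakk> \<Longrightarrow> nrm A (mul A a b) \<le> nrm A a * nrm A b"
    and cstar_identity: "a \<in> carr A \<Longrightarrow> nrm A (mul A (adj A a) a) = (nrm A a)\<^sup>2"

definition positive :: "'a star_algebra \<Rightarrow> 'a \<Rightarrow> bool" where
  "positive A a \<longleftrightarrow> (\<exists>b\<in>carr A. a = mul A (adj A b) b)"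

definition below :: "'a::ab_group_add star_algebra \<Rightarrow> 'a \<Rightarrow> 'a \<Rightarrow> bool" where
  "below A a b \<longleftrightarrow> positive A (b - a)"

definition projection :: "'a star_algebra \<Rightarrow> 'a \<Rightarrow> bool" where
  "projection A p \<longleftrightarrow> p \<in> carr A \<and> adj A p = p \<and> mul A p p = p"

definition range_proj :: "'a::ab_group_add star_algebra \<Rightarrow> 'a \<Rightarrow> 'a" where
  "range_proj A a = (THE p. projection A p \<and> mul A p a = a \<and>
     (\<forall>q. projection A q \<and> mul A q a = a \<longrightarrow> below A p q))"

definition proj_meet :: "'a::ab_group_add star_algebra \<Rightarrow> 'a \<Rightarrow> 'a \<Rightarrow> 'a" where
  "proj_meet A p q = (THE m. projection A m \<and> below A m p \<and> below A m q \<and>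
     (\<forall>m'. projection A m' \<and> below A m' p \<and> below A m' q \<longrightarrow> below A m' m))"

definition proj_compl :: "'a::ab_group_add star_algebra \<Rightarrow> 'a \<Rightarrow> 'a" where
  "proj_compl A q = unit A - q"

definition pos_sqrt :: "'a star_algebra \<Rightarrow> 'a \<Rightarrow> 'a" where
  "pos_sqrt A a = (THE b. positive A b \<and> mul A b b = a)"

text \<open>The inverse of \<open>a\<close> in the corner \<open>p A p\<close>, extended by zero on the complement of \<open>p\<close>.\<close>

definition corner_inverse :: "'a star_algebra \<Rightarrow> 'a \<Rightarrow> 'a \<Rightarrow> 'a" where
  "corner_inverse A p a = (THE b. b \<in> carr A \<and> mul A p b = b \<and> mul A b p = b \<and>
     mul A a b = p \<and> mul A b a = p)"

definition spectrum :: "'a::ab_group_add star_algebra \<Rightarrow> 'a \<Rightarrow> complex set" where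
  "spectrum A a = {l. \<not> (\<exists>b\<in>carr A. mul A (a - smul A l (unit A)) b = unit A \<and>
     mul A b (a - smul A l (unit A)) = unit A)}"

definition spectral_radius :: "'a::ab_group_add star_algebra \<Rightarrow> 'a \<Rightarrow> real" where
  "spectral_radius A a = (SUP l\<in>spectrum A a. cmod l)"

definition norm_limit :: "'a::ab_group_add star_algebra \<Rightarrow> 'i filter \<Rightarrow> ('i \<Rightarrow> 'a) \<Rightarrow> 'a" where
  "norm_limit A F f = (THE w. w \<in> carr A \<and> ((\<lambda>t. nrm A (f t - w)) \<longlongrightarrow> 0) F)"

definition norm_suminf :: "'a::ab_group_add star_algebra \<Rightarrow> (nat \<Rightarrow> 'a) \<Rightarrow> 'a" where
  "norm_suminf A f = norm_limit A sequentially (\<lambda>N. \<Sum>j<N. f j)"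

definition positive_faithful_trace ::
    "'a::ab_group_add star_algebra \<Rightarrow> ('a \<Rightarrow> complex) \<Rightarrow> bool" where
  "positive_faithful_trace A \<tau> \<longleftrightarrow>
     (\<forall>a\<in>carr A. \<forall>b\<in>carr A. \<tau> (a + b) = \<tau> a + \<tau> b) \<and>
     (\<forall>c. \<forall>a\<in>carr A. \<tau> (smul A c a) = c * \<tau> a) \<and>
     (\<forall>a\<in>carr A. \<forall>b\<in>carr A. \<tau> (mul A a b) = \<tau> (mul A b a)) \<and>
     (\<forall>a\<in>carr A. \<tau> (mul A (adj A a) a) \<in> \<real> \<and> 0 \<le> Re (\<tau> (mul A (adj A a) a))) \<and>
     (\<forall>a\<in>carr A. \<tau> (mul A (adj A a) a) = 0 \<longrightarrow> a = 0)"


section \<open>Shaded planar tangles\<close>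

text \<open>
  A shaded planar tangle is drawn in a rectangle, its inner boxes being rectangles whose sides are
  horizontal and vertical, with the marked point of every box on its left side, and with strings in
  general position with respect to height.  Every tangle is isotopic to one in this position.  Read
  from bottom to top, the picture is a list of slices, each containing exactly one local minimum
  of a string (\<open>Cup\<close>), one local maximum (\<open>Cap\<close>), or one inner box (\<open>Box\<close>).  The first argument
  of each slice is the number of strings that pass by on its left; the second argument of \<open>Box\<close>
  is the number of the inner box, counted from 0.

  \<open>Plus\<close> means that the region at the left of a box is unshaded.  Since the shading alternates,
  the region to the right of \<open>i\<close> strings has the shading \<open>region s i\<close> if the leftmost one has
  shading \<open>s\<close>.
\<close>

datatype sign = Plus | Minus

fun opp :: "sign \<Rightarrow> sign" where
  "opp Plus = Minus"
| "opp Minus = Plus"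

definition region :: "sign \<Rightarrow> nat \<Rightarrow> sign" where
  "region s i = (if even i then s else opp s)"

text \<open>\<open>(n, s)\<close> is the type of a box with \<open>n\<close> strings on top, \<open>n\<close> at the bottom and \<open>s\<close> at the left.\<close>

type_synonym box_type = "nat \<times> sign"

datatype slice = Cup nat | Cap nat | Box nat nat

fun offset :: "slice \<Rightarrow> nat" where
  "offset (Cup i) = i"
| "offset (Cap i) = i"
| "offset (Box i k) = i"

fun lower :: "box_type list \<Rightarrow> slice \<Rightarrow> nat" where
  "lower bs (Cup i) = 0"
| "lower bs (Cap i) = 2"
| "lower bs (Box i k) = fst (bs ! k)"

fun upper :: "box_type list \<Rightarrow> slice \<Rightarrow> nat" where
  "upper bs (Cup i) = 2"
| "upper bs (Cap i) = 0"
| "upper bs (Box i k) = fst (bs ! k)"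

fun set_offset :: "nat \<Rightarrow> slice \<Rightarrow> slice" where
  "set_offset j (Cup i) = Cup j"
| "set_offset j (Cap i) = Cap j"
| "set_offset j (Box i k) = Box j k"

fun renumber_slice :: "(nat \<Rightarrow> nat) \<Rightarrow> slice \<Rightarrow> slice" where
  "renumber_slice f (Cup i) = Cup i"
| "renumber_slice f (Cap i) = Cap i"
| "renumber_slice f (Box i k) = Box i (f k)"

fun flip_slice :: "slice \<Rightarrow> slice" where
  "flip_slice (Cup i) = Cap i"
| "flip_slice (Cap i) = Cup i"
| "flip_slice (Box i k) = Box i k"

definition shift_slice :: "nat \<Rightarrow> slice \<Rightarrow> slice" where
  "shift_slice d e = set_offset (offset e + d) e"

fun box_numbers :: "slice list \<Rightarrow> nat list" where
  "box_numbers [] = []"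
| "box_numbers (Box i k # w) = k # box_numbers w"
| "box_numbers (e # w) = box_numbers w"

fun slice_ok :: "box_type list \<Rightarrow> sign \<Rightarrow> slice \<Rightarrow> bool" where
  "slice_ok bs s (Box i k) \<longleftrightarrow> k < length bs \<and> snd (bs ! k) = region s i"
| "slice_ok bs s e \<longleftrightarrow> True"

text \<open>\<open>diagram bs s m w m'\<close>: the slices \<open>w\<close> fit together, from \<open>m\<close> strings to \<open>m'\<close> strings.\<close>

fun diagram :: "box_type list \<Rightarrow> sign \<Rightarrow> nat \<Rightarrow> slice list \<Rightarrow> nat \<Rightarrow> bool" where
  "diagram bs s m [] m' \<longleftrightarrow> m = m'"
| "diagram bs s m (e # w) m' \<longleftrightarrow> slice_ok bs s e \<and> offset e + lower bs e \<le> m \<and>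
     diagram bs s (m - lower bs e + upper bs e) w m'"

datatype tangle = Tangle (inner: "box_type list") (outer: box_type) (slices: "slice list")

definition is_tangle :: "tangle \<Rightarrow> bool" where
  "is_tangle T \<longleftrightarrow>
     diagram (inner T) (snd (outer T)) (fst (outer T)) (slices T) (fst (outer T)) \<and>
     distinct (box_numbers (slices T)) \<and> set (box_numbers (slices T)) = {..<length (inner T)}"

text \<open>
  Planar isotopy is generated by local moves: two neighbouring slices that are horizontally apart
  exchange heights; a minimum and a maximum of a string cancel; an inner box makes a full turn.  In
  the last move the box is turned upside down, anticlockwise on one side and clockwise
  on the other (both sides have \<open>n\<close> strings at the bottom and at the top).
\<close>

inductive move :: "box_type list \<Rightarrow> slice list \<Rightarrow> slice list \<Rightarrow> bool" for bs where
  exchange: "offset g + upper bs g \<le> offset h \<Longrightarrow>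
    move bs [g, h] [set_offset (offset h - upper bs g + lower bs g) h, g]"
| straighten_right: "move bs [Cup i, Cap (Suc i)] []"
| straighten_left: "move bs [Cup (Suc i), Cap i] []"
| full_turn: "n = fst (bs ! k) \<Longrightarrow> move bs
    (map Cup [i + n..<i + 2 * n] @ [Box (i + n) k] @ map Cap (rev [i..<i + n]))
    (map Cup [i..<i + n] @ [Box (i + n) k] @ map Cap (rev [i + n..<i + 2 * n]))"

definition elementary_isotopy :: "tangle \<Rightarrow> tangle \<Rightarrow> bool" where
  "elementary_isotopy T T' \<longleftrightarrow> is_tangle T \<and> is_tangle T' \<and>
     inner T = inner T' \<and> outer T = outer T' \<and>
     (\<exists>u v a b. slices T = u @ a @ v \<and> slices T' = u @ b @ v \<and> move (inner T) a b)"

definition isotopic :: "tangle \<Rightarrow> tangle \<Rightarrow> bool" where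
  "isotopic = equivclp elementary_isotopy"

definition id_tangle :: "box_type \<Rightarrow> tangle" where
  "id_tangle b = Tangle [b] b [Box 0 0]"

text \<open>
  \<open>compose k T S\<close> is \<open>T \<circ>\<^sub>k S\<close>: the tangle \<open>S\<close> replaces the inner box \<open>k\<close> of \<open>T\<close>, and the
  inner boxes of \<open>S\<close> take the place of \<open>k\<close> in the numbering.
\<close>

fun insert_slices :: "nat \<Rightarrow> tangle \<Rightarrow> slice \<Rightarrow> slice list" where
  "insert_slices k S (Box i l) =
     (if l = k then map (\<lambda>e. shift_slice i (renumber_slice (\<lambda>j. k + j) e)) (slices S)
      else if l < k then [Box i l]
      else [Box i (l + length (inner S) - 1)])"
| "insert_slices k S e = [e]"

definition compose :: "nat \<Rightarrow> tangle \<Rightarrow> tangle \<Rightarrow> tangle" where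
  "compose k T S = Tangle (take k (inner T) @ inner S @ drop (Suc k) (inner T)) (outer T)
     (concat (map (insert_slices k S) (slices T)))"

definition reflect :: "tangle \<Rightarrow> tangle" where
  "reflect T = Tangle (inner T) (outer T) (map flip_slice (rev (slices T)))"

definition stack_tangle :: "box_type \<Rightarrow> tangle" where
  "stack_tangle b = Tangle [b, b] b [Box 0 0, Box 0 1]"

definition unit_tangle :: "box_type \<Rightarrow> tangle" where
  "unit_tangle b = Tangle [] b []"

definition closure_tangle :: "box_type \<Rightarrow> tangle" where
  "closure_tangle b = Tangle [b] (0, snd b)
     (map Cup [0..<fst b] @ [Box 0 0] @ map Cap (rev [0..<fst b]))"


section \<open>C*-planar algebras\<close>

record 'a planar_data =
  box_smul :: "complex \<Rightarrow> 'a \<Rightarrow> 'a"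
  box_space :: "box_type \<Rightarrow> 'a set"
  act :: "tangle \<Rightarrow> 'a list \<Rightarrow> 'a"
  box_adj :: "box_type \<Rightarrow> 'a \<Rightarrow> 'a"
  box_nrm :: "box_type \<Rightarrow> 'a \<Rightarrow> real"

definition fits :: "'a planar_data \<Rightarrow> box_type list \<Rightarrow> 'a list \<Rightarrow> bool" where
  "fits P bs as \<longleftrightarrow> list_all2 (\<lambda>b a. a \<in> box_space P b) bs as"

locale planar_algebra =
  fixes P :: "'a::ab_group_add planar_data"
  assumes vector_space_box_smul: "vector_space (box_smul P)"
    and subspace_box_space: "module.subspace (box_smul P) (box_space P b)"
    and act_closed: "\<lbrakk>is_tangle T; fits P (inner T) us\<rbrakk> \<Longrightarrow> act P T us \<in> box_space P (outer T)"
    and act_add: "\<lbrakk>is_tangle T; fits P (inner T) (us @ v # ws); fits P (inner T) (us @ v' # ws)\<rbrakk> \<Longrightarrow>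
      act P T (us @ (v + v') # ws) = act P T (us @ v # ws) + act P T (us @ v' # ws)"
    and act_smul: "\<lbrakk>is_tangle T; fits P (inner T) (us @ v # ws)\<rbrakk> \<Longrightarrow>
      act P T (us @ box_smul P l v # ws) = box_smul P l (act P T (us @ v # ws))"
    and act_id: "v \<in> box_space P b \<Longrightarrow> act P (id_tangle b) [v] = v"
    and act_isotopic: "\<lbrakk>isotopic T T'; is_tangle T; fits P (inner T) us\<rbrakk> \<Longrightarrow> act P T us = act P T' us"
    and act_renumber: "\<lbrakk>bij_betw \<pi> {..<length bs} {..<length bs}; fits P bs us;
        is_tangle (Tangle (map (\<lambda>k. bs ! \<pi> k) [0..<length bs]) b sl)\<rbrakk> \<Longrightarrow>
      act P (Tangle bs b (map (renumber_slice \<pi>) sl)) us =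
      act P (Tangle (map (\<lambda>k. bs ! \<pi> k) [0..<length bs]) b sl) (map (\<lambda>k. us ! \<pi> k) [0..<length bs])"
    and act_compose: "\<lbrakk>is_tangle T; is_tangle S; length us < length (inner T);
        inner T ! length us = outer S;
        fits P (inner S) vs; fits P (inner T) (us @ act P S vs # ws)\<rbrakk> \<Longrightarrow>
      act P (compose (length us) T S) (us @ vs @ ws) = act P T (us @ act P S vs # ws)"

definition box_alg :: "'a planar_data \<Rightarrow> box_type \<Rightarrow> 'a star_algebra" where
  "box_alg P b = \<lparr>carr = box_space P b, smul = box_smul P,
     mul = (\<lambda>x y. act P (stack_tangle b) [x, y]), unit = act P (unit_tangle b) [],
     adj = box_adj P b, nrm = box_nrm P b\<rparr>"

locale cstar_planar_algebra = planar_algebra P for P :: "'a::ab_group_add planar_data" +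
  assumes box_alg_cstar: "fd_cstar_algebra (box_alg P b)"
    and act_reflect: "\<lbrakk>is_tangle T; fits P (inner T) us\<rbrakk> \<Longrightarrow>
      act P (reflect T) (map2 (box_adj P) (inner T) us) = box_adj P (outer T) (act P T us)"
    and traces: "\<exists>tr :: box_type \<Rightarrow> 'a \<Rightarrow> complex.
      (\<forall>b. positive_faithful_trace (box_alg P b) (tr b)) \<and>
      (\<forall>n s. \<forall>a\<in>box_space P (n, s). tr (n, s) a = tr (0, s) (act P (closure_tangle (n, s)) [a]))"

text \<open>
  In the following operations the sign is that of the first argument.  Lists of slices are read
  from bottom to top.
\<close>

definition fourier :: "'a planar_data \<Rightarrow> sign \<Rightarrow> 'a \<Rightarrow> 'a" where
  "fourier P s x = act P (Tangle [(2, s)] (2, opp s) [Cup 0, Box 1 0, Cap 2]) [x]"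

definition conv :: "'a planar_data \<Rightarrow> sign \<Rightarrow> 'a \<Rightarrow> 'a \<Rightarrow> 'a" where
  "conv P s u v =
     act P (Tangle [(2, s), (2, s)] (2, s) [Cup 1, Box 0 0, Box 2 1, Cap 1]) [u, v]"

definition left_conv :: "'a planar_data \<Rightarrow> sign \<Rightarrow> 'a \<Rightarrow> 'a \<Rightarrow> 'a" where
  "left_conv P s y u =
     act P (Tangle [(1, s), (2, opp s)] (1, s) [Cup 0, Box 0 0, Box 1 1, Cap 0]) [y, u]"

definition right_conv :: "'a planar_data \<Rightarrow> sign \<Rightarrow> 'a \<Rightarrow> 'a \<Rightarrow> 'a" where
  "right_conv P s u z =
     act P (Tangle [(2, s), (1, s)] (1, s) [Cup 1, Box 0 0, Box 2 1, Cap 1]) [u, z]"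

text \<open>\<open>conv_power P s u j\<close> is the convolution power of exponent \<open>Suc j\<close>.\<close>

fun conv_power :: "'a planar_data \<Rightarrow> sign \<Rightarrow> 'a \<Rightarrow> nat \<Rightarrow> 'a" where
  "conv_power P s u 0 = u"
| "conv_power P s u (Suc j) = conv P s (conv_power P s u j) u"

fun left_conv_power :: "'a planar_data \<Rightarrow> sign \<Rightarrow> 'a \<Rightarrow> 'a \<Rightarrow> nat \<Rightarrow> 'a" where
  "left_conv_power P s y u 0 = y"
| "left_conv_power P s y u (Suc j) = left_conv P s y (conv_power P (opp s) u j)"

definition rot180 :: "'a planar_data \<Rightarrow> sign \<Rightarrow> 'a \<Rightarrow> 'a" where
  "rot180 P s y = act P (Tangle [(1, s)] (1, opp s) [Cup 1, Box 1 0, Cap 0]) [y]"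

definition juxtapose :: "'a planar_data \<Rightarrow> sign \<Rightarrow> 'a \<Rightarrow> 'a \<Rightarrow> 'a" where
  "juxtapose P s a b = act P (Tangle [(1, s), (1, opp s)] (2, s) [Box 0 0, Box 1 1]) [a, b]"


section \<open>Perron--Frobenius data\<close>

definition F_positive :: "'a planar_data \<Rightarrow> sign \<Rightarrow> 'a \<Rightarrow> bool" where
  "F_positive P s x \<longleftrightarrow> positive (box_alg P (2, opp s)) (fourier P s x)"

definition pf_radius :: "'a::ab_group_add planar_data \<Rightarrow> sign \<Rightarrow> 'a \<Rightarrow> real" where
  "pf_radius P s x = spectral_radius (box_alg P (2, s)) x"

definition pf_space :: "'a::ab_group_add planar_data \<Rightarrow> sign \<Rightarrow> 'a \<Rightarrow> 'a set" where
  "pf_space P s x = {y \<in> box_space P (1, s).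
     left_conv P s y (fourier P s x) = box_smul P (complex_of_real (pf_radius P s x)) y}"

definition pf_cone :: "'a::ab_group_add planar_data \<Rightarrow> sign \<Rightarrow> 'a \<Rightarrow> 'a set" where
  "pf_cone P s x = {y \<in> pf_space P s x. positive (box_alg P (1, s)) y}"

definition p_max :: "'a::ab_group_add planar_data \<Rightarrow> sign \<Rightarrow> 'a \<Rightarrow> 'a" where
  "p_max P s x = (THE p. p \<in> range_proj (box_alg P (1, s)) ` pf_cone P s x \<and>
     (\<forall>q\<in>range_proj (box_alg P (1, s)) ` pf_cone P s x. below (box_alg P (1, s)) q p))"

definition right_pf_eigenvector :: "'a::ab_group_add planar_data \<Rightarrow> sign \<Rightarrow> 'a \<Rightarrow> 'a \<Rightarrow> bool" where
  "right_pf_eigenvector P s x y \<longleftrightarrow>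
     y \<in> box_space P (1, opp s) \<and> y \<noteq> 0 \<and> positive (box_alg P (1, opp s)) y \<and>
     right_conv P (opp s) (fourier P s x) y = box_smul P (complex_of_real (pf_radius P s x)) y"

definition zeta :: "'a::ab_group_add planar_data \<Rightarrow> sign \<Rightarrow> 'a \<Rightarrow> 'a" where
  "zeta P s x = norm_limit (box_alg P (1, s)) (at_right (pf_radius P s x))
     (\<lambda>z. box_smul P (complex_of_real (z - pf_radius P s x))
        (norm_suminf (box_alg P (1, s))
          (\<lambda>j. box_smul P (complex_of_real (1 / z ^ (j + 1)))
             (left_conv_power P s (p_max P s x) (fourier P s x) j))))"

definition zeta_sqrt :: "'a::ab_group_add planar_data \<Rightarrow> sign \<Rightarrow> 'a \<Rightarrow> 'a" where
  "zeta_sqrt P s x = pos_sqrt (box_alg P (1, s)) (zeta P s x)"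

definition zeta_inv_sqrt :: "'a::ab_group_add planar_data \<Rightarrow> sign \<Rightarrow> 'a \<Rightarrow> 'a" where
  "zeta_inv_sqrt P s x = corner_inverse (box_alg P (1, s)) (p_max P s x) (zeta_sqrt P s x)"

definition x_zeta :: "'a::ab_group_add planar_data \<Rightarrow> sign \<Rightarrow> 'a \<Rightarrow> 'a" where
  "x_zeta P s x = (let A = box_alg P (2, s) in
     mul A (mul A (juxtapose P s (zeta_sqrt P s x) (rot180 P s (zeta_sqrt P s x))) x)
       (juxtapose P s (zeta_inv_sqrt P s x) (rot180 P s (zeta_inv_sqrt P s x))))"

definition C_zeta :: "'a::ab_group_add planar_data \<Rightarrow> sign \<Rightarrow> 'a \<Rightarrow> 'a set" where
  "C_zeta P s x = {y \<in> box_space P (1, s). let A = box_alg P (2, s);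
      yr = juxtapose P s (unit (box_alg P (1, s))) (rot180 P s y);
      yl = juxtapose P s y (unit (box_alg P (1, opp s)))
    in mul A (x_zeta P s x) yr = mul A yr (x_zeta P s x) \<and>
       mul A (x_zeta P s x) yl = mul A yl (x_zeta P s x)}"

definition C_zeta_pos :: "'a::ab_group_add planar_data \<Rightarrow> sign \<Rightarrow> 'a \<Rightarrow> 'a set" where
  "C_zeta_pos P s x = {c \<in> C_zeta P s x. positive (box_alg P (1, s)) c}"

end

(*
  By F-positivity, fourier P s x = adj b b, and bending the strings of adj b turns the map
  Phi y = left_conv P s y (fourier P s x) into a Kraus form: tr (Phi y m) = tr (k y (adj k) m),
  where k = fourier (adj b) is a 2-box and y, m stand for y tensor 1, m tensor 1. Conjugating x by
  the square root of zeta replaces Phi by Phi' y = zeta^(-1/2) Phi (zeta^(1/2) y zeta^(1/2))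
  zeta^(-1/2), which is r times a unital map on the corner of p_max. The rotated right eigenvector
  gives a positive functional h' with h' Phi' = r h', and the condition on the supports makes h'
  faithful on the corner. For self-adjoint c with Phi' c = r c, put D = k c - c k. Expanding D (adj D)
  shows that h' kills it, because h' Phi' (c c) = r h' (c c); so D = 0 and c commutes with k. Sliding
  c through the two halves of (adj b) b gives the two commutation relations that define C_zeta.
  Conversely, these relations turn Phi' c into (Phi' 1) c.
*)
theory Submission
  imports Defs "HOL-Computational_Algebra.Fundamental_Theorem_Algebra" "HOL-Library.Complex_Order"
begin

text \<open>Passing from \<open>x\<close> to \<open>x_zeta\<close> looks like a similarity, but the
  quarter turn carries one of its four corner factors up and one down, so on the Fourier side it is
  a congruence \<open>w X w\<close> with self-adjoint \<open>w\<close>. Hence positivity survives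
  and a Kraus operator exists again. Two obstacles shape the rest. The objects of the statement are
  definite descriptions, so supports, meets, square roots, \<open>p_max\<close> and
  \<open>\<zeta>\<close> must be shown to exist and be unique; this rests on a functional calculus
  by interpolation, valid because the minimal polynomial of a self-adjoint element has simple real
  roots. For \<open>\<zeta>\<close> the key is a sandwich \<open>c y0 <= p_max <= C y0\<close> with
  an eigenvector \<open>y0\<close> of maximal support: the upper bound keeps the iterates of
  \<open>p_max\<close> of order \<open>r^n\<close>, so the resolvent has at most a simple pole at
  \<open>r\<close>; the lower bound passes to the residue, so \<open>\<zeta>\<close> keeps the full
  support. Positivity is tested on trace forms, since closed diagrams are what an isotopy compares.
  The meet condition enters once: if \<open>h'\<close> were not faithful on the corner, some nonzero
  projection would lie under \<open>p_max\<close> and be orthogonal to the rotated support of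
  \<open>y1\<close>.\<close>

section \<open>Deciding planar isotopies by scripts\<close>

text \<open>
  An identity between composites of tangles is proved by computation: both composites are flattened
  to lists of slices, and two scripts of elementary moves lead from these lists to a common one. The
  scripts used below were found by breadth-first search.
\<close>

datatype pexp = Leaf nat | Node tangle "pexp list"

text \<open>The counter advances by the number of inner boxes just inserted, because
  \<open>compose\<close> gives them the numbers from \<open>k\<close> on; box \<open>k\<close> is
  thus always the next unfilled box of the original \<open>T\<close>.\<close>

fun plug :: "nat \<Rightarrow> tangle \<Rightarrow> tangle list \<Rightarrow> tangle" where
  "plug k T [] = T"
| "plug k T (S # Ss) = plug (k + length (inner S)) (compose k T S) Ss"

fun plug_ok :: "nat \<Rightarrow> tangle \<Rightarrow> tangle list \<Rightarrow> bool" where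
  "plug_ok k T [] \<longleftrightarrow> is_tangle T"
| "plug_ok k T (S # Ss) \<longleftrightarrow> is_tangle T \<and> plug_ok (k + length (inner S)) (compose k T S) Ss"

fun leaves :: "pexp \<Rightarrow> nat list" where
  "leaves (Leaf k) = [k]"
| "leaves (Node T es) = concat (map leaves es)"

fun flat :: "box_type list \<Rightarrow> pexp \<Rightarrow> tangle" where
  "flat bs (Leaf k) = id_tangle (bs ! k)"
| "flat bs (Node T es) = plug 0 T (map (flat bs) es)"

fun pexp_ok :: "box_type list \<Rightarrow> pexp \<Rightarrow> bool" where
  "pexp_ok bs (Leaf k) \<longleftrightarrow> k < length bs"
| "pexp_ok bs (Node T es) \<longleftrightarrow> list_all (pexp_ok bs) es \<and>
     (let Ss = map (flat bs) es in inner T = map outer Ss \<and> plug_ok 0 T Ss)"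

fun eval_pexp :: "'a planar_data \<Rightarrow> 'a list \<Rightarrow> pexp \<Rightarrow> 'a" where
  "eval_pexp P us (Leaf k) = us ! k"
| "eval_pexp P us (Node T es) = act P T (map (eval_pexp P us) es)"

text \<open>Flattening numbers the boxes in the order in which the leaves occur, so the two sides of
  an identity may number them differently. Renumbering by the leaves gives both sides the box list
  \<open>bs\<close>.\<close>

definition relabel :: "box_type list \<Rightarrow> pexp \<Rightarrow> tangle" where
  "relabel bs e = Tangle bs (outer (flat bs e))
     (map (renumber_slice (nth (leaves e))) (slices (flat bs e)))"

definition relabel_ok :: "box_type list \<Rightarrow> pexp \<Rightarrow> bool" where
  "relabel_ok bs e \<longleftrightarrow> pexp_ok bs e \<and> length (leaves e) = length bs \<and>
     distinct (leaves e) \<and> list_all (\<lambda>k. k < length bs) (leaves e) \<and> is_tangle (relabel bs e)"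

text \<open>
  The number in a step is the height at which the step is made; \<open>rewrite_slices\<close> is given the slices
  from that height on and splits them into the rewritten part and the rest. \<open>SR\<close> and \<open>SL\<close>
  straighten a string, \<open>FT\<close> is the full turn of a box with one string.
\<close>

datatype step = Fwd nat | Bwd nat | SR nat | SL nat | FT nat

fun rewrite_slices :: "box_type list \<Rightarrow> step \<Rightarrow> slice list \<Rightarrow> (slice list \<times> slice list) option" where
  "rewrite_slices bs (Fwd n) (g # h # w) = (if offset g + upper bs g \<le> offset h
     then Some ([set_offset (offset h - upper bs g + lower bs g) h, g], w) else None)"
| "rewrite_slices bs (Bwd n) (h # g # w) = (if offset g + lower bs g \<le> offset h
     then Some ([g, set_offset (offset h + upper bs g - lower bs g) h], w) else None)"
| "rewrite_slices bs (SR n) (Cup i # Cap j # w) = (if j = Suc i then Some ([], w) else None)"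
| "rewrite_slices bs (SL n) (Cup i # Cap j # w) = (if i = Suc j then Some ([], w) else None)"
| "rewrite_slices bs (FT n) (Cup i # Box j k # Cap l # w) =
     (if fst (bs ! k) = 1 \<and> j = Suc l \<and> i = j
      then Some ([Cup l, Box j k, Cap j], w) else None)"
| "rewrite_slices bs _ _ = None"

fun position :: "step \<Rightarrow> nat" where
  "position (Fwd n) = n"
| "position (Bwd n) = n"
| "position (SR n) = n"
| "position (SL n) = n"
| "position (FT n) = n"

text \<open>The tangle test is repeated after each step because \<open>elementary_isotopy\<close>
  demands it at both ends.\<close>

definition apply_step :: "step \<Rightarrow> tangle \<Rightarrow> tangle option" where
  "apply_step st T = (case rewrite_slices (inner T) st (drop (position st) (slices T)) of
      None \<Rightarrow> None
    | Some (b, w) \<Rightarrow> (let T' = Tangle (inner T) (outer T) (take (position st) (slices T) @ b @ w)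
        in if is_tangle T' then Some T' else None))"

fun apply_steps :: "step list \<Rightarrow> tangle \<Rightarrow> tangle option" where
  "apply_steps [] T = Some T"
| "apply_steps (st # sts) T = (case apply_step st T of None \<Rightarrow> None | Some T' \<Rightarrow> apply_steps sts T')"

text \<open>Two scripts meet in the middle because straightening and full turns are run in one
  direction only, so that a script cannot in general be reversed.\<close>

definition same_diagram :: "box_type list \<Rightarrow> pexp \<Rightarrow> pexp \<Rightarrow> step list \<Rightarrow> step list \<Rightarrow> bool" where
  "same_diagram bs e e' sts sts' \<longleftrightarrow> relabel_ok bs e \<and> relabel_ok bs e' \<and>
     (case apply_steps sts (relabel bs e) of None \<Rightarrow> False
      | Some T \<Rightarrow> apply_steps sts' (relabel bs e') = Some T)"

lemma rewrite_slices_move: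
  assumes "rewrite_slices bs st u = Some (b, w)"
  shows "\<exists>a. u = a @ w \<and> (move bs a b \<or> move bs b a)"
  using assms
proof (induction bs st u rule: rewrite_slices.induct)
  case (1 bs n g h w')
  then have le: "offset g + upper bs g \<le> offset h" and "w = w'"
    and b: "b = [set_offset (offset h - upper bs g + lower bs g) h, g]"
    by (simp_all split: if_splits)
  from move.exchange[OF le] have "move bs [g, h] b" "w = w'"
    using b \<open>w = w'\<close> by simp_all
  then show ?case by (intro exI[of _ "[g, h]"]) auto
next
  case (2 bs n h g w')
  let ?h = "set_offset (offset h + upper bs g - lower bs g) h"
  from 2 have le: "offset g + lower bs g \<le> offset h" and b: "b = [g, ?h]" and w: "w = w'"
    by (auto split: if_splits)
  have off: "offset ?h = offset h + upper bs g - lower bs g" by (cases h) auto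
  \<comment> \<open>\<open>Bwd\<close> is the exchange move for \<open>g\<close> and the shifted
    \<open>h\<close>, read from right to left; shifting twice gives back \<open>h\<close>.\<close>
  have "move bs [g, ?h] [set_offset (offset ?h - upper bs g + lower bs g) ?h, g]"
    using le off by (intro move.exchange) linarith
  moreover have "set_offset (offset ?h - upper bs g + lower bs g) ?h = h"
    using le by (cases h) auto
  ultimately show ?case using b w by (intro exI[of _ "[h, g]"]) auto
next
  case (3 bs n i j w')
  then show ?case using move.straighten_right[of bs i]
    by (intro exI[of _ "[Cup i, Cap j]"]) (auto split: if_splits)
next
  case (4 bs n i j w')
  then show ?case using move.straighten_left[of bs j]
    by (intro exI[of _ "[Cup i, Cap j]"]) (auto split: if_splits)
next
  case (5 bs n i j k l w')
  then have eq: "1 = fst (bs ! k)" "j = Suc l" "i = Suc l" "w = w'" "b =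
    [Cup l, Box (Suc l) k, Cap (Suc l)]"
    by (simp_all split: if_splits)
  have "move bs [Cup (Suc l), Box (Suc l) k, Cap l] [Cup l, Box (Suc l) k, Cap (Suc l)]"
    using move.full_turn[OF eq(1), of l] by (simp add: upt_rec)
  with eq show ?case by (intro exI[of _ "[Cup i, Box j k, Cap l]"]) simp
qed auto

lemma apply_step_isotopic:
  assumes "apply_step st T = Some T'" and "is_tangle T"
  shows "isotopic T T' \<and> is_tangle T' \<and> inner T' = inner T"
proof -
  let ?n = "position st"
  obtain b w where bw: "rewrite_slices (inner T) st (drop ?n (slices T)) = Some (b, w)"
    and T': "T' = Tangle (inner T) (outer T) (take ?n (slices T) @ b @ w)" "is_tangle T'"
    using assms(1) by (auto simp: apply_step_def Let_def split: option.splits if_splits)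
  obtain a where a: "drop ?n (slices T) = a @ w" "move (inner T) a b \<or> move (inner T) b a"
    using rewrite_slices_move[OF bw] by auto
  have T: "slices T = take ?n (slices T) @ a @ w"
    by (metis a(1) append_take_drop_id)
  from a(2) have "elementary_isotopy T T' \<or> elementary_isotopy T' T"
  proof
    assume "move (inner T) a b"
    then have "elementary_isotopy T T'"
      unfolding elementary_isotopy_def using assms(2) T' T by auto
    then show ?thesis ..
  next
    assume "move (inner T) b a"
    then have "elementary_isotopy T' T"
      unfolding elementary_isotopy_def using assms(2) T' T by auto
    then show ?thesis ..
  qed
  then have "isotopic T T'"
    unfolding isotopic_def by (meson r_into_equivclp converse_r_into_equivclp)
  then show ?thesis using T' by simp
qed

lemma apply_steps_isotopic:
  assumes "apply_steps sts T = Some T'" and "is_tangle T"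
  shows "isotopic T T' \<and> is_tangle T' \<and> inner T' = inner T"
  using assms
proof (induction sts arbitrary: T)
  case Nil
  then show ?case by (auto simp: isotopic_def)
next
  case (Cons st sts)
  then obtain T1 where T1: "apply_step st T = Some T1" "apply_steps sts T1 = Some T'"
    by (auto split: option.splits)
  note 1 = apply_step_isotopic[OF T1(1) Cons.prems(2)]
  note 2 = Cons.IH[OF T1(2)]
  show ?case using 1 2 unfolding isotopic_def by (metis equivclp_trans)
qed

context planar_algebra
begin

lemma is_tangle_id: "is_tangle (id_tangle b)"
  by (cases b) (auto simp: is_tangle_def id_tangle_def region_def)

text \<open>Invariant of the substitution from left to right: \<open>pre\<close> lists the boxes
  already inserted and \<open>us\<close> their arguments, while \<open>Ss\<close> is still to be
  filled in.\<close>

lemma act_plug: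
  assumes "plug_ok k T Ss" and "inner T = pre @ map outer Ss" and "length pre = k"
    and "list_all2 (\<lambda>S vs. is_tangle S \<and> fits P (inner S) vs) Ss vss" and "fits P pre us"
  shows "act P (plug k T Ss) (us @ concat vss) = act P T (us @ map2 (act P) Ss vss) \<and>
    is_tangle (plug k T Ss) \<and> outer (plug k T Ss) = outer T \<and>
    inner (plug k T Ss) = pre @ concat (map inner Ss)"
  using assms
proof (induction Ss arbitrary: k T pre us vss)
  case Nil
  then show ?case by auto
next
  case (Cons S Ss)
  obtain vs vss' where vss: "vss = vs # vss'" and vs: "is_tangle S" "fits P (inner S) vs"
    and vss': "list_all2 (\<lambda>S vs. is_tangle S \<and> fits P (inner S) vs) Ss vss'"
    using Cons.prems(4) by (auto simp: list_all2_Cons1)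
  have len: "length us = k" using Cons.prems(3,5) by (auto simp: fits_def dest: list_all2_lengthD)
  have innc: "inner (compose k T S) = (pre @ inner S) @ map outer Ss"
    using Cons.prems(2,3) by (simp add: compose_def)
  have fpre: "fits P (pre @ inner S) (us @ vs)"
    using Cons.prems(5) vs(2) unfolding fits_def by (rule list_all2_appendI)
  have IH: "act P (plug (k + length (inner S)) (compose k T S) Ss) ((us @ vs) @ concat vss') =
      act P (compose k T S) ((us @ vs) @ map2 (act P) Ss vss') \<and>
      is_tangle (plug (k + length (inner S)) (compose k T S) Ss) \<and>
      outer (plug (k + length (inner S)) (compose k T S) Ss) = outer (compose k T S) \<and>
      inner (plug (k + length (inner S)) (compose k T S) Ss) = (pre @ inner S) @ concat
        (map inner Ss)"
    by (rule Cons.IH[OF _ innc _ vss' fpre]) (use Cons.prems(1,3) in auto)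
  have rest: "list_all2 (\<lambda>b a. a \<in> box_space P b) (map outer Ss) (map2 (act P) Ss vss')"
    using vss'
    by (induction rule: list_all2_induct) (auto intro: act_closed)
  have "fits P (inner T) (us @ act P S vs # map2 (act P) Ss vss')"
    unfolding fits_def Cons.prems(2)
    by (rule list_all2_appendI)
      (use Cons.prems(5) rest vs in \<open>auto simp: fits_def intro: act_closed\<close>)
  then have "act P (compose (length us) T S) (us @ vs @ map2 (act P) Ss vss') =
      act P T (us @ act P S vs # map2 (act P) Ss vss')"
    using Cons.prems(1,2,3) vs len by (intro act_compose) (auto simp: nth_append)
  then show ?case using IH len vss by (simp add: compose_def)
qed

lemma eval_pexp_flat:
  assumes "pexp_ok bs e" and "fits P bs us"
  shows "eval_pexp P us e = act P (flat bs e) (map (nth us) (leaves e)) \<and> is_tangle (flat bs e) \<and>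
    inner (flat bs e) = map (nth bs) (leaves e) \<and>
    fits P (inner (flat bs e)) (map (nth us) (leaves e))"
  using assms(1)
proof (induction e)
  case (Leaf k)
  then have "us ! k \<in> box_space P (bs ! k)"
    using assms(2) by (auto simp: fits_def list_all2_conv_all_nth)
  then show ?case
    using is_tangle_id by (simp add: act_id) (simp add: id_tangle_def fits_def)
next
  case (Node T es)
  let ?Ss = "map (flat bs) es" and ?vss = "map (\<lambda>e. map (nth us) (leaves e)) es"
  have IH: "eval_pexp P us e = act P (flat bs e) (map (nth us) (leaves e)) \<and> is_tangle (flat bs e) \<and>
      inner (flat bs e) = map (nth bs) (leaves e) \<and>
      fits P (inner (flat bs e)) (map (nth us) (leaves e))" if "e \<in> set es" for e
  proof -
    have "pexp_ok bs e" using Node.prems that by (auto simp: list_all_iff)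
    then show ?thesis using Node.IH[OF that] by blast
  qed
  have ok: "plug_ok 0 T ?Ss" "inner T = [] @ map outer ?Ss"
    using Node.prems by (auto simp: Let_def)
  have all: "list_all2 (\<lambda>S vs. is_tangle S \<and> fits P (inner S) vs) ?Ss ?vss"
    by (simp only: list_all2_map1 list_all2_map2 list_all2_same) (use IH in blast)
  have m2: "map2 (act P) ?Ss ?vss = map (eval_pexp P us) es"
    using IH by (auto simp: list_eq_iff_nth_eq)
  have inn: "concat (map inner ?Ss) = map (nth bs) (concat (map leaves es))"
    using IH by (simp add: map_concat comp_def cong: map_cong)
  have "list_all2 (\<lambda>b a. a \<in> box_space P b) (map (nth bs) (concat (map leaves es)))
      (map (nth us) (concat (map leaves es)))"
  proof -
    have "bs ! k = bs ! k \<and> us ! k \<in> box_space P (bs ! k)" if k: "k \<in> set (concat (map leaves es))"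
      for k
    proof -
      obtain e where e: "e \<in> set es" "k \<in> set (leaves e)" using k by auto
      have "list_all2 (\<lambda>b a. a \<in> box_space P b) (map (nth bs) (leaves e)) (map (nth us) (leaves e))"
        using IH[OF e(1)] unfolding fits_def by argo
      then show ?thesis using e(2) by (auto simp: list_all2_conv_all_nth in_set_conv_nth)
    qed
    then show ?thesis by (simp only: list_all2_map1 list_all2_map2 list_all2_same) blast
  qed
  then show ?case
    using act_plug[OF ok(1) ok(2) _ all, of "[]"] m2 inn
    by (simp add: fits_def map_concat comp_def)
qed

lemma eval_pexp_relabel:
  assumes "relabel_ok bs e" and "fits P bs us"
  shows "eval_pexp P us e = act P (relabel bs e) us \<and> is_tangle (relabel bs e)"
proof -
  let ?n = "length bs"
  have len: "length (leaves e) = ?n" and dis: "distinct (leaves e)"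
    and sub: "set (leaves e) \<subseteq> {..<?n}" and tang: "is_tangle (relabel bs e)"
    and ok: "pexp_ok bs e"
    using assms(1) by (auto simp: relabel_ok_def list_all_iff)
  have set: "set (leaves e) = {..<?n}"
    using card_subset_eq[OF finite_lessThan sub] distinct_card[OF dis] len by simp
  have bij: "bij_betw (nth (leaves e)) {..<?n} {..<?n}"
    by (rule bij_betw_nth[OF dis]) (simp_all only: len set)
  note F = eval_pexp_flat[OF ok assms(2)]
  have m: "map f (leaves e) = map (\<lambda>k. f (leaves e ! k)) [0..<?n]" for f :: "nat \<Rightarrow> 'c"
    by (rule nth_equalityI) (simp_all add: len)
  have fl: "flat bs e = Tangle (map (\<lambda>k. bs ! (leaves e ! k)) [0..<?n]) (outer (flat bs e))
    (slices (flat bs e))"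
    using F unfolding m[of "nth bs"] by (metis tangle.collapse)
  have "act P (relabel bs e) us = act P (flat bs e) (map (nth us) (leaves e))"
    unfolding relabel_def m[of "nth us"]
    using act_renumber[OF bij assms(2), of "outer (flat bs e)" "slices (flat bs e)"] F fl
    by metis
  then show ?thesis using F tang by simp
qed

text \<open>Reduces an equation between composite operations to a closed term that
  \<open>code_simp\<close> evaluates once the sign is split into its two values.\<close>

lemma same_diagram_eval:
  assumes "same_diagram bs e e' sts sts'" and "fits P bs us"
  shows "eval_pexp P us e = eval_pexp P us e'"
proof -
  obtain T where ok: "relabel_ok bs e" "relabel_ok bs e'"
    and T: "apply_steps sts (relabel bs e) = Some T" "apply_steps sts' (relabel bs e') = Some T"
    using assms(1) by (auto simp: same_diagram_def split: option.splits)
  have inn: "inner (relabel bs d) = bs" for d by (simp add: relabel_def)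
  note 1 = eval_pexp_relabel[OF ok(1) assms(2)] and 2 = eval_pexp_relabel[OF ok(2) assms(2)]
  have "fits P (inner (relabel bs d)) us" for d using assms(2) inn by simp
  then have "act P (relabel bs e) us = act P T us" "act P (relabel bs e') us = act P T us"
    using apply_steps_isotopic[OF T(1)] apply_steps_isotopic[OF T(2)] 1 2
    by (blast intro: act_isotopic)+
  then show ?thesis using 1 2 by simp
qed

end

section \<open>Identities between composite tangles\<close>

definition box_closure :: "'a planar_data \<Rightarrow> box_type \<Rightarrow> 'a \<Rightarrow> 'a" where
  "box_closure P b x = act P (closure_tangle b) [x]"

definition fourier_inv :: "'a planar_data \<Rightarrow> sign \<Rightarrow> 'a \<Rightarrow> 'a" where
  "fourier_inv P s x = act P (Tangle [(2, s)] (2, opp s) [Cup 2, Box 1 0, Cap 0]) [x]"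

definition "mul_exp b e e' = Node (stack_tangle b) [e, e']"
definition "unit_exp b = Node (unit_tangle b) []"
definition "closure_exp b e = Node (closure_tangle b) [e]"
definition "fourier_exp s e = Node (Tangle [(2, s)] (2, opp s) [Cup 0, Box 1 0, Cap 2]) [e]"
definition "fourier_inv_exp s e = Node (Tangle [(2, s)] (2, opp s) [Cup 2, Box 1 0, Cap 0]) [e]"
definition "conv_exp s e e' =
  Node (Tangle [(2, s), (2, s)] (2, s) [Cup 1, Box 0 0, Box 2 1, Cap 1]) [e, e']"
definition "left_conv_exp s e e' =
  Node (Tangle [(1, s), (2, opp s)] (1, s) [Cup 0, Box 0 0, Box 1 1, Cap 0]) [e, e']"
definition "right_conv_exp s e e' =
  Node (Tangle [(2, s), (1, s)] (1, s) [Cup 1, Box 0 0, Box 2 1, Cap 1]) [e, e']"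
definition "rot_exp s e = Node (Tangle [(1, s)] (1, opp s) [Cup 1, Box 1 0, Cap 0]) [e]"
definition "juxt_exp s e e' = Node (Tangle [(1, s), (1, opp s)] (2, s) [Box 0 0, Box 1 1]) [e, e']"

text \<open>Upside-down pictures of \<open>juxtapose\<close> and \<open>rot180\<close>: reflection
  reverses the slices and exchanges minima and maxima. They enter through \<open>act_reflect\<close>
  when adjoints are computed.\<close>

definition "juxt_flip_exp s e e' = Node (Tangle [(1, s), (1, opp s)] (2, s) [Box 1 1, Box 0 0])
  [e, e']"
definition "rot_flip_exp s e = Node (Tangle [(1, s)] (1, opp s) [Cup 0, Box 1 0, Cap 1]) [e]"

abbreviation box_mul :: "'a planar_data \<Rightarrow> box_type \<Rightarrow> 'a \<Rightarrow> 'a \<Rightarrow> 'a" where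
  "box_mul P b \<equiv> mul (box_alg P b)"

abbreviation box_unit :: "'a planar_data \<Rightarrow> box_type \<Rightarrow> 'a" where
  "box_unit P b \<equiv> unit (box_alg P b)"

lemma eval_pexp_ops [simp]:
  "eval_pexp P us (mul_exp b e e') = box_mul P b (eval_pexp P us e) (eval_pexp P us e')"
  "eval_pexp P us (unit_exp b) = box_unit P b"
  "eval_pexp P us (closure_exp b e) = box_closure P b (eval_pexp P us e)"
  "eval_pexp P us (fourier_exp s e) = fourier P s (eval_pexp P us e)"
  "eval_pexp P us (fourier_inv_exp s e) = fourier_inv P s (eval_pexp P us e)"
  "eval_pexp P us (conv_exp s e e') = conv P s (eval_pexp P us e) (eval_pexp P us e')"
  "eval_pexp P us (left_conv_exp s e e') = left_conv P s (eval_pexp P us e) (eval_pexp P us e')"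
  "eval_pexp P us (right_conv_exp s e e') = right_conv P s (eval_pexp P us e) (eval_pexp P us e')"
  "eval_pexp P us (rot_exp s e) = rot180 P s (eval_pexp P us e)"
  "eval_pexp P us (juxt_exp s e e') = juxtapose P s (eval_pexp P us e) (eval_pexp P us e')"
  "eval_pexp P us (juxt_flip_exp s e e') = act P
    (Tangle [(1, s), (1, opp s)] (2, s) [Box 1 1, Box 0 0])
     [eval_pexp P us e, eval_pexp P us e']"
  "eval_pexp P us (rot_flip_exp s e) = act P (Tangle [(1, s)] (1, opp s) [Cup 0, Box 1 0, Cap 1])
     [eval_pexp P us e]"
  by (simp_all add: mul_exp_def unit_exp_def closure_exp_def fourier_exp_def fourier_inv_exp_def
      conv_exp_def left_conv_exp_def right_conv_exp_def rot_exp_def juxt_exp_def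
      juxt_flip_exp_def rot_flip_exp_def box_alg_def box_closure_def fourier_def fourier_inv_def
        conv_def left_conv_def
      right_conv_def rot180_def juxtapose_def)

context planar_algebra
begin

text \<open>Both sides are one closed diagram, drawn with \<open>u\<close> and \<open>v\<close>
  given quarter turns in opposite directions. If \<open>v\<close> is the adjoint of
  \<open>u\<close>, the two rotated boxes are adjoint to each other and the right side is a Kraus
  form.\<close>

lemma conv_kraus:
  assumes "y \<in> box_space P (1, s)"
    and "u \<in> box_space P (2, opp s)" and "v \<in> box_space P (2, opp s)" and "m \<in> box_space P (1, s)"
  shows "box_closure P (1, s) (box_mul P (1, s) (left_conv P s y (box_mul P (2, opp s) u v)) m) =
    box_closure P (2, s) (box_mul P (2, s)
      (box_mul P (2, s) (box_mul P (2, s) (fourier P (opp s) u)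
      (juxtapose P s y (box_unit P (1, opp s)))) (fourier_inv P (opp s) v))
      (juxtapose P s m (box_unit P (1, opp s))))"
proof -
  have "same_diagram [(1, s), (2, opp s), (2, opp s), (1, s)]
      (closure_exp (1, s) (mul_exp (1, s)
        (left_conv_exp s (Leaf 0) (mul_exp (2, opp s) (Leaf 1) (Leaf 2))) (Leaf 3)))
      (closure_exp (2, s) (mul_exp (2, s)
        (mul_exp (2, s) (mul_exp (2, s) (fourier_exp (opp s) (Leaf 1))
        (juxt_exp s (Leaf 0) (unit_exp (1, opp s)))) (fourier_inv_exp (opp s) (Leaf 2)))
        (juxt_exp s (Leaf 3) (unit_exp (1, opp s)))))
      []
      [Bwd 1, Bwd 2, SL 3, Fwd 7, Fwd 6, Fwd 5, SR 4, Bwd 2]"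
    by (cases s; simp; code_simp)
  from same_diagram_eval[OF this, of "[y, u, v, m]"] show ?thesis
    using assms by (cases s) (simp_all add: fits_def)
qed

text \<open>One closed diagram of \<open>y\<close>, \<open>u\<close> and \<open>z\<close>, read in
  two ways: up to the half turn, right convolution by \<open>u\<close> is the transpose of left
  convolution for the trace pairing.\<close>

lemma left_right_conv_dual:
  assumes "y \<in> box_space P (1, s)" and "u \<in> box_space P (2, opp s)" and "z \<in> box_space P (1, opp s)"
  shows "box_closure P (1, s) (box_mul P (1, s) (rot180 P (opp s) z) (left_conv P s y u)) =
    box_closure P (1, s) (box_mul P (1, s) y (rot180 P (opp s) (right_conv P (opp s) u z)))"
proof -
  have "same_diagram [(1, s), (2, opp s), (1, opp s)]
      (closure_exp (1, s) (mul_exp (1, s) (rot_exp (opp s) (Leaf 2))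
        (left_conv_exp s (Leaf 0) (Leaf 1))))
      (closure_exp (1, s) (mul_exp (1, s) (Leaf 0)
        (rot_exp (opp s) (right_conv_exp (opp s) (Leaf 1) (Leaf 2)))))
      [FT 1, Bwd 0, Bwd 1, SL 2]
      [Fwd 7, Fwd 6, Fwd 5, Fwd 4, Fwd 3, SR 2, Fwd 1, Fwd 0, Fwd 3, Fwd 2, Fwd 1, Bwd 5]"
    by (cases s; simp; code_simp)
  from same_diagram_eval[OF this, of "[y, u, z]"] show ?thesis
    using assms by (cases s) (simp_all add: fits_def)
qed

text \<open>Boxes on the left strings of \<open>u\<close> slide around the loop onto
  \<open>y\<close>, turned upside down; boxes on the right strings stay on the open string. Used for
  the corner square roots and later for moving \<open>c\<close>.\<close>

lemma left_conv_corners: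
  assumes "y \<in> box_space P (1, s)"
    and "u \<in> box_space P (2, opp s)" and "e \<in> box_space P (1, opp s)" and "f \<in> box_space P (1, s)"
    and "e' \<in> box_space P (1, opp s)" and "d \<in> box_space P (1, s)"
  shows "left_conv P s y (box_mul P (2, opp s) (box_mul P (2, opp s) (juxtapose P (opp s) e f) u)
    (juxtapose P (opp s) e' d)) =
    box_mul P (1, s) (box_mul P (1, s) f (left_conv P s
      (box_mul P (1, s) (box_mul P (1, s) (rot180 P (opp s) e) y) (rot180 P (opp s) e')) u)) d"
proof -
  have "same_diagram [(1, s), (2, opp s), (1, opp s), (1, s), (1, opp s), (1, s)]
      (left_conv_exp s (Leaf 0) (mul_exp (2, opp s)
        (mul_exp (2, opp s) (juxt_exp (opp s) (Leaf 2) (Leaf 3)) (Leaf 1))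
        (juxt_exp (opp s) (Leaf 4) (Leaf 5))))
      (mul_exp (1, s) (mul_exp (1, s) (Leaf 3)
        (left_conv_exp s (mul_exp (1, s) (mul_exp (1, s) (rot_exp (opp s) (Leaf 2)) (Leaf 0))
        (rot_exp (opp s) (Leaf 4))) (Leaf 1))) (Leaf 5))
      []
      [FT 2, Bwd 1, Bwd 2, SL 3, Fwd 6, Fwd 5, Fwd 4, Fwd 7, Fwd 6, SR 5, Bwd 0, Bwd 1, Bwd 2, Bwd
        1, Fwd 6]"
    by (cases s; simp; code_simp)
  from same_diagram_eval[OF this, of "[y, u, e, f, e', d]"] show ?thesis
    using assms by (cases s) (simp_all add: fits_def)
qed

text \<open>A quarter turn carries corners to corners. A box that changes between bottom and top
  (\<open>a\<close> and \<open>f\<close>) arrives upside down; one that only changes sides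
  (\<open>e\<close> and \<open>d\<close>) keeps its direction.\<close>

lemma fourier_corners:
  assumes "x \<in> box_space P (2, s)"
    and "a \<in> box_space P (1, s)" and "e \<in> box_space P (1, opp s)" and "d \<in> box_space P (1, s)"
    and "f \<in> box_space P (1, opp s)"
  shows "fourier P s (box_mul P (2, s) (box_mul P (2, s) (juxtapose P s a e) x) (juxtapose P s d f))
    =
    box_mul P (2, opp s) (box_mul P (2, opp s) (juxtapose P (opp s) e (rot180 P (opp s) f))
      (fourier P s x)) (juxtapose P (opp s) (rot180 P s a) d)"
proof -
  have "same_diagram [(2, s), (1, s), (1, opp s), (1, s), (1, opp s)]
      (fourier_exp s (mul_exp (2, s) (mul_exp (2, s) (juxt_exp s (Leaf 1) (Leaf 2)) (Leaf 0))
        (juxt_exp s (Leaf 3) (Leaf 4))))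
      (mul_exp (2, opp s) (mul_exp (2, opp s) (juxt_exp (opp s) (Leaf 2) (rot_exp (opp s) (Leaf 4)))
        (fourier_exp s (Leaf 0))) (juxt_exp (opp s) (rot_exp s (Leaf 1)) (Leaf 3)))
      []
      [FT 1, Bwd 3, Bwd 2, Bwd 1, Bwd 4, Bwd 3, Bwd 2, Bwd 5, Bwd 4, SL 3, Bwd 4, Bwd 3, Bwd 2, Bwd
        5, Bwd 4, Bwd 3, Bwd 6, Bwd 5, Bwd 4, FT 2, Bwd 1, Bwd 2, SL 3, Bwd 0, Bwd 1, Bwd 5, Bwd 4]"
    by (cases s; simp; code_simp)
  from same_diagram_eval[OF this, of "[x, a, e, d, f]"] show ?thesis
    using assms by (cases s) (simp_all add: fits_def)
qed

lemma fourier_inv_fourier: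
  assumes "x \<in> box_space P (2, s)"
  shows "fourier_inv P (opp s) (fourier P s x) = x"
proof -
  have "same_diagram [(2, s)]
      (fourier_inv_exp (opp s) (fourier_exp s (Leaf 0)))
      (Leaf 0)
      [Bwd 0, Bwd 1, SL 2, Bwd 1, SL 0]
      []"
    by (cases s; simp; code_simp)
  from same_diagram_eval[OF this, of "[x]"] show ?thesis
    using assms by (cases s) (simp_all add: fits_def)
qed

lemma juxtapose_mul:
  assumes "a \<in> box_space P (1, s)"
    and "e \<in> box_space P (1, opp s)" and "a' \<in> box_space P (1, s)" and "e' \<in> box_space P (1, opp s)"
  shows "box_mul P (2, s) (juxtapose P s a e) (juxtapose P s a' e') =
    juxtapose P s (box_mul P (1, s) a a') (box_mul P (1, opp s) e e')"
proof -
  have "same_diagram [(1, s), (1, opp s), (1, s), (1, opp s)]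
      (mul_exp (2, s) (juxt_exp s (Leaf 0) (Leaf 1)) (juxt_exp s (Leaf 2) (Leaf 3)))
      (juxt_exp s (mul_exp (1, s) (Leaf 0) (Leaf 2)) (mul_exp (1, opp s) (Leaf 1) (Leaf 3)))
      []
      [Fwd 1]"
    by (cases s; simp; code_simp)
  from same_diagram_eval[OF this, of "[a, e, a', e']"] show ?thesis
    using assms by (cases s) (simp_all add: fits_def)
qed

lemma juxtapose_unit:
  "juxtapose P s (box_unit P (1, s)) (box_unit P (1, opp s)) =
    box_unit P (2, s)"
proof -
  have "same_diagram []
      (juxt_exp s (unit_exp (1, s)) (unit_exp (1, opp s)))
      (unit_exp (2, s))
      []
      []"
    by (cases s; simp; code_simp)
  from same_diagram_eval[OF this, of "[]"] show ?thesis
    by (cases s) (simp_all add: fits_def)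
qed

lemma juxtapose_flip:
  assumes "a \<in> box_space P (1, s)" and "e \<in> box_space P (1, opp s)"
  shows "act P (Tangle [(1, s), (1, opp s)] (2, s) [Box 1 1, Box 0 0]) [a, e] =
    juxtapose P s a e"
proof -
  have "same_diagram [(1, s), (1, opp s)]
      (juxt_flip_exp s (Leaf 0) (Leaf 1))
      (juxt_exp s (Leaf 0) (Leaf 1))
      []
      [Fwd 0]"
    by (cases s; simp; code_simp)
  from same_diagram_eval[OF this, of "[a, e]"] show ?thesis
    using assms by (cases s) (simp_all add: fits_def)
qed

lemma rot180_mul:
  assumes "a \<in> box_space P (1, s)" and "b \<in> box_space P (1, s)"
  shows "rot180 P s (box_mul P (1, s) a b) =
    box_mul P (1, opp s) (rot180 P s b) (rot180 P s a)"
proof -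
  have "same_diagram [(1, s), (1, s)]
      (rot_exp s (mul_exp (1, s) (Leaf 0) (Leaf 1)))
      (mul_exp (1, opp s) (rot_exp s (Leaf 1)) (rot_exp s (Leaf 0)))
      []
      [Fwd 2, Fwd 1, Fwd 0, Fwd 3, Fwd 2, Fwd 1, Fwd 4, Fwd 3, SR 2]"
    by (cases s; simp; code_simp)
  from same_diagram_eval[OF this, of "[a, b]"] show ?thesis
    using assms by (cases s) (simp_all add: fits_def)
qed

lemma rot180_unit:
  "rot180 P s (box_unit P (1, s)) =
    box_unit P (1, opp s)"
proof -
  have "same_diagram []
      (rot_exp s (unit_exp (1, s)))
      (unit_exp (1, opp s))
      [SL 0]
      []"
    by (cases s; simp; code_simp)
  from same_diagram_eval[OF this, of "[]"] show ?thesis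
    by (cases s) (simp_all add: fits_def)
qed

lemma rot180_flip:
  assumes "a \<in> box_space P (1, s)"
  shows "act P (Tangle [(1, s)] (1, opp s) [Cup 0, Box 1 0, Cap 1]) [a] =
    rot180 P s a"
proof -
  have "same_diagram [(1, s)]
      (rot_flip_exp s (Leaf 0))
      (rot_exp s (Leaf 0))
      []
      [FT 0]"
    by (cases s; simp; code_simp)
  from same_diagram_eval[OF this, of "[a]"] show ?thesis
    using assms by (cases s) (simp_all add: fits_def)
qed

lemma rot180_rot180:
  assumes "a \<in> box_space P (1, s)"
  shows "rot180 P (opp s) (rot180 P s a) =
    a"
proof -
  have "same_diagram [(1, s)]
      (rot_exp (opp s) (rot_exp s (Leaf 0)))
      (Leaf 0)
      [FT 1, Bwd 0, Bwd 1, SL 2, Bwd 1, SL 0]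
      []"
    by (cases s; simp; code_simp)
  from same_diagram_eval[OF this, of "[a]"] show ?thesis
    using assms by (cases s) (simp_all add: fits_def)
qed

text \<open>Makes the convolution powers in the definition of \<open>zeta\<close> iterates of a
  single map.\<close>

lemma left_conv_conv:
  assumes "y \<in> box_space P (1, s)" and "u \<in> box_space P (2, opp s)" and "v \<in> box_space P (2, opp s)"
  shows "left_conv P s y (conv P (opp s) u v) =
    left_conv P s (left_conv P s y u) v"
proof -
  have "same_diagram [(1, s), (2, opp s), (2, opp s)]
      (left_conv_exp s (Leaf 0) (conv_exp (opp s) (Leaf 1) (Leaf 2)))
      (left_conv_exp s (left_conv_exp s (Leaf 0) (Leaf 1)) (Leaf 2))
      []
      [Bwd 0, Bwd 1, Fwd 4, Fwd 5]"
    by (cases s; simp; code_simp)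
  from same_diagram_eval[OF this, of "[y, u, v]"] show ?thesis
    using assms by (cases s) (simp_all add: fits_def)
qed

end

section \<open>Polynomials in a linear operator\<close>

lemma ex_interpolating_poly:
  fixes f :: "'a::field \<Rightarrow> 'a"
  assumes "finite R"
  shows "\<exists>q. \<forall>x\<in>R. poly q x = f x"
  using assms
proof induction
  case (insert x R)
  then obtain q where q: "\<forall>x\<in>R. poly q x = f x" by auto
  define g where "g = (\<Prod>y\<in>R. [:-y, 1:])"
  have gx: "poly g x \<noteq> 0" using insert by (auto simp: g_def poly_prod)
  have gR: "poly g y = 0" if "y \<in> R" for y using insert that by (auto simp: g_def poly_prod)
  let ?q = "q + smult ((f x - poly q x) / poly g x) g"
  have "\<forall>y\<in>insert x R. poly ?q y = f y" using q gx gR by auto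
  then show ?case by blast
qed simp

lemma prod_linear_factors_dvd:
  fixes q :: "'a::field poly"
  assumes "finite R" and "\<forall>x\<in>R. poly q x = 0"
  shows "(\<Prod>x\<in>R. [:-x, 1:]) dvd q"
  using assms
proof (induction arbitrary: q)
  case (insert x R)
  then obtain g where g: "q = [:-x, 1:] * g" by (auto simp: poly_eq_0_iff_dvd elim: dvdE)
  have "\<forall>y\<in>R. poly g y = 0" using insert g by auto
  with insert.IH have "(\<Prod>x\<in>R. [:-x, 1:]) dvd g" by blast
  then have "[:-x, 1:] * (\<Prod>x\<in>R. [:-x, 1:]) dvd q" unfolding g by (intro mult_dvd_mono) auto
  then show ?case using insert.hyps by simp
qed simp

text \<open>A locale of its own, so that the interpretation of \<^locale>\<open>vector_space\<close> by the real vector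
  spaces does not capture the constants below.\<close>

locale field_space = vector_space scale
  for scale :: "'a::field \<Rightarrow> 'b::ab_group_add \<Rightarrow> 'b" (infixr "*s" 75)
begin

definition poly_op :: "('b \<Rightarrow> 'b) \<Rightarrow> 'a poly \<Rightarrow> 'b \<Rightarrow> 'b" where
  "poly_op T q v = (\<Sum>i\<le>degree q. coeff q i *s (T ^^ i) v)"

lemma poly_op_bound:
  fixes q :: "'a poly"
  assumes "degree q \<le> n"
  shows "poly_op T q v = (\<Sum>i\<le>n. coeff q i *s (T ^^ i) v)"
  unfolding poly_op_def using assms
  by (intro sum.mono_neutral_left) (auto simp: coeff_eq_0)

lemma poly_op_0 [simp]: "poly_op T 0 v = 0"
  by (simp add: poly_op_def)

lemma poly_op_1 [simp]: "poly_op T 1 v = v"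
  by (simp add: poly_op_def)

lemma poly_op_add: "poly_op T (p + q) v = poly_op T p v + poly_op T q v"
proof -
  let ?n = "max (degree p) (degree q)"
  have "degree (p + q) \<le> ?n" by (rule degree_add_le_max)
  then show ?thesis
    using poly_op_bound[of _ ?n] by (simp add: scale_left_distrib sum.distrib)
qed

lemma poly_op_smult: "poly_op T (smult c q) v = c *s poly_op T q v"
  using poly_op_bound[OF degree_smult_le, where T = T and v = v]
  by (simp add: poly_op_def scale_sum_right)

lemma poly_op_diff: "poly_op T (p - q) v = poly_op T p v - poly_op T q v"
  using poly_op_add[of T "p - q" q v] by simp

lemma poly_op_pCons: "poly_op T (pCons c q) v = c *s v + poly_op T q (T v)"
proof -
  have "poly_op T (pCons c q) v = (\<Sum>i\<le>Suc (degree q). coeff (pCons c q) i *s (T ^^ i) v)"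
    by (intro poly_op_bound degree_pCons_le)
  also have "\<dots> = c *s v + (\<Sum>i\<le>degree q. coeff q i *s (T ^^ i) (T v))"
    by (simp add: sum.atMost_Suc_shift funpow_swap1 del: sum.atMost_Suc)
  finally show ?thesis by (simp add: poly_op_def)
qed

lemma poly_op_linear_factor: "poly_op T [:-c, 1:] v = T v - c *s v"
  by (simp add: poly_op_pCons)

end

locale linear_operator_on = field_space scale
  for scale :: "'a::field \<Rightarrow> 'b::ab_group_add \<Rightarrow> 'b" (infixr "*s" 75) +
  fixes S :: "'b set" and T :: "'b \<Rightarrow> 'b"
  assumes subspace: "subspace S"
    and closed: "v \<in> S \<Longrightarrow> T v \<in> S"
    and add: "\<lbrakk>u \<in> S; v \<in> S\<rbrakk> \<Longrightarrow> T (u + v) = T u + T v"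
    and scale: "v \<in> S \<Longrightarrow> T (c *s v) = c *s T v"
begin

lemma funpow_closed [simp, intro]: "v \<in> S \<Longrightarrow> (T ^^ n) v \<in> S"
  by (induction n) (auto intro: closed)

lemma funpow_add: "\<lbrakk>u \<in> S; v \<in> S\<rbrakk> \<Longrightarrow> (T ^^ n) (u + v) = (T ^^ n) u + (T ^^ n) v"
  by (induction n) (auto simp: add)

lemma funpow_scale: "v \<in> S \<Longrightarrow> (T ^^ n) (c *s v) = c *s (T ^^ n) v"
  by (induction n) (auto simp: scale)

lemma map_zero [simp]: "T 0 = 0"
  using scale[of 0 0] subspace by (simp add: subspace_0)

lemma map_minus: "v \<in> S \<Longrightarrow> T (- v) = - T v"
  using scale[of v "-1"] by simp

lemma map_diff: "\<lbrakk>u \<in> S; v \<in> S\<rbrakk> \<Longrightarrow> T (u - v) = T u - T v"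
  using add[of u "- v"] subspace_neg[OF subspace] map_minus by simp

lemma funpow_diff: "\<lbrakk>u \<in> S; v \<in> S\<rbrakk> \<Longrightarrow> (T ^^ n) (u - v) = (T ^^ n) u - (T ^^ n) v"
  by (induction n) (auto simp: map_diff)

lemma poly_op_closed [simp, intro]: "v \<in> S \<Longrightarrow> poly_op T q v \<in> S"
  unfolding poly_op_def by (intro subspace_sum subspace_scale) (auto intro: subspace)

lemma poly_op_commute: "v \<in> S \<Longrightarrow> poly_op T q (T v) = T (poly_op T q v)"
proof (induction q arbitrary: v)
  case (pCons c q)
  then show ?case
    using closed add scale subspace subspace_scale by (simp add: poly_op_pCons)
qed simp

lemma poly_op_funpow: "v \<in> S \<Longrightarrow> (T ^^ n) (poly_op T q v) = poly_op T q ((T ^^ n) v)"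
  by (induction n) (simp_all add: poly_op_commute)

lemma poly_op_mult: "v \<in> S \<Longrightarrow> poly_op T (p * q) v = poly_op T p (poly_op T q v)"
proof (induction p arbitrary: v)
  case (pCons c p)
  have "poly_op T (pCons c p * q) v = c *s poly_op T q v + poly_op T p (poly_op T q (T v))"
    using pCons closed by (simp add: poly_op_add poly_op_smult poly_op_pCons)
  then show ?case using pCons.prems by (simp add: poly_op_commute poly_op_pCons)
qed simp

text \<open>The iterates up to exponent \<open>card B\<close> are too many to be independent in the
  span of \<open>B\<close>. Dependence is a notion for sets, so a repeated iterate is a separate
  case; it gives the polynomial \<open>X^i - X^j\<close>.\<close>

lemma ex_annihilating_poly:
  assumes "finite B" and "S \<subseteq> span B" and "v \<in> S"
  shows "\<exists>q. q \<noteq> 0 \<and> degree q \<le> card B \<and> poly_op T q v = 0"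
proof (cases "inj_on (\<lambda>i. (T ^^ i) v) {..card B}")
  case True
  let ?V = "(\<lambda>i. (T ^^ i) v) ` {..card B}"
  have "card ?V = Suc (card B)" using True by (simp add: card_image)
  moreover have "?V \<subseteq> span B" using assms(2,3) by auto
  ultimately have "dependent ?V"
    using independent_span_bound[OF assms(1), of ?V] by auto
  then obtain u w where uw: "w \<in> ?V" "u w \<noteq> 0" and sum: "(\<Sum>w\<in>?V. u w *s w) = 0"
    using dependent_finite[of ?V] by auto
  define q where "q = (\<Sum>i\<le>card B. monom (u ((T ^^ i) v)) i)"
  have cf: "coeff q i = (if i \<le> card B then u ((T ^^ i) v) else 0)" for i
    unfolding q_def by (simp add: coeff_sum if_distrib if_distribR sum.delta cong: if_cong)
  have dq: "degree q \<le> card B" by (rule degree_le) (simp add: cf)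
  have "poly_op T q v = (\<Sum>i\<le>card B. u ((T ^^ i) v) *s (T ^^ i) v)"
    by (simp add: poly_op_bound[OF dq] cf)
  also have "\<dots> = 0" using sum True by (simp add: sum.reindex)
  finally have "poly_op T q v = 0" .
  moreover from uw obtain i where "i \<le> card B" "coeff q i \<noteq> 0" using cf by auto
  then have "q \<noteq> 0" by auto
  ultimately show ?thesis using dq by blast
next
  case False
  then obtain i j where ij: "i \<le> card B" "j \<le> card B" "i \<noteq> j" "(T ^^ i) v = (T ^^ j) v"
    by (auto simp: inj_on_def)
  define q :: "'a poly" where "q = monom 1 i - monom 1 j"
  have dq: "degree q \<le> card B"
    unfolding q_def using ij by (intro degree_diff_le) (auto intro: order_trans[OF degree_monom_le])
  have mono: "poly_op T (monom 1 k) v = (T ^^ k) v" for k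
  proof -
    have "poly_op T (monom 1 k) v = (\<Sum>i\<le>k. coeff (monom 1 k) i *s (T ^^ i) v)"
      by (rule poly_op_bound) (rule degree_monom_le)
    also have "\<dots> = (\<Sum>i\<le>k. if i = k then (T ^^ i) v else 0)"
      by (intro sum.cong) (auto simp: coeff_monom)
    finally show ?thesis by simp
  qed
  have "poly_op T q v = 0" unfolding q_def using ij(4) by (simp add: poly_op_diff mono)
  moreover have "coeff q i \<noteq> 0" using ij(3) by (simp add: q_def)
  then have "q \<noteq> 0" by auto
  ultimately show ?thesis using dq by blast
qed

end

section \<open>Functional calculus in finite-dimensional C*-algebras\<close>

context fd_cstar_algebra
begin

abbreviation amul :: "'a \<Rightarrow> 'a \<Rightarrow> 'a" (infixl "\<odot>" 70) where "a \<odot> b \<equiv> mul A a b"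
abbreviation aadj :: "'a \<Rightarrow> 'a" ("_\<^sup>\<star>" [1000] 999) where "a\<^sup>\<star> \<equiv> adj A a"
abbreviation ascale :: "complex \<Rightarrow> 'a \<Rightarrow> 'a" (infixr "\<cdot>" 75) where "c \<cdot> a \<equiv> smul A c a"
abbreviation aone :: "'a" ("\<one>") where "\<one> \<equiv> unit A"
abbreviation "M \<equiv> carr A"

sublocale V: field_space "smul A"
  unfolding field_space_def by (rule vector_space_smul)

lemma subspace_carr: "V.subspace M"
  using finite_dim V.subspace_span by metis

lemma zero_closed [simp, intro]: "0 \<in> M"
  using subspace_carr by (rule V.subspace_0)

lemma add_closed [simp, intro]: "\<lbrakk>a \<in> M; b \<in> M\<rbrakk> \<Longrightarrow> a + b \<in> M"
  using subspace_carr by (rule V.subspace_add)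

lemma diff_closed [simp, intro]: "\<lbrakk>a \<in> M; b \<in> M\<rbrakk> \<Longrightarrow> a - b \<in> M"
  using subspace_carr by (rule V.subspace_diff)

lemma minus_closed [simp, intro]: "a \<in> M \<Longrightarrow> - a \<in> M"
  using subspace_carr by (rule V.subspace_neg)

lemma scale_closed [simp, intro]: "a \<in> M \<Longrightarrow> c \<cdot> a \<in> M"
  using subspace_carr by (rule V.subspace_scale)

lemma sum_closed [simp, intro]: "(\<And>i. i \<in> R \<Longrightarrow> f i \<in> M) \<Longrightarrow> sum f R \<in> M"
  using subspace_carr by (rule V.subspace_sum)

lemmas algebra_closed [simp, intro] = mul_closed unit_closed adj_closed
lemmas algebra_rules [simp] = mul_assoc unit_left unit_right adj_adj adj_add adj_smul adj_mul
  mul_smul_left mul_smul_right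

lemma mul_zero_left [simp]: "a \<in> M \<Longrightarrow> 0 \<odot> a = 0"
  using mul_add_left[of 0 0 a] by simp

lemma mul_zero_right [simp]: "a \<in> M \<Longrightarrow> a \<odot> 0 = 0"
  using mul_add_right[of a 0 0] by simp

lemma mul_diff_left: "\<lbrakk>a \<in> M; b \<in> M; c \<in> M\<rbrakk> \<Longrightarrow> (a - b) \<odot> c = a \<odot> c - b \<odot> c"
  using mul_add_left[of "a - b" b c] by (simp add: eq_diff_eq)

lemma mul_diff_right: "\<lbrakk>a \<in> M; b \<in> M; c \<in> M\<rbrakk> \<Longrightarrow> a \<odot> (b - c) = a \<odot> b - a \<odot> c"
  using mul_add_right[of a "b - c" c] by (simp add: eq_diff_eq)

lemma mul_minus_left [simp]: "\<lbrakk>a \<in> M; b \<in> M\<rbrakk> \<Longrightarrow> (- a) \<odot> b = - (a \<odot> b)"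
  using mul_diff_left[of 0 a b] by simp

lemma mul_minus_right [simp]: "\<lbrakk>a \<in> M; b \<in> M\<rbrakk> \<Longrightarrow> a \<odot> (- b) = - (a \<odot> b)"
  using mul_diff_right[of a 0 b] by simp

lemmas distrib = mul_add_left mul_add_right mul_diff_left mul_diff_right

lemma adj_zero [simp]: "0\<^sup>\<star> = 0"
  using adj_add[of 0 0] by simp

lemma adj_diff [simp]: "\<lbrakk>a \<in> M; b \<in> M\<rbrakk> \<Longrightarrow> (a - b)\<^sup>\<star> = a\<^sup>\<star> - b\<^sup>\<star>"
  using adj_add[of "a - b" b] by (simp add: eq_diff_eq)

lemma adj_unit [simp]: "\<one>\<^sup>\<star> = \<one>"
  using adj_mul[of \<one> "\<one>\<^sup>\<star>"] by simp

lemma adj_mul_self_eq_0: "\<lbrakk>a \<in> M; a\<^sup>\<star> \<odot> a = 0\<rbrakk> \<Longrightarrow> a = 0"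
  by (metis cstar_identity nrm_eq_0 zero_closed power_eq_0_iff)

definition ev :: "'a \<Rightarrow> complex poly \<Rightarrow> 'a" where
  "ev a q = V.poly_op (mul A a) q \<one>"

lemma linear_mul: "a \<in> M \<Longrightarrow> linear_operator_on (smul A) M (mul A a)"
  by unfold_locales (auto simp: subspace_carr mul_add_right)

lemma poly_op_mul: "\<lbrakk>a \<in> M; b \<in> M; v \<in> M\<rbrakk> \<Longrightarrow>
    V.poly_op (mul A a) q (v \<odot> b) = V.poly_op (mul A a) q v \<odot> b"
proof (induction q arbitrary: v)
  case (pCons c q)
  interpret L: linear_operator_on "smul A" M "mul A a" using pCons.prems by (intro linear_mul)
  have "V.poly_op (mul A a) q (a \<odot> (v \<odot> b)) = V.poly_op (mul A a) q (a \<odot> v) \<odot> b"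
    using pCons.IH[of "a \<odot> v"] pCons.prems by simp
  then show ?case using pCons.prems by (simp add: V.poly_op_pCons distrib)
qed simp

lemma ev_closed [simp, intro]: "a \<in> M \<Longrightarrow> ev a q \<in> M"
  unfolding ev_def by (intro linear_operator_on.poly_op_closed[OF linear_mul]) auto

lemma ev_0 [simp]: "ev a 0 = 0" and ev_1 [simp]: "ev a 1 = \<one>"
  by (simp_all add: ev_def)

lemma ev_add: "ev a (p + q) = ev a p + ev a q"
  by (simp add: ev_def V.poly_op_add)

lemma ev_diff: "ev a (p - q) = ev a p - ev a q"
  by (simp add: ev_def V.poly_op_diff)

lemma ev_smult: "ev a (smult c q) = c \<cdot> ev a q"
  by (simp add: ev_def V.poly_op_smult)

lemma ev_mult: "a \<in> M \<Longrightarrow> ev a (p * q) = ev a p \<odot> ev a q"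
  using linear_operator_on.poly_op_mult[OF linear_mul, of a \<one> p q]
    poly_op_mul[of a "ev a q" \<one> p] ev_closed[of a q]
  by (simp add: ev_def)

lemma ev_const: "ev a [:c:] = c \<cdot> \<one>"
  using ev_smult[of a c 1] by simp

lemma ev_X: "a \<in> M \<Longrightarrow> ev a [:0, 1:] = a"
  by (simp add: ev_def V.poly_op_pCons)

lemma ev_linear_factor: "a \<in> M \<Longrightarrow> ev a [:-c, 1:] = a - c \<cdot> \<one>"
  by (simp add: ev_def V.poly_op_linear_factor)

lemma ev_pCons: "a \<in> M \<Longrightarrow> ev a (pCons c q) = c \<cdot> \<one> + a \<odot> ev a q"
  using ev_add[of a "[:c:]" "[:0, 1:] * q"] ev_mult[of a "[:0, 1:]" q] by (simp add: ev_const ev_X)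

lemma ev_commute_with:
  "\<lbrakk>a \<in> M; b \<in> M; a \<odot> b = b \<odot> a\<rbrakk> \<Longrightarrow> ev a q \<odot> b = b \<odot> ev a q"
proof (induction q)
  case (pCons c q)
  then have "a \<odot> (b \<odot> ev a q) = b \<odot> (a \<odot> ev a q)"
    using mul_assoc[of a b "ev a q"] mul_assoc[of b a "ev a q"] by simp
  then show ?case using pCons by (simp add: ev_pCons distrib)
qed simp

lemma ev_adj: "a \<in> M \<Longrightarrow> a\<^sup>\<star> = a \<Longrightarrow> (ev a q)\<^sup>\<star> = ev a (map_poly cnj q)"
proof (induction q)
  case (pCons c q)
  then show ?case
    using ev_commute_with[of a a "map_poly cnj q"] by (simp add: ev_pCons map_poly_pCons)
qed simp

text \<open>The roots of the minimal polynomial, described without choosing it. For self-adjoint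
  \<open>a\<close> they are real and simple, so a polynomial in \<open>a\<close> depends only on its
  values on this set; this makes \<open>fc\<close> independent of the interpolating
  polynomial.\<close>

definition spec :: "'a \<Rightarrow> complex set" where
  "spec a = {l. \<forall>q. ev a q = 0 \<longrightarrow> poly q l = 0}"

definition fc :: "'a \<Rightarrow> (complex \<Rightarrow> complex) \<Rightarrow> 'a" where
  "fc a f = ev a (SOME q. \<forall>l\<in>spec a. poly q l = f l)"

text \<open>One size of a finite spanning set, fixed once and for all: it bounds the number of
  spectral points of all self-adjoint elements at the same time, and so gives uniform constants in
  norm estimates.\<close>

definition dim_bound :: nat where
  "dim_bound = (SOME n. \<exists>B. finite B \<and> card B = n \<and> M = V.span B)"

lemma dim_bound: "\<exists>B. finite B \<and> card B = dim_bound \<and> M = V.span B"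
proof -
  have "\<exists>n B. finite B \<and> card B = n \<and> M = V.span B" using finite_dim by blast
  then show ?thesis unfolding dim_bound_def by (rule someI_ex)
qed

text \<open>For a root \<open>l\<close> of the minimal polynomial with cofactor \<open>g\<close>,
  the element \<open>v = g(a)\<close> is a nonzero eigenvector. Moving \<open>a\<close> across the
  product of \<open>adj v\<close> and \<open>v\<close> gives \<open>cnj l = l\<close>; a double root
  would put \<open>v\<close> in the range of \<open>a - l\<close> and make that product
  zero.\<close>

lemma spec_hermitian:
  assumes a: "a \<in> M" "a\<^sup>\<star> = a"
  shows "finite (spec a)" and "card (spec a) \<le> dim_bound" and "spec a \<subseteq> \<real>"
    and "ev a q = 0 \<longleftrightarrow> (\<forall>l\<in>spec a. poly q l = 0)"
proof -
  obtain B where B: "finite B" "card B = dim_bound" "M = V.span B" using dim_bound by auto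
  obtain m0 where m0: "m0 \<noteq> 0" "degree m0 \<le> dim_bound" "ev a m0 = 0"
    using linear_operator_on.ex_annihilating_poly[OF linear_mul[OF a(1)] B(1), of \<one>] B
    by (auto simp: ev_def)
  define m where "m = arg_min degree (\<lambda>q. q \<noteq> 0 \<and> ev a q = 0)"
  have m: "m \<noteq> 0" "ev a m = 0"
    using arg_min_natI[of "\<lambda>q. q \<noteq> 0 \<and> ev a q = 0" m0 degree] m0 by (auto simp: m_def)
  have least: "degree m \<le> degree q" if "q \<noteq> 0" "ev a q = 0" for q
    unfolding m_def using that by (intro arg_min_nat_le) auto
  have dvd: "m dvd q" if "ev a q = 0" for q
  proof -
    have "ev a (q mod m) = ev a q - ev a (m * (q div m))"
      by (simp add: ev_diff[symmetric] minus_mult_div_eq_mod)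
    also have "\<dots> = 0" using that m a by (simp add: ev_mult)
    finally have "q mod m = 0" using least degree_mod_less'[OF m(1), of q] by fastforce
    then show ?thesis by auto
  qed
  have roots: "spec a = {l. poly m l = 0}"
    unfolding spec_def using m(2) dvd by (auto, metis dvd_trans poly_eq_0_iff_dvd)
  show "finite (spec a)" unfolding roots using m(1) by (rule poly_roots_finite)
  have "card (spec a) \<le> degree m" unfolding roots using m(1) by (rule card_poly_roots_bound)
  also have "\<dots> \<le> dim_bound" using least[OF m0(1,3)] m0(2) by simp
  finally show "card (spec a) \<le> dim_bound" .
  have root: "l \<in> \<real> \<and> order l m = 1" if ml: "poly m l = 0" for l
  proof -
    obtain g where g: "m = [:-l, 1:] * g" using ml unfolding poly_eq_0_iff_dvd dvd_def by blast
    have g0: "g \<noteq> 0" using m(1) g by auto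
    have "degree m = degree [:-l, 1:] + degree g"
      unfolding g using g0 by (intro degree_mult_eq) auto
    then have "degree g < degree m" by simp
    define v where "v = ev a g"
    have vM: "v \<in> M" using a by (simp add: v_def)
    have v0: "v \<noteq> 0" using least[OF g0] \<open>degree g < degree m\<close> by (auto simp: v_def)
    from v0 have vv: "v\<^sup>\<star> \<odot> v \<noteq> 0" using adj_mul_self_eq_0[OF vM] by blast
    have "(a - l \<cdot> \<one>) \<odot> v = 0"
      using m(2) a unfolding g v_def by (simp only: ev_mult ev_linear_factor)
    then have av: "a \<odot> v = l \<cdot> v" using a vM by (simp add: distrib)
    have "(v\<^sup>\<star> \<odot> a) \<odot> v = l \<cdot> (v\<^sup>\<star> \<odot> v)" using av a vM by simp
    moreover have "(v\<^sup>\<star> \<odot> a) \<odot> v = (a \<odot> v)\<^sup>\<star> \<odot> v" using a vM by simp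
    then have "(v\<^sup>\<star> \<odot> a) \<odot> v = cnj l \<cdot> (v\<^sup>\<star> \<odot> v)" using av vM by simp
    ultimately have "(l - cnj l) \<cdot> (v\<^sup>\<star> \<odot> v) = 0"
      by (auto simp: V.scale_left_diff_distrib)
    then have "cnj l = l" using vv by simp
    then have real: "l \<in> \<real>" by (simp add: Reals_cnj_iff)
    have "poly g l \<noteq> 0"
    proof
      assume "poly g l = 0"
      then obtain h where h: "g = [:-l, 1:] * h" unfolding poly_eq_0_iff_dvd dvd_def by blast
      have vh: "v = (a - l \<cdot> \<one>) \<odot> ev a h" unfolding v_def h using a by
        (simp only: ev_mult ev_linear_factor)
      have "(a - l \<cdot> \<one>)\<^sup>\<star> = a - l \<cdot> \<one>" using a \<open>cnj l = l\<close> by simp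
      then have "v\<^sup>\<star> = (ev a h)\<^sup>\<star> \<odot> (a - l \<cdot> \<one>)" using a by (subst vh, subst adj_mul) auto
      then have "v\<^sup>\<star> \<odot> v = (ev a h)\<^sup>\<star> \<odot> ((a - l \<cdot> \<one>) \<odot> v)" using a vM by (simp del: adj_diff)
      also have "\<dots> = 0" using \<open>(a - l \<cdot> \<one>) \<odot> v = 0\<close> a by simp
      finally show False using vv by simp
    qed
    then have "order l g = 0" by (simp add: order_0I)
    moreover have "order l m = order l [:-l, 1:] + order l g"
      unfolding g using m(1) g by (intro order_mult) auto
    moreover have "order l [:-l, 1:] = 1" using order_power_n_n[of l 1] by simp
    ultimately show ?thesis using real by simp
  qed
  show "spec a \<subseteq> \<real>" unfolding roots using root by blast
  have "rsquarefree m"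
    unfolding rsquarefree_def using m(1) root by (metis order_0I)
  \<comment> \<open>A squarefree complex polynomial is, up to a constant, the product of its linear
    factors, so vanishing on \<open>spec a\<close> means divisibility by \<open>m\<close>.\<close>
  then have mP: "smult (lead_coeff m) (\<Prod>l\<in>spec a. [:-l, 1:]) = m"
    unfolding roots by (rule complex_poly_decompose_rsquarefree)
  show "ev a q = 0 \<longleftrightarrow> (\<forall>l\<in>spec a. poly q l = 0)"
  proof
    assume "ev a q = 0"
    then show "\<forall>l\<in>spec a. poly q l = 0" by (auto simp: spec_def)
  next
    assume "\<forall>l\<in>spec a. poly q l = 0"
    then have "(\<Prod>l\<in>spec a. [:-l, 1:]) dvd q"
      using prod_linear_factors_dvd[OF \<open>finite (spec a)\<close>] by blast
    then have "m dvd q" using m(1) mP by (metis smult_dvd_iff leading_coeff_0_iff)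
    then show "ev a q = 0" using m(2) a by (auto elim!: dvdE simp: ev_mult)
  qed
qed

lemma ex_fc_poly:
  assumes "a \<in> M" and "a\<^sup>\<star> = a"
  shows "\<exists>q. (\<forall>l\<in>spec a. poly q l = f l) \<and> fc a f = ev a q"
  unfolding fc_def using someI_ex[OF ex_interpolating_poly[OF spec_hermitian(1)[OF assms], of f]]
  by blast

lemma fc_eq_ev:
  assumes "a \<in> M" "a\<^sup>\<star> = a" and "\<And>l. l \<in> spec a \<Longrightarrow> poly q l = f l"
  shows "fc a f = ev a q"
proof -
  obtain q' where q': "\<forall>l\<in>spec a. poly q' l = f l" "fc a f = ev a q'"
    using ex_fc_poly[OF assms(1,2)] by blast
  have "ev a (q' - q) = 0" using q' assms by (subst spec_hermitian) auto
  then show ?thesis using q' by (simp add: ev_diff)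
qed

context
  fixes a assumes a: "a \<in> M" "a\<^sup>\<star> = a"
begin

lemma fc_closed [simp, intro]: "fc a f \<in> M"
  using a by (simp add: fc_def)

lemma fc_add: "fc a (\<lambda>x. f x + g x) = fc a f + fc a g"
proof -
  obtain p where p: "\<forall>l\<in>spec a. poly p l = f l" "fc a f = ev a p" using ex_fc_poly[OF a] by blast
  obtain q where q: "\<forall>l\<in>spec a. poly q l = g l" "fc a g = ev a q" using ex_fc_poly[OF a] by blast
  show ?thesis using fc_eq_ev[OF a, of "p + q"] p q by (simp add: ev_add)
qed

lemma fc_mult: "fc a f \<odot> fc a g = fc a (\<lambda>x. f x * g x)"
proof -
  obtain p where p: "\<forall>l\<in>spec a. poly p l = f l" "fc a f = ev a p" using ex_fc_poly[OF a] by blast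
  obtain q where q: "\<forall>l\<in>spec a. poly q l = g l" "fc a g = ev a q" using ex_fc_poly[OF a] by blast
  show ?thesis using fc_eq_ev[OF a, of "p * q"] p q a by (simp add: ev_mult)
qed

lemma fc_cmult: "fc a (\<lambda>x. c * f x) = c \<cdot> fc a f"
proof -
  obtain p where p: "\<forall>l\<in>spec a. poly p l = f l" "fc a f = ev a p" using ex_fc_poly[OF a] by blast
  show ?thesis using fc_eq_ev[OF a, of "smult c p"] p by (simp add: ev_smult)
qed

lemma fc_diff: "fc a (\<lambda>x. f x - g x) = fc a f - fc a g"
  using fc_add[of f "\<lambda>x. (-1) * g x"] by (simp only: fc_cmult) simp

lemma fc_0: "fc a (\<lambda>x. 0) = 0"
  using fc_eq_ev[OF a, of 0] by simp

lemma fc_1: "fc a (\<lambda>x. 1) = \<one>"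
  using fc_eq_ev[OF a, of 1] by simp

lemma fc_id: "fc a (\<lambda>x. x) = a"
  using fc_eq_ev[OF a, of "[:0, 1:]"] a by (simp add: ev_X)

lemma fc_cong: "(\<And>l. l \<in> spec a \<Longrightarrow> f l = g l) \<Longrightarrow> fc a f = fc a g"
  using ex_fc_poly[OF a, of f] fc_eq_ev[OF a] by metis

lemma fc_adj: "(fc a f)\<^sup>\<star> = fc a (\<lambda>x. cnj (f x))"
proof -
  obtain p where p: "\<forall>l\<in>spec a. poly p l = f l" "fc a f = ev a p" using ex_fc_poly[OF a] by blast
  have "poly (map_poly cnj p) l = cnj (f l)" if "l \<in> spec a" for l
  proof -
    have "cnj l = l" using that spec_hermitian(3)[OF a] Reals_cnj_iff by blast
    then have "poly (map_poly cnj p) l = cnj (poly p l)" by (metis poly_cnj)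
    then show ?thesis using p that by simp
  qed
  then show ?thesis using fc_eq_ev[OF a, of "map_poly cnj p"] p a by (simp add: ev_adj)
qed

lemma fc_eq_0_iff: "fc a f = 0 \<longleftrightarrow> (\<forall>l\<in>spec a. f l = 0)"
  using ex_fc_poly[OF a, of f] spec_hermitian(4)[OF a] by force

lemma fc_commute_with: "\<lbrakk>b \<in> M; a \<odot> b = b \<odot> a\<rbrakk> \<Longrightarrow> fc a f \<odot> b = b \<odot> fc a f"
  using ex_fc_poly[OF a, of f] a ev_commute_with by metis

lemma fc_sum: "finite R \<Longrightarrow> fc a (\<lambda>x. \<Sum>i\<in>R. f i x) = (\<Sum>i\<in>R. fc a (f i))"
  by (induction R rule: finite_induct) (simp_all add: fc_0 fc_add)

lemma positive_fc:
  assumes "\<And>l. l \<in> spec a \<Longrightarrow> 0 \<le> f l"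
  shows "positive A (fc a f)"
proof -
  let ?g = "\<lambda>x. complex_of_real (sqrt (Re (f x)))"
  have "(fc a ?g)\<^sup>\<star> \<odot> fc a ?g = fc a (\<lambda>x. ?g x * ?g x)" by (simp add: fc_adj fc_mult)
  also have "\<dots> = fc a f"
  proof (rule fc_cong)
    fix l assume "l \<in> spec a"
    then have "0 \<le> f l" by (rule assms)
    then show "?g l * ?g l = f l"
      by (simp add: less_eq_complex_def complex_eq_iff flip: of_real_mult)
  qed
  finally show ?thesis unfolding positive_def by (metis fc_closed)
qed

end

end

section \<open>Positivity in the presence of a faithful trace\<close>

locale traced_algebra = fd_cstar_algebra A for A :: "'a::ab_group_add star_algebra" +
  fixes \<tau> :: "'a \<Rightarrow> complex"
  assumes trace: "positive_faithful_trace A \<tau>"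
begin

lemma tr_add: "\<lbrakk>a \<in> M; b \<in> M\<rbrakk> \<Longrightarrow> \<tau> (a + b) = \<tau> a + \<tau> b"
  and tr_scale: "a \<in> M \<Longrightarrow> \<tau> (c \<cdot> a) = c * \<tau> a"
  and tr_commute: "\<lbrakk>a \<in> M; b \<in> M\<rbrakk> \<Longrightarrow> \<tau> (a \<odot> b) = \<tau> (b \<odot> a)"
  and tr_pos: "a \<in> M \<Longrightarrow> 0 \<le> \<tau> (a\<^sup>\<star> \<odot> a)"
  and tr_faithful: "\<lbrakk>a \<in> M; \<tau> (a\<^sup>\<star> \<odot> a) = 0\<rbrakk> \<Longrightarrow> a = 0"
  using trace unfolding positive_faithful_trace_def
  by (auto simp: less_eq_complex_def complex_is_Real_iff)

lemma tr_zero [simp]: "\<tau> 0 = 0"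
  using tr_add[of 0 0] by simp

lemma tr_diff: "\<lbrakk>a \<in> M; b \<in> M\<rbrakk> \<Longrightarrow> \<tau> (a - b) = \<tau> a - \<tau> b"
  using tr_add[of "a - b" b] by (simp add: eq_diff_eq)

text \<open>Polarisation: the trace form is real at \<open>\<one> + x\<close> and at
  \<open>\<one> + \<i> \<cdot> x\<close>, which settles the imaginary and the real part.\<close>

lemma tr_adj:
  assumes x: "x \<in> M"
  shows "\<tau> (x\<^sup>\<star>) = cnj (\<tau> x)"
proof -
  have "\<tau> ((\<one> + x)\<^sup>\<star> \<odot> (\<one> + x)) = \<tau> \<one> + \<tau> x + \<tau> (x\<^sup>\<star>) + \<tau> (x\<^sup>\<star> \<odot> x)"
    using x by (simp add: distrib tr_add algebra_simps)
  moreover have "\<tau> ((\<one> + \<i> \<cdot> x)\<^sup>\<star> \<odot> (\<one> + \<i> \<cdot> x)) =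
      \<tau> \<one> + \<i> * \<tau> x - \<i> * \<tau> (x\<^sup>\<star>) + \<tau> (x\<^sup>\<star> \<odot> x)"
    using x by (simp add: distrib tr_add tr_diff tr_scale algebra_simps)
  moreover have "0 \<le> \<tau> \<one>" using tr_pos[of \<one>] by simp
  ultimately have "Im (\<tau> x + \<tau> (x\<^sup>\<star>)) = 0" "Im (\<i> * \<tau> x - \<i> * \<tau> (x\<^sup>\<star>)) = 0"
    using tr_pos[of x] tr_pos[of "\<one> + x"] tr_pos[of "\<one> + \<i> \<cdot> x"] x
    by (simp_all add: less_eq_complex_def)
  then show ?thesis by (simp add: complex_eq_iff)
qed

lemma positive_closed [intro]: "positive A a \<Longrightarrow> a \<in> M"
  by (auto simp: positive_def)

lemma positive_adj: "positive A a \<Longrightarrow> a\<^sup>\<star> = a"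
  by (auto simp: positive_def)

lemma positive_square: "b \<in> M \<Longrightarrow> positive A (b\<^sup>\<star> \<odot> b)"
  by (auto simp: positive_def)

lemma positive_square': "b \<in> M \<Longrightarrow> positive A (b \<odot> b\<^sup>\<star>)"
  using positive_square[of "b\<^sup>\<star>"] by simp

lemma positive_conj: "\<lbrakk>positive A a; c \<in> M\<rbrakk> \<Longrightarrow> positive A (c\<^sup>\<star> \<odot> a \<odot> c)"
  unfolding positive_def by (metis adj_mul mul_closed mul_assoc adj_closed)

section \<open>Spectral projections and tests for positivity\<close>

definition ep :: "'a \<Rightarrow> complex \<Rightarrow> 'a" where
  "ep a l = fc a (\<lambda>x. if x = l then 1 else 0)"

context
  fixes a assumes a: "a \<in> M" "a\<^sup>\<star> = a"
begin

lemma ep_closed [simp, intro]: "ep a l \<in> M"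
  using a by (simp add: ep_def)

lemma ep_adj: "(ep a l)\<^sup>\<star> = ep a l"
  unfolding ep_def by (simp add: fc_adj[OF a] if_distrib cong: if_cong)

lemma ep_idem: "ep a l \<odot> ep a l = ep a l"
  unfolding ep_def by (simp add: fc_mult[OF a] if_distrib cong: if_cong)

lemma ep_sandwich: "(ep a l)\<^sup>\<star> \<odot> fc a f \<odot> ep a l = f l \<cdot> ep a l"
proof -
  have "(ep a l)\<^sup>\<star> \<odot> fc a f \<odot> ep a l =
      fc a (\<lambda>x. (if x = l then 1 else 0) * (f x * (if x = l then 1 else 0)))"
    using a by (simp add: ep_adj) (simp add: ep_def fc_mult)
  also have "\<dots> = fc a (\<lambda>x. f l * (if x = l then 1 else 0))"
    by (intro arg_cong[where f = "fc a"] ext) simp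
  finally show ?thesis by (simp add: fc_cmult[OF a] ep_def)
qed

lemma tr_ep_pos: "l \<in> spec a \<Longrightarrow> 0 < \<tau> (ep a l)"
proof -
  assume l: "l \<in> spec a"
  have "ep a l \<noteq> 0" unfolding ep_def fc_eq_0_iff[OF a] using l by auto
  then show ?thesis
    using tr_faithful[of "ep a l"] tr_pos[of "ep a l"] by (auto simp: ep_adj ep_idem order_less_le)
qed

end

text \<open>Testing with spectral projections. The form of \<open>k\<close>, a multiple of the
  imaginary part of \<open>a\<close>, vanishes, so 0 is its only possible spectral value and
  \<open>a\<close> is self-adjoint; then the test element \<open>ep a l\<close> shows that each
  spectral value \<open>l\<close> is nonnegative.\<close>

lemma positiveI:
  assumes a: "a \<in> M" and pos: "\<And>c. c \<in> M \<Longrightarrow> 0 \<le> \<tau> (c\<^sup>\<star> \<odot> a \<odot> c)"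
  shows "positive A a"
proof -
  define k where "k = \<i> \<cdot> (a - a\<^sup>\<star>)"
  have k: "k \<in> M" "k\<^sup>\<star> = k"
    using a by (simp_all add: k_def V.scale_right_diff_distrib)
  have zero: "\<tau> (c\<^sup>\<star> \<odot> k \<odot> c) = 0" if c: "c \<in> M" for c
  proof -
    have "\<tau> (c\<^sup>\<star> \<odot> a\<^sup>\<star> \<odot> c) = cnj (\<tau> (c\<^sup>\<star> \<odot> a \<odot> c))"
      using tr_adj[of "c\<^sup>\<star> \<odot> a \<odot> c"] a c by simp
    also have "\<dots> = \<tau> (c\<^sup>\<star> \<odot> a \<odot> c)" using pos[OF c] by
      (simp add: less_eq_complex_def complex_eq_iff)
    finally show ?thesis using a c by (simp add: k_def distrib tr_diff tr_scale)
  qed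
  have "l = 0" if l: "l \<in> spec k" for l
    using zero[of "ep k l"] ep_sandwich[OF k, of l "\<lambda>x. x"] tr_ep_pos[OF k l]
    by (auto simp add: k ep_closed fc_id tr_scale)
  then have "k = 0" using fc_eq_0_iff[OF k, of "\<lambda>x. x"] by (simp add: fc_id[OF k])
  then have h: "a\<^sup>\<star> = a" by (simp add: k_def)
  have "0 \<le> l" if l: "l \<in> spec a" for l
  proof -
    have "0 \<le> l * \<tau> (ep a l)"
      using pos[of "ep a l"] ep_sandwich[OF a h, of l "\<lambda>x. x"]
      by (simp add: a h ep_closed fc_id tr_scale)
    moreover have "l \<in> \<real>" using spec_hermitian(3)[OF a h] l by blast
    ultimately show ?thesis using tr_ep_pos[OF a h l]
      by (auto simp: less_eq_complex_def less_complex_def complex_is_Real_iff zero_le_mult_iff)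
  qed
  then show ?thesis using positive_fc[OF a h, of "\<lambda>x. x"] by (simp add: fc_id[OF a h])
qed

lemma tr_conj_nonneg: "\<lbrakk>positive A a; c \<in> M\<rbrakk> \<Longrightarrow> 0 \<le> \<tau> (c\<^sup>\<star> \<odot> a \<odot> c)"
  using positive_conj[of a c] tr_pos unfolding positive_def by metis

lemma positive_tr_nonneg: "positive A a \<Longrightarrow> 0 \<le> \<tau> a"
  using tr_pos unfolding positive_def by auto

lemma spec_nonneg:
  assumes "positive A a" and "l \<in> spec a"
  shows "0 \<le> l"
proof -
  have a: "a \<in> M" "a\<^sup>\<star> = a" using assms positive_adj by auto
  have "0 \<le> l * \<tau> (ep a l)"
    using tr_conj_nonneg[OF assms(1), of "ep a l"] ep_sandwich[OF a, of l "\<lambda>x. x"]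
    by (simp add: a ep_closed fc_id tr_scale)
  moreover have "l \<in> \<real>" using spec_hermitian(3)[OF a] assms(2) by blast
  ultimately show ?thesis using tr_ep_pos[OF a assms(2)]
    by (auto simp: less_eq_complex_def less_complex_def complex_is_Real_iff zero_le_mult_iff)
qed

lemma positive_add: "\<lbrakk>positive A a; positive A b\<rbrakk> \<Longrightarrow> positive A (a + b)"
proof (rule positiveI)
  fix c assume "positive A a" "positive A b" and c: "c \<in> M"
  then show "0 \<le> \<tau> (c\<^sup>\<star> \<odot> (a + b) \<odot> c)"
    using tr_conj_nonneg[of a c] tr_conj_nonneg[of b c] positive_closed[of a] positive_closed[of b]
    by (simp add: distrib tr_add)
qed auto

lemma positive_scale:
  assumes "positive A a" and "0 \<le> t"
  shows "positive A (complex_of_real t \<cdot> a)"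
proof (rule positiveI)
  fix c assume c: "c \<in> M"
  have "0 \<le> complex_of_real t" using assms(2) by (simp add: less_eq_complex_def)
  then show "0 \<le> \<tau> (c\<^sup>\<star> \<odot> (complex_of_real t \<cdot> a) \<odot> c)"
    using tr_conj_nonneg[OF assms(1) c] c positive_closed[OF assms(1)] by (simp add: tr_scale)
qed (use assms in auto)

lemma positive_zero: "positive A 0"
  using positive_square[of 0] by simp

lemma positive_tr_zero: "\<lbrakk>positive A a; \<tau> a = 0\<rbrakk> \<Longrightarrow> a = 0"
  unfolding positive_def using tr_faithful by force

lemma positive_conj_zero:
  assumes "positive A a" "c \<in> M" "\<tau> (c\<^sup>\<star> \<odot> a \<odot> c) = 0"
  shows "a \<odot> c = 0"
proof -
  obtain b where b: "b \<in> M" "a = b\<^sup>\<star> \<odot> b" using assms by (auto simp: positive_def)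
  have "(b \<odot> c)\<^sup>\<star> \<odot> (b \<odot> c) = c\<^sup>\<star> \<odot> a \<odot> c" using b assms by simp
  then have "b \<odot> c = 0" using tr_faithful[of "b \<odot> c"] b assms by simp
  then show ?thesis using b assms by simp
qed

lemma positive_mul_zero:
  assumes "positive A a" "positive A b" "\<tau> (a \<odot> b) = 0"
  shows "a \<odot> b = 0"
proof -
  obtain d where d: "d \<in> M" "b = d\<^sup>\<star> \<odot> d" using assms by (auto simp: positive_def)
  have aM: "a \<in> M" using assms by auto
  have "\<tau> (a \<odot> b) = \<tau> ((d\<^sup>\<star>)\<^sup>\<star> \<odot> a \<odot> d\<^sup>\<star>)"
    using tr_commute[of "a \<odot> d\<^sup>\<star>" d] d aM by simp
  then have "a \<odot> d\<^sup>\<star> = 0" using positive_conj_zero[OF assms(1), of "d\<^sup>\<star>"] assms d by simp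
  then have "a \<odot> d\<^sup>\<star> \<odot> d = 0" using d by simp
  then show ?thesis using d aM by simp
qed

lemma positive_antisym:
  assumes "positive A a" "positive A (- a)"
  shows "a = 0"
proof -
  have "\<tau> (- a) = - \<tau> a" using tr_diff[of 0 a] assms by auto
  then have "\<tau> a = 0" using positive_tr_nonneg[OF assms(1)] positive_tr_nonneg[OF assms(2)] by simp
  then show ?thesis using assms positive_tr_zero by blast
qed

lemma below_antisym: "\<lbrakk>below A a b; below A b a\<rbrakk> \<Longrightarrow> a = b"
  using positive_antisym[of "b - a"] by (simp add: below_def)

text \<open>Compression by \<open>\<one> - q\<close> kills \<open>b\<close>, so the compressions of
  \<open>a\<close> and of \<open>- a\<close> both have nonnegative trace; hence both traces
  vanish.\<close>

lemma below_absorb: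
  assumes "positive A a" "below A a b" "projection A q" "q \<odot> b = b" "b \<in> M"
  shows "q \<odot> a = a" "a \<odot> q = a"
proof -
  have q: "q \<in> M" "q\<^sup>\<star> = q" "q \<odot> q = q" using assms by (auto simp: projection_def)
  have aM: "a \<in> M" using assms by auto
  let ?c = "\<one> - q"
  have cb: "?c \<odot> b = 0" using q assms by (simp add: distrib)
  have "?c\<^sup>\<star> \<odot> (b - a) \<odot> ?c = (?c \<odot> b - ?c \<odot> a) \<odot> ?c"
    using q aM assms(5) by (simp add: mul_diff_right del: mul_assoc)
  also have "\<dots> = - (?c\<^sup>\<star> \<odot> a \<odot> ?c)" using cb q aM by simp
  finally have "?c\<^sup>\<star> \<odot> (b - a) \<odot> ?c = - (?c\<^sup>\<star> \<odot> a \<odot> ?c)" .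
  then have "0 \<le> \<tau> (- (?c\<^sup>\<star> \<odot> a \<odot> ?c))"
    using tr_conj_nonneg[of "b - a" ?c] assms q by (simp add: below_def)
  moreover have "\<tau> (- (?c\<^sup>\<star> \<odot> a \<odot> ?c)) = - \<tau> (?c\<^sup>\<star> \<odot> a \<odot> ?c)"
    using tr_diff[of 0 "?c\<^sup>\<star> \<odot> a \<odot> ?c"] q aM by simp
  moreover have "0 \<le> \<tau> (?c\<^sup>\<star> \<odot> a \<odot> ?c)" using tr_conj_nonneg[OF assms(1), of ?c] q by simp
  ultimately have "\<tau> (?c\<^sup>\<star> \<odot> a \<odot> ?c) = 0" by simp
  then have "a \<odot> ?c = 0" using positive_conj_zero[OF assms(1), of ?c] q by simp
  then show aq: "a \<odot> q = a" using aM q by (simp add: distrib)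
  have "(a \<odot> q)\<^sup>\<star> = q \<odot> a" using aM q positive_adj[OF assms(1)] by simp
  then show "q \<odot> a = a" using aq positive_adj[OF assms(1)] by simp
qed

lemma projection_positive: "projection A p \<Longrightarrow> positive A p"
  unfolding projection_def positive_def by metis

lemma projection_below_iff:
  assumes "projection A p" "projection A q"
  shows "below A p q \<longleftrightarrow> q \<odot> p = p"
proof
  assume "below A p q"
  then show "q \<odot> p = p"
    using below_absorb(1)[of p q q] assms projection_positive by (auto simp: projection_def)
next
  assume qp: "q \<odot> p = p"
  have p: "p \<in> M" "p\<^sup>\<star> = p" "p \<odot> p = p" and q: "q \<in> M" "q\<^sup>\<star> = q" "q \<odot> q = q"
    using assms by (auto simp: projection_def)
  have pq: "p \<odot> q = p" using arg_cong[OF qp, of "adj A"] p q by simp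
  have "projection A (q - p)"
    unfolding projection_def using p q pq qp by (simp add: distrib)
  then show "below A p q" unfolding below_def by (rule projection_positive)
qed

lemma projection_complement: "projection A p \<Longrightarrow> projection A (\<one> - p)"
  by (auto simp: projection_def distrib)

section \<open>Support projections, pseudo-inverses and norm bounds\<close>

definition rp :: "'a \<Rightarrow> 'a" where
  "rp a = fc a (\<lambda>x. if x = 0 then 0 else 1)"

text \<open>Since \<open>inverse 0 = 0\<close>, this is the pseudo-inverse, zero off the support of
  \<open>a\<close>.\<close>

definition pinv :: "'a \<Rightarrow> 'a" where
  "pinv a = fc a inverse"

context
  fixes a assumes a: "a \<in> M" "a\<^sup>\<star> = a"
begin

lemma rp_projection: "projection A (rp a)"
  unfolding projection_def rp_def
  by (simp add: a fc_adj[OF a] fc_mult[OF a] if_distrib cong: if_cong)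

lemma pinv_closed [simp, intro]: "pinv a \<in> M"
  using a by (simp add: pinv_def)

lemma rp_mul: "rp a \<odot> a = a"
  and mul_pinv: "a \<odot> pinv a = rp a" and pinv_mul: "pinv a \<odot> a = rp a"
proof -
  have "rp a \<odot> fc a (\<lambda>x. x) = fc a (\<lambda>x. x)"
    "fc a (\<lambda>x. x) \<odot> pinv a = rp a" "pinv a \<odot> fc a (\<lambda>x. x) = rp a"
    unfolding rp_def pinv_def fc_mult[OF a] by (auto intro!: fc_cong[OF a])
  then show "rp a \<odot> a = a" "a \<odot> pinv a = rp a" "pinv a \<odot> a = rp a"
    by (simp_all add: fc_id[OF a])
qed

lemma rp_absorb: "\<lbrakk>q \<in> M; q \<odot> a = a\<rbrakk> \<Longrightarrow> q \<odot> rp a = rp a"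
  using mul_assoc[of q a "pinv a"] a by (simp add: mul_pinv)

lemma rp_annihilate: "\<lbrakk>q \<in> M; q \<odot> a = 0\<rbrakk> \<Longrightarrow> q \<odot> rp a = 0"
  using mul_assoc[of q a "pinv a"] a by (simp add: mul_pinv)

lemma range_proj_eq: "range_proj A a = rp a"
  unfolding range_proj_def
proof (rule the_equality)
  show *: "projection A (rp a) \<and> rp a \<odot> a = a \<and>
      (\<forall>q. projection A q \<and> q \<odot> a = a \<longrightarrow> below A (rp a) q)"
    using rp_projection rp_mul rp_absorb projection_below_iff by (auto simp: projection_def)
  fix p assume "projection A p \<and> p \<odot> a = a \<and>
      (\<forall>q. projection A q \<and> q \<odot> a = a \<longrightarrow> below A p q)"
  then show "p = rp a" using * below_antisym by blast
qed

lemma fc_scalar_diff: "fc a (\<lambda>x. c - x) = c \<cdot> \<one> - a"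
  using fc_diff[OF a, of "\<lambda>x. c * 1" "\<lambda>x. x"] fc_cmult[OF a, of c "\<lambda>x. 1"]
  by (simp add: fc_id[OF a] fc_1[OF a])

lemma nrm_ep: "nrm A (ep a l) \<le> 1"
proof -
  have "nrm A (ep a l) = (nrm A (ep a l))\<^sup>2"
    using cstar_identity[of "ep a l"] by (simp add: ep_adj[OF a] ep_idem[OF a] ep_closed[OF a])
  then show ?thesis by (auto simp: power2_eq_square)
qed

lemma spectral_sum: "a = (\<Sum>l\<in>spec a. l \<cdot> ep a l)"
proof -
  have "a = fc a (\<lambda>x. \<Sum>l\<in>spec a. l * (if x = l then 1 else 0))"
    by (subst fc_id[OF a, symmetric], rule fc_cong[OF a])
      (simp add: spec_hermitian(1)[OF a] if_distrib cong: if_cong)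
  then show ?thesis
    by (simp only: fc_sum[OF a spec_hermitian(1)[OF a]] fc_cmult[OF a] ep_def)
qed

lemma nrm_sum:
  assumes "finite R" and "\<And>i. i \<in> R \<Longrightarrow> f i \<in> M"
  shows "nrm A (\<Sum>i\<in>R. f i) \<le> (\<Sum>i\<in>R. nrm A (f i))"
  using assms
proof (induction R rule: finite_induct)
  case empty
  show ?case using nrm_eq_0[of 0] by simp
next
  case (insert i R)
  then have "nrm A (f i + (\<Sum>i\<in>R. f i)) \<le> nrm A (f i) + nrm A (\<Sum>i\<in>R. f i)"
    by (intro nrm_add) auto
  then show ?case using insert by force
qed

text \<open>Triangle inequality for the spectral sum, whose projections have norm at most 1. The
  factor is crude but the same for all \<open>a\<close>, which suffices for bounds along a
  sequence.\<close>

lemma nrm_le_spec: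
  fixes t :: real
  assumes "0 \<le> t" and "\<And>l. l \<in> spec a \<Longrightarrow> cmod l \<le> t"
  shows "nrm A a \<le> dim_bound * t"
proof -
  have "nrm A a \<le> (\<Sum>l\<in>spec a. nrm A (l \<cdot> ep a l))"
    by (subst spectral_sum) (intro nrm_sum spec_hermitian(1)[OF a] scale_closed ep_closed[OF a])
  also have "\<dots> \<le> (\<Sum>l\<in>spec a. t)"
  proof (rule sum_mono)
    fix l assume "l \<in> spec a"
    then have "cmod l * nrm A (ep a l) \<le> t * 1"
      using assms nrm_ep nrm_nonneg ep_closed[OF a] by (intro mult_mono) auto
    then show "nrm A (l \<cdot> ep a l) \<le> t" by (simp add: nrm_smul ep_closed[OF a])
  qed
  also have "\<dots> \<le> dim_bound * t"
    using spec_hermitian(2)[OF a] assms(1) by (simp add: mult_right_mono)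
  finally show ?thesis .
qed

end

lemma nrm_le_below:
  fixes t :: real
  assumes "positive A a" and "0 \<le> t" and "below A a (complex_of_real t \<cdot> \<one>)"
  shows "nrm A a \<le> dim_bound * t"
proof -
  have a: "a \<in> M" "a\<^sup>\<star> = a" using assms(1) positive_adj by auto
  have "cmod l \<le> t" if l: "l \<in> spec a" for l
  proof -
    have "0 \<le> (complex_of_real t - l) * \<tau> (ep a l)"
      using tr_conj_nonneg[of "complex_of_real t \<cdot> \<one> - a" "ep a l"] assms(3)
        ep_sandwich[OF a, of l "\<lambda>x. complex_of_real t - x"]
      by (simp add: a ep_closed fc_scalar_diff tr_scale below_def)
    moreover have "l \<in> \<real>" using spec_hermitian(3)[OF a] l by blast
    ultimately have "Re l \<le> t" using tr_ep_pos[OF a l]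
      by (auto simp: less_eq_complex_def less_complex_def complex_is_Real_iff zero_le_mult_iff)
    then show ?thesis using spec_nonneg[OF assms(1) l]
      by (simp add: less_eq_complex_def cmod_eq_Re)
  qed
  then show ?thesis using nrm_le_spec[OF a assms(2)] by blast
qed

lemma positive_le_scalar:
  assumes "positive A a"
  shows "\<exists>t\<ge>0. below A a (complex_of_real t \<cdot> \<one>) \<and> below A a (complex_of_real t \<cdot> rp a)"
proof -
  have a: "a \<in> M" "a\<^sup>\<star> = a" using assms(1) positive_adj by auto
  \<comment> \<open>Any number above all spectral values serves; a sum, unlike a maximum, is also
    defined for an empty spectrum.\<close>
  define t where "t = (\<Sum>l\<in>spec a. cmod l)"
  have t0: "0 \<le> t" unfolding t_def by (rule sum_nonneg) simp
  have le: "l \<le> complex_of_real t" if l: "l \<in> spec a" for l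
  proof -
    have "cmod l \<le> t" unfolding t_def by (rule member_le_sum[OF l])
      (simp_all add: spec_hermitian(1)[OF a])
    moreover have "l \<in> \<real>" using spec_hermitian(3)[OF a] l by blast
    ultimately show ?thesis
      by (auto simp: less_eq_complex_def complex_is_Real_iff intro:
        order_trans[OF complex_Re_le_cmod])
  qed
  have "positive A (fc a (\<lambda>x. complex_of_real t - x))"
    by (rule positive_fc[OF a]) (use le in simp)
  then have "below A a (complex_of_real t \<cdot> \<one>)" by (simp only: below_def fc_scalar_diff[OF a])
  moreover have "positive A (fc a (\<lambda>x. complex_of_real t * (if x = 0 then 0 else 1) - x))"
    by (rule positive_fc[OF a]) (use le in simp)
  ultimately show ?thesis
    using t0 by (auto simp: below_def fc_diff[OF a] fc_cmult[OF a] fc_id[OF a] rp_def)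
qed

lemma rp_le_positive:
  assumes "positive A a"
  shows "\<exists>t>0. below A (complex_of_real t \<cdot> rp a) a"
proof -
  have a: "a \<in> M" "a\<^sup>\<star> = a" using assms(1) positive_adj by auto
  \<comment> \<open>The smallest positive spectral value, capped by 1; the 1 keeps the set nonempty
    when \<open>a = 0\<close>.\<close>
  define t where "t = Min (insert 1 (Re ` (spec a - {0})))"
  have fin: "finite (insert 1 (Re ` (spec a - {0})))" using spec_hermitian(1)[OF a] by simp
  have pos: "0 < Re l" if "l \<in> spec a" "l \<noteq> 0" for l
    using spec_nonneg[OF assms that(1)] that(2) by (auto simp: less_eq_complex_def complex_eq_iff)
  then have t0: "0 < t" unfolding t_def using fin by (subst Min_gr_iff) auto
  have "positive A (fc a (\<lambda>x. x - complex_of_real t * (if x = 0 then 0 else 1)))"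
  proof (rule positive_fc[OF a])
    fix l assume l: "l \<in> spec a"
    show "0 \<le> l - complex_of_real t * (if l = 0 then 0 else 1)"
    proof (cases "l = 0")
      case False
      then have "t \<le> Re l" unfolding t_def using fin l by (intro Min_le) auto
      then show ?thesis using spec_nonneg[OF assms l] False by (simp add: less_eq_complex_def)
    qed simp
  qed
  then show ?thesis
    using t0 by (auto simp: below_def fc_diff[OF a] fc_cmult[OF a] fc_id[OF a] rp_def)
qed

section \<open>Square roots and meets of projections\<close>

definition sq :: "'a \<Rightarrow> 'a" where
  "sq a = fc a (\<lambda>x. complex_of_real (sqrt (Re x)))"

text \<open>Division by zero yields 0, so the spectral value 0 contributes nothing, as
  \<open>corner_inverse\<close> requires off the support.\<close>

definition isq :: "'a \<Rightarrow> 'a" where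
  "isq a = fc a (\<lambda>x. complex_of_real (1 / sqrt (Re x)))"

context
  fixes a assumes pos: "positive A a"
begin

lemma herm: "a \<in> M" "a\<^sup>\<star> = a"
  using pos positive_adj by auto

lemma sq_closed [simp, intro]: "sq a \<in> M" and isq_closed [simp, intro]: "isq a \<in> M"
  by (simp_all add: sq_def isq_def herm)

lemma sq_adj: "(sq a)\<^sup>\<star> = sq a" and isq_adj: "(isq a)\<^sup>\<star> = isq a"
  by (simp_all add: sq_def isq_def fc_adj[OF herm])

lemma sq_positive: "positive A (sq a)"
  unfolding sq_def
  by (rule positive_fc[OF herm]) (use spec_nonneg[OF pos] in \<open>auto simp: less_eq_complex_def\<close>)

lemma sq_sq: "sq a \<odot> sq a = a"
proof -
  have "sq a \<odot> sq a = fc a (\<lambda>x. x)"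
    unfolding sq_def fc_mult[OF herm]
    by (rule fc_cong[OF herm])
      (use spec_nonneg[OF pos] in \<open>auto simp: less_eq_complex_def complex_eq_iff\<close>)
  then show ?thesis by (simp add: fc_id[OF herm])
qed

lemma spec_Re_eq_0: "l \<in> spec a \<Longrightarrow> Re l = 0 \<longleftrightarrow> l = 0"
  using spec_nonneg[OF pos, of l] by (auto simp: less_eq_complex_def complex_eq_iff)

lemma sq_isq: "sq a \<odot> isq a = rp a" and isq_sq: "isq a \<odot> sq a = rp a"
  and rp_sq: "rp a \<odot> sq a = sq a" and sq_rp: "sq a \<odot> rp a = sq a"
  and rp_isq: "rp a \<odot> isq a = isq a" and isq_rp: "isq a \<odot> rp a = isq a"
  unfolding sq_def isq_def rp_def fc_mult[OF herm]
  by (auto intro!: fc_cong[OF herm] simp: spec_Re_eq_0)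

text \<open>Uniqueness: another root \<open>b\<close> commutes with \<open>a\<close>, hence with
  \<open>sq a\<close>, so \<open>sq a + b\<close> kills the difference \<open>d\<close>. The forms
  of both roots at \<open>d\<close> are nonnegative with sum zero; so each root kills
  \<open>d\<close>, and \<open>d\<close> has square zero.\<close>

lemma pos_sqrt_eq: "pos_sqrt A a = sq a"
  unfolding pos_sqrt_def
proof (rule the_equality)
  show "positive A (sq a) \<and> sq a \<odot> sq a = a" using sq_positive sq_sq by blast
  fix b assume b: "positive A b \<and> b \<odot> b = a"
  then have bM: "b \<in> M" "b\<^sup>\<star> = b" using positive_adj by auto
  have "a \<odot> b = b \<odot> a" using b bM by (metis mul_assoc)
  then have com: "sq a \<odot> b = b \<odot> sq a" unfolding sq_def by (intro fc_commute_with herm bM)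
  define d where "d = sq a - b"
  have d: "d \<in> M" "d\<^sup>\<star> = d" using bM by (simp_all add: d_def sq_adj)
  have "(sq a + b) \<odot> d = 0"
    using bM b com by (simp add: d_def distrib sq_sq)
  then have "d\<^sup>\<star> \<odot> (sq a \<odot> d + b \<odot> d) = 0" using d bM by (simp add: distrib)
  then have "d\<^sup>\<star> \<odot> sq a \<odot> d + d\<^sup>\<star> \<odot> b \<odot> d = 0" using d bM by (simp add: distrib)
  then have "\<tau> (d\<^sup>\<star> \<odot> sq a \<odot> d) + \<tau> (d\<^sup>\<star> \<odot> b \<odot> d) = 0"
    using d bM by (simp flip: tr_add)
  moreover have "0 \<le> \<tau> (d\<^sup>\<star> \<odot> sq a \<odot> d)" by (rule tr_conj_nonneg[OF sq_positive d(1)])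
  moreover have "0 \<le> \<tau> (d\<^sup>\<star> \<odot> b \<odot> d)" by (rule tr_conj_nonneg[OF conjunct1[OF b] d(1)])
  ultimately have "\<tau> (d\<^sup>\<star> \<odot> sq a \<odot> d) = 0" "\<tau> (d\<^sup>\<star> \<odot> b \<odot> d) = 0"
    by (simp_all add: add_nonneg_eq_0_iff)
  then have "sq a \<odot> d = 0" "b \<odot> d = 0"
    using positive_conj_zero[OF sq_positive d(1)] positive_conj_zero[OF conjunct1[OF b] d(1)] by
      blast+
  then have "d\<^sup>\<star> \<odot> d = 0" unfolding d(2) by (subst (1) d_def) (use d bM in \<open>simp add: distrib\<close>)
  then have "d = 0" using adj_mul_self_eq_0 d by blast
  then show "b = sq a" by (simp add: d_def)
qed

lemma corner_inverse_eq: "corner_inverse A (rp a) (sq a) = isq a"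
  unfolding corner_inverse_def
proof (rule the_equality)
  show "isq a \<in> M \<and> rp a \<odot> isq a = isq a \<and> isq a \<odot> rp a = isq a \<and>
      sq a \<odot> isq a = rp a \<and> isq a \<odot> sq a = rp a"
    by (simp add: sq_isq isq_sq rp_isq isq_rp)
  fix b assume b: "b \<in> M \<and> rp a \<odot> b = b \<and> b \<odot> rp a = b \<and>
      sq a \<odot> b = rp a \<and> b \<odot> sq a = rp a"
  then have "b = b \<odot> (sq a \<odot> isq a)" by (simp add: sq_isq)
  also have "\<dots> = rp a \<odot> isq a" using b mul_assoc[of b "sq a" "isq a"] by simp
  finally show "b = isq a" by (simp add: rp_isq)
qed

end

text \<open>The meet is the complement of the support of \<open>(\<one> - p) + (\<one> - q)\<close>.
  Exhibiting it allows the description in \<open>proj_meet\<close> to be evaluated.\<close>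

lemma proj_meet_eq_0D:
  assumes p: "projection A p" and q: "projection A q" and "proj_meet A p q = 0"
    and m: "projection A m" "p \<odot> m = m" "q \<odot> m = m"
  shows "m = 0"
proof -
  define a where "a = (\<one> - p) + (\<one> - q)"
  have pq: "p \<in> M" "p\<^sup>\<star> = p" "p \<odot> p = p" "q \<in> M" "q\<^sup>\<star> = q" "q \<odot> q = q"
    using p q by (auto simp: projection_def)
  note cp = projection_positive[OF projection_complement[OF p]]
    and cq = projection_positive[OF projection_complement[OF q]]
  have pa: "positive A a" unfolding a_def using cp cq by (rule positive_add)
  then have ah: "a \<in> M" "a\<^sup>\<star> = a" using positive_adj by auto
  have R: "projection A (rp a)" "rp a \<odot> a = a" using rp_projection[OF ah] rp_mul[OF ah] by auto
  then have RM: "rp a \<in> M" "(rp a)\<^sup>\<star> = rp a" by (auto simp: projection_def)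
  let ?m = "\<one> - rp a"
  have pm: "projection A ?m" by (rule projection_complement[OF R(1)])
  have "below A (\<one> - p) a" "below A (\<one> - q) a" using cp cq by (simp_all add: below_def a_def)
  then have "(\<one> - p) \<odot> rp a = \<one> - p" "(\<one> - q) \<odot> rp a = \<one> - q"
    using below_absorb(2) cp cq R ah by blast+
  then have mp: "p \<odot> ?m = ?m" and mq: "q \<odot> ?m = ?m"
    using pq RM by (simp_all add: distrib algebra_simps)
  have great: "?m \<odot> m' = m'" if m': "projection A m'" "p \<odot> m' = m'" "q \<odot> m' = m'" for m'
  proof -
    have mM: "m' \<in> M" "m'\<^sup>\<star> = m'" using m' by (auto simp: projection_def)
    have "m' \<odot> p = m'" "m' \<odot> q = m'"
      using arg_cong[OF m'(2), of "adj A"] arg_cong[OF m'(3), of "adj A"] mM pq by simp_all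
    then have "m' \<odot> a = 0" using mM pq by (simp add: a_def distrib)
    then have "m' \<odot> rp a = 0" using rp_annihilate[OF ah] mM by blast
    moreover have "rp a \<odot> m' = (m' \<odot> rp a)\<^sup>\<star>" using mM RM by simp
    ultimately have "rp a \<odot> m' = 0" by simp
    then show ?thesis using mM RM by (simp add: distrib)
  qed
  have "proj_meet A p q = ?m"
    unfolding proj_meet_def
  proof (rule the_equality)
    show *: "projection A ?m \<and> below A ?m p \<and> below A ?m q \<and>
        (\<forall>m'. projection A m' \<and> below A m' p \<and> below A m' q \<longrightarrow> below A m' ?m)"
      using pm mp mq great projection_below_iff p q by blast
    fix m1 assume "projection A m1 \<and> below A m1 p \<and> below A m1 q \<and>
        (\<forall>m'. projection A m' \<and> below A m' p \<and> below A m' q \<longrightarrow> below A m' m1)"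
    then show "m1 = ?m" using * below_antisym by blast
  qed
  then have "?m = 0" using assms(3) by simp
  then show ?thesis using great[OF m] m(1) by (simp add: projection_def)
qed

end

section \<open>Perron-Frobenius eigenvectors of positive maps\<close>

lemma tendsto_complex_nonneg:
  fixes f :: "'i \<Rightarrow> complex"
  assumes "(f \<longlongrightarrow> L) F" and "eventually (\<lambda>t. 0 \<le> f t) F" and "F \<noteq> bot"
  shows "0 \<le> L"
proof -
  have "0 \<le> Re L"
    by (rule tendsto_lowerbound[OF tendsto_Re[OF assms(1)] _ assms(3)])
      (use assms(2) in \<open>auto elim: eventually_mono simp: less_eq_complex_def\<close>)
  moreover have "((\<lambda>t. Im (f t)) \<longlongrightarrow> 0) F"
    by (rule tendsto_eventually) (use assms(2) in \<open>auto elim: eventually_mono simp: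
      less_eq_complex_def\<close>)
  then have "Im L = 0" using tendsto_unique[OF assms(3) tendsto_Im[OF assms(1)]] by simp
  ultimately show ?thesis by (simp add: less_eq_complex_def)
qed

text \<open>Each coefficient of the quotient by \<open>X - z\<close> is a polynomial in
  \<open>z\<close>. This lets \<open>z\<close> tend to \<open>r\<close> in the formula for the
  resolvent.\<close>

lemma isCont_coeff_synthetic_div:
  "isCont (\<lambda>z::complex. coeff (synthetic_div q z) i) a"
proof (induction q arbitrary: i)
  case (pCons c q)
  show ?case by (cases i) (use pCons in auto)
qed simp

context fd_cstar_algebra
begin

lemma norm_limit_eq:
  assumes "w \<in> M" and "((\<lambda>t. nrm A (f t - w)) \<longlongrightarrow> 0) F" and "F \<noteq> bot"
    and "eventually (\<lambda>t. f t \<in> M) F"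
  shows "norm_limit A F f = w"
  unfolding norm_limit_def
proof (rule the_equality)
  fix w' assume w': "w' \<in> M \<and> ((\<lambda>t. nrm A (f t - w')) \<longlongrightarrow> 0) F"
  have "eventually (\<lambda>t. nrm A (w' - w) \<le> nrm A (f t - w) + nrm A (f t - w')) F"
    using assms(4)
  proof eventually_elim
    case (elim t)
    have "nrm A (w' - w) \<le> nrm A (f t - w) + nrm A (w' - f t)"
      using nrm_add[of "f t - w" "w' - f t"] elim w' assms(1) by simp
    moreover have "nrm A (w' - f t) = nrm A (f t - w')"
      using nrm_smul[of "f t - w'" "-1"] elim w' by simp
    ultimately show ?case by simp
  qed
  moreover have "((\<lambda>t. nrm A (f t - w) + nrm A (f t - w')) \<longlongrightarrow> 0) F"
    using tendsto_add[OF assms(2) conjunct2[OF w']] by simp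
  ultimately have "nrm A (w' - w) \<le> 0"
    by (intro tendsto_lowerbound[OF _ _ assms(3)]) auto
  then show "w' = w" using nrm_nonneg[of "w' - w"] nrm_eq_0[of "w' - w"] w' assms(1) by simp
qed (use assms in simp)

end

locale positive_map = traced_algebra A \<tau> for A :: "'a::ab_group_add star_algebra" and \<tau> +
  fixes \<Phi> :: "'a \<Rightarrow> 'a"
  assumes map_closed [simp, intro]: "a \<in> M \<Longrightarrow> \<Phi> a \<in> M"
    and map_add: "\<lbrakk>a \<in> M; b \<in> M\<rbrakk> \<Longrightarrow> \<Phi> (a + b) = \<Phi> a + \<Phi> b"
    and map_scale: "a \<in> M \<Longrightarrow> \<Phi> (c \<cdot> a) = c \<cdot> \<Phi> a"
    and map_positive: "positive A a \<Longrightarrow> positive A (\<Phi> a)"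
begin

sublocale L: linear_operator_on "smul A" M \<Phi>
  by unfold_locales (auto simp: subspace_carr map_add map_scale)

definition cone :: "real \<Rightarrow> 'a set" where
  "cone r = {y. positive A y \<and> \<Phi> y = complex_of_real r \<cdot> y}"

lemma cone_add: "\<lbrakk>y \<in> cone r; z \<in> cone r\<rbrakk> \<Longrightarrow> y + z \<in> cone r"
  by (auto simp: cone_def positive_add map_add V.scale_right_distrib positive_closed)

lemma cone_zero: "0 \<in> cone r"
  by (simp add: cone_def positive_zero)

lemma cone_sum: "(\<And>b. b \<in> B \<Longrightarrow> b \<in> cone r) \<Longrightarrow> \<Sum>B \<in> cone r"
  by (induction B rule: infinite_finite_induct) (auto simp: cone_zero cone_add)

text \<open>The sum of a finite subset of the cone that spans the cone has maximal support.\<close>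

lemma ex_maximal_support: "\<exists>y\<in>cone r. \<forall>z\<in>cone r. rp y \<odot> z = z"
proof -
  obtain B where B: "B \<subseteq> cone r" "V.independent B" "cone r \<subseteq> V.span B"
    using V.maximal_independent_subset[of "cone r"] by blast
  obtain B0 where "finite B0" "M = V.span B0" using dim_bound by auto
  moreover have "B \<subseteq> M" using B(1) by (auto simp: cone_def)
  ultimately have fin: "finite B" using V.independent_span_bound[of B0 B] B(2) by blast
  let ?y = "\<Sum>B"
  have y: "?y \<in> cone r" using B(1) by (intro cone_sum) auto
  then have ypos: "positive A ?y" by (simp add: cone_def)
  then have yh: "?y \<in> M" "?y\<^sup>\<star> = ?y" using positive_adj by auto
  have R: "projection A (rp ?y)" "rp ?y \<odot> ?y = ?y" using rp_projection[OF yh] rp_mul[OF yh] by auto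
  have "rp ?y \<odot> b = b" if b: "b \<in> B" for b
  proof -
    have "\<Sum>(B - {b}) \<in> cone r" using B(1) by (intro cone_sum) auto
    moreover have "?y = b + \<Sum>(B - {b})" using fin b by (simp add: sum.remove)
    ultimately have "below A b ?y" by (simp add: below_def cone_def)
    moreover have "positive A b" using B(1) b by (auto simp: cone_def)
    ultimately show ?thesis using below_absorb(1) R yh by blast
  qed
  moreover have "V.subspace {v \<in> M. rp ?y \<odot> v = v}"
    using R(1) by (auto simp: V.subspace_def distrib projection_def)
  ultimately have "V.span B \<subseteq> {v \<in> M. rp ?y \<odot> v = v}"
    using \<open>B \<subseteq> M\<close> by (intro V.span_minimal) auto
  then show ?thesis using y B(3) by blast
qed

lemma map_below: "\<lbrakk>below A a b; a \<in> M; b \<in> M\<rbrakk> \<Longrightarrow> below A (\<Phi> a) (\<Phi> b)"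
  using map_positive[of "b - a"] by (simp add: below_def L.map_diff)

lemma below_trans: "\<lbrakk>below A a b; below A b c\<rbrakk> \<Longrightarrow> below A a c"
  using positive_add[of "b - a" "c - b"] by (simp add: below_def)

lemma below_scale: "\<lbrakk>below A a b; 0 \<le> t\<rbrakk> \<Longrightarrow> below A (complex_of_real t \<cdot> a) (complex_of_real t \<cdot> b)"
  using positive_scale[of "b - a" t] by (simp add: below_def V.scale_right_diff_distrib)

end

locale pf_data = positive_map A \<tau> \<Phi> for A :: "'a::ab_group_add star_algebra" and \<tau> \<Phi> +
  fixes r :: real and y0 :: 'a
  assumes y0_cone: "y0 \<in> cone r" and y0_max: "z \<in> cone r \<Longrightarrow> rp y0 \<odot> z = z"
begin

abbreviation "p \<equiv> rp y0"
abbreviation "R \<equiv> complex_of_real r"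

lemma y0: "positive A y0" "y0 \<in> M" "y0\<^sup>\<star> = y0" "\<Phi> y0 = R \<cdot> y0"
  using y0_cone positive_adj by (auto simp: cone_def)

lemma p: "projection A p" "p \<in> M" "p\<^sup>\<star> = p" "p \<odot> p = p" "positive A p"
  using rp_projection[OF y0(2,3)] projection_positive by (auto simp: projection_def)

lemma p_y0: "p \<odot> y0 = y0"
  using rp_mul[OF y0(2,3)] .

text \<open>Iterating \<open>\<Phi>\<close> on this bound shows that the iterates of
  \<open>p\<close> grow at most like \<open>r ^ j\<close>. The reverse bound
  \<open>below_y0_p\<close> keeps the limit \<open>\<zeta>\<close> from losing support.\<close>

lemma below_p_y0: "\<exists>C>0. below A p (complex_of_real C \<cdot> y0)"
proof -
  obtain t where t: "t > 0" "below A (complex_of_real t \<cdot> p) y0"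
    using rp_le_positive[OF y0(1)] by blast
  have "below A p (complex_of_real (1 / t) \<cdot> y0)"
    using below_scale[OF t(2), of "1 / t"] t(1) by simp
  then show ?thesis using t(1) by (intro exI[of _ "1 / t"]) simp
qed

lemma below_y0_p: "\<exists>c>0. below A (complex_of_real c \<cdot> y0) p"
proof -
  obtain t where t: "t \<ge> 0" "below A y0 (complex_of_real t \<cdot> p)"
    using positive_le_scalar[OF y0(1)] by blast
  \<comment> \<open>\<open>t\<close> may be 0; the shift by 1 makes the factor invertible.\<close>
  have "below A (complex_of_real t \<cdot> p) (complex_of_real (t + 1) \<cdot> p)"
    using p by (simp add: below_def V.scale_left_distrib)
  with t(2) have "below A y0 (complex_of_real (t + 1) \<cdot> p)" by (rule below_trans)
  moreover have "complex_of_real t + 1 \<noteq> 0" using t(1) by (simp add: complex_eq_iff)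
  ultimately have "below A (complex_of_real (1 / (t + 1)) \<cdot> y0) p" 
    using below_scale[of y0 _ "1 / (t + 1)"] t(1) by fastforce
  then show ?thesis using t(1) by (intro exI[of _ "1 / (t + 1)"]) simp
qed

lemma iter_y0: "(\<Phi> ^^ j) y0 = complex_of_real (r ^ j) \<cdot> y0"
  by (induction j) (simp_all add: y0 map_scale mult_ac)

lemma iter_positive: "positive A a \<Longrightarrow> positive A ((\<Phi> ^^ j) a)"
  by (induction j) (simp_all add: map_positive)

lemma iter_below:
  assumes "below A a b" "a \<in> M" "b \<in> M"
  shows "below A ((\<Phi> ^^ j) a) ((\<Phi> ^^ j) b)"
  by (induction j) (use assms in \<open>auto intro: map_below\<close>)

lemma r_nonneg: "y0 \<noteq> 0 \<Longrightarrow> 0 \<le> r"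
proof -
  assume "y0 \<noteq> 0"
  then have "\<tau> y0 \<noteq> 0" using positive_tr_zero y0 by blast
  then have "0 < Re (\<tau> y0)" "Im (\<tau> y0) = 0"
    using positive_tr_nonneg[OF y0(1)] by (auto simp: less_eq_complex_def complex_eq_iff)
  moreover have "0 \<le> R * \<tau> y0"
    using positive_tr_nonneg[OF map_positive[OF y0(1)]] y0 by (simp add: tr_scale)
  ultimately show ?thesis by (simp add: less_eq_complex_def zero_le_mult_iff)
qed

text \<open>\<open>\<nu>\<close> is instantiated both with the norm and with the modulus of the functionals
  \<open>v \<mapsto> \<tau> (d\<^sup>\<star> v d)\<close>, which detect positivity.\<close>

definition dominated :: "('a \<Rightarrow> real) \<Rightarrow> bool" where
  "dominated \<nu> \<longleftrightarrow> (\<forall>u\<in>M. 0 \<le> \<nu> u) \<and> (\<forall>u\<in>M. \<forall>v\<in>M. \<nu> (u + v) \<le> \<nu> u + \<nu> v) \<and>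
     (\<forall>c. \<forall>u\<in>M. \<nu> (c \<cdot> u) = cmod c * \<nu> u) \<and> (\<exists>C. \<forall>j. \<nu> ((\<Phi> ^^ j) p) \<le> C * r ^ j)"

lemma dominated_sum:
  assumes "dominated \<nu>" and "\<And>i. i \<in> I \<Longrightarrow> f i \<in> M"
  shows "\<nu> (\<Sum>i\<in>I. f i) \<le> (\<Sum>i\<in>I. \<nu> (f i))"
proof -
  have z: "\<nu> 0 = 0"
    using assms(1) unfolding dominated_def by
      (metis V.scale_zero_left norm_zero mult_zero_left zero_closed)
  show ?thesis using assms(2)
  proof (induction I rule: infinite_finite_induct)
    case (insert i I)
    then have "\<nu> (f i + (\<Sum>i\<in>I. f i)) \<le> \<nu> (f i) + \<nu> (\<Sum>i\<in>I. f i)"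
      using assms(1) unfolding dominated_def by auto
    then show ?case using insert by force
  qed (simp_all add: z)
qed

lemma dominated_iter:
  assumes nu: "dominated \<nu>"
  shows "\<exists>K. \<forall>n. \<nu> ((\<Phi> ^^ n) (V.poly_op \<Phi> q p)) \<le> K * r ^ n"
proof -
  obtain C where C: "\<And>j. \<nu> ((\<Phi> ^^ j) p) \<le> C * r ^ j" using nu by (auto simp: dominated_def)
  have hom: "\<nu> (c \<cdot> u) = cmod c * \<nu> u" if "u \<in> M" for c u using nu that by
    (auto simp: dominated_def)
  have "\<nu> ((\<Phi> ^^ n) (V.poly_op \<Phi> q p)) \<le> (\<Sum>i\<le>degree q. cmod (coeff q i) * C * r ^ i) * r ^ n" for n
  proof -
    have "\<nu> ((\<Phi> ^^ n) (V.poly_op \<Phi> q p)) =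
        \<nu> (\<Sum>i\<le>degree q. coeff q i \<cdot> (\<Phi> ^^ i) ((\<Phi> ^^ n) p))"
      by (subst L.poly_op_funpow[OF p(2)]) (simp only: V.poly_op_def)
    also have "\<dots> \<le> (\<Sum>i\<le>degree q. \<nu> (coeff q i \<cdot> (\<Phi> ^^ i) ((\<Phi> ^^ n) p)))"
      using p by (intro dominated_sum[OF nu]) auto
    also have "\<dots> \<le> (\<Sum>i\<le>degree q. cmod (coeff q i) * C * r ^ i * r ^ n)"
    proof (rule sum_mono)
      fix i
      have "\<nu> ((\<Phi> ^^ i) ((\<Phi> ^^ n) p)) \<le> C * r ^ (i + n)" using C[of "i + n"] by
        (simp add: funpow_add)
      then show "\<nu> (coeff q i \<cdot> (\<Phi> ^^ i) ((\<Phi> ^^ n) p)) \<le> cmod (coeff q i) * C * r ^ i * r ^ n"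
        using p by (simp add: hom power_add mult_left_mono mult.assoc)
    qed
    finally show ?thesis by (simp add: sum_distrib_right)
  qed
  then show ?thesis by blast
qed

lemma dominated_nrm:
  assumes "0 \<le> r"
  shows "dominated (nrm A)"
proof -
  obtain C where C: "C > 0" "below A p (complex_of_real C \<cdot> y0)" using below_p_y0 by blast
  obtain t where t: "t \<ge> 0" "below A y0 (complex_of_real t \<cdot> \<one>)"
    using positive_le_scalar[OF y0(1)] by blast
  have *: "nrm A ((\<Phi> ^^ j) p) \<le> dim_bound * (C * t) * r ^ j" for j
  proof -
    have "below A ((\<Phi> ^^ j) p) ((\<Phi> ^^ j) (complex_of_real C \<cdot> y0))"
      using C p y0 by (intro iter_below) auto
    also have "(\<Phi> ^^ j) (complex_of_real C \<cdot> y0) = complex_of_real (C * r ^ j) \<cdot> y0"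
      using y0 by (simp add: L.funpow_scale iter_y0)
    finally have "below A ((\<Phi> ^^ j) p) (complex_of_real (C * r ^ j) \<cdot> y0)" .
    moreover have "below A (complex_of_real (C * r ^ j) \<cdot> y0)
        (complex_of_real (C * r ^ j) \<cdot> complex_of_real t \<cdot> \<one>)"
      using t C assms by (intro below_scale) auto
    ultimately have "below A ((\<Phi> ^^ j) p) (complex_of_real (C * r ^ j * t) \<cdot> \<one>)"
      using below_trans by (simp add: mult.assoc)
    then have "nrm A ((\<Phi> ^^ j) p) \<le> dim_bound * (C * r ^ j * t)"
      using C t assms p by (intro nrm_le_below iter_positive) auto
    then show ?thesis by (simp add: mult_ac)
  qed
  show ?thesis unfolding dominated_def
    by (intro conjI ballI allI exI[of _ "dim_bound * (C * t)"] nrm_nonneg nrm_add nrm_smul *)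
qed

lemma dominated_functional:
  assumes "0 \<le> r" and d: "d \<in> M"
  shows "dominated (\<lambda>v. cmod (\<tau> (d\<^sup>\<star> \<odot> v \<odot> d)))"
proof -
  obtain C where C: "C > 0" "below A p (complex_of_real C \<cdot> y0)" using below_p_y0 by blast
  let ?F = "\<lambda>v. \<tau> (d\<^sup>\<star> \<odot> v \<odot> d)"
  have "cmod (?F ((\<Phi> ^^ j) p)) \<le> C * cmod (?F y0) * r ^ j" for j
  proof -
    have "below A ((\<Phi> ^^ j) p) ((\<Phi> ^^ j) (complex_of_real C \<cdot> y0))"
      using C p y0 by (intro iter_below) auto
    also have "(\<Phi> ^^ j) (complex_of_real C \<cdot> y0) = complex_of_real (C * r ^ j) \<cdot> y0"
      using y0 by (simp add: L.funpow_scale iter_y0)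
    finally have "0 \<le> ?F (complex_of_real (C * r ^ j) \<cdot> y0 - (\<Phi> ^^ j) p)"
      using d by (intro tr_conj_nonneg) (auto simp: below_def)
    then have "?F ((\<Phi> ^^ j) p) \<le> complex_of_real (C * r ^ j) * ?F y0"
      using d p y0 by (simp add: distrib tr_diff tr_scale)
    moreover have "0 \<le> ?F ((\<Phi> ^^ j) p)" by (intro tr_conj_nonneg iter_positive p d)
    moreover have "0 \<le> ?F y0" by (intro tr_conj_nonneg y0 d)
    ultimately show ?thesis by (simp add: less_eq_complex_def cmod_eq_Re mult_ac)
  qed
  moreover have "cmod (?F (u + v)) \<le> cmod (?F u) + cmod (?F v)" if "u \<in> M" "v \<in> M" for u v
    using that d by (simp add: distrib tr_add norm_triangle_ineq)
  moreover have "cmod (?F (c \<cdot> u)) = cmod c * cmod (?F u)" if "u \<in> M" for c u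
    using that d by (simp add: tr_scale norm_mult)
  ultimately show ?thesis unfolding dominated_def by (auto simp del: mul_assoc)
qed

text \<open>On a Jordan chain the iterates of \<open>v\<close> contain the term
  \<open>n r^(n-1) W\<close>, while \<open>dominated_iter\<close> bounds them by
  \<open>K r^n\<close>.\<close>

lemma no_jordan_block:
  assumes r: "0 \<le> r" and v: "v = V.poly_op \<Phi> q p" and W: "W = \<Phi> v - R \<cdot> v" and ev: "\<Phi> W = R \<cdot> W"
  shows "W = 0"
proof -
  have vM: "v \<in> M" using v p by auto
  have WM: "W \<in> M" using W vM by auto
  obtain K where K: "\<And>n. nrm A ((\<Phi> ^^ n) v) \<le> K * r ^ n"
    using dominated_iter[OF dominated_nrm[OF r], of q] v by blast
  show ?thesis
  proof (cases "r = 0")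
    case True
    then have "nrm A (\<Phi> v) \<le> 0" using K[of 1] by simp
    then have "\<Phi> v = 0" using nrm_nonneg[of "\<Phi> v"] nrm_eq_0[of "\<Phi> v"] vM by simp
    then show ?thesis using W True by simp
  next
    case False
    then have r0: "0 < r" using r by simp
    \<comment> \<open>Multiplied by \<open>R\<close> to avoid the exponent
      \<open>n - 1\<close>.\<close>
    have iter: "R \<cdot> (\<Phi> ^^ n) v = R ^ Suc n \<cdot> v + (of_nat n * R ^ n) \<cdot> W" for n
    proof (induction n)
      case (Suc n)
      have "R \<cdot> (\<Phi> ^^ Suc n) v = \<Phi> (R \<cdot> (\<Phi> ^^ n) v)" using vM by (simp add: map_scale)
      also have "\<dots> = R ^ Suc n \<cdot> \<Phi> v + (of_nat n * R ^ n) \<cdot> \<Phi> W"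
        unfolding Suc using vM WM by (simp add: map_add map_scale)
      also have "\<dots> = R ^ Suc n \<cdot> (W + R \<cdot> v) + (of_nat n * R ^ n) \<cdot> (R \<cdot> W)"
        using W ev by simp
      finally show ?case
        by (simp add: V.scale_right_distrib V.scale_left_distrib algebra_simps)
    qed simp
    have "real n * nrm A W \<le> r * (K + nrm A v)" for n
    proof -
      have "r ^ n * (real n * nrm A W) = nrm A ((of_nat n * R ^ n) \<cdot> W)"
        using r WM by (simp only: nrm_smul) (simp add: norm_mult norm_power)
      also have "(of_nat n * R ^ n) \<cdot> W = R \<cdot> (\<Phi> ^^ n) v + (- (R ^ Suc n)) \<cdot> v"
        using iter[of n] by simp
      also have "nrm A \<dots> \<le> nrm A (R \<cdot> (\<Phi> ^^ n) v) + nrm A ((- (R ^ Suc n)) \<cdot> v)"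
        using vM by (intro nrm_add) auto
      also have "nrm A (R \<cdot> (\<Phi> ^^ n) v) = r * nrm A ((\<Phi> ^^ n) v)"
        using r vM by (simp add: nrm_smul)
      also have "nrm A ((- (R ^ Suc n)) \<cdot> v) = r ^ Suc n * nrm A v"
        using r vM by (simp only: nrm_smul) (simp add: norm_mult norm_power)
      also have "r * nrm A ((\<Phi> ^^ n) v) \<le> r * (K * r ^ n)"
        using K[of n] r by (rule mult_left_mono)
      finally have "r ^ n * (real n * nrm A W) \<le> r ^ n * (r * (K + nrm A v))"
        by (simp add: algebra_simps)
      then show ?thesis using r0 by simp
    qed
    then have "nrm A W \<le> 0"
      using reals_Archimedean3[of "nrm A W"] by (meson not_le)
    then show ?thesis using nrm_nonneg[OF WM] nrm_eq_0[OF WM] by simp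
  qed
qed

text \<open>Split an annihilating polynomial of \<open>p\<close> into a power of
  \<open>X - R\<close> and a factor \<open>g\<close> that is nonzero at \<open>R\<close>. As long as
  the exponent exceeds one, \<open>no_jordan_block\<close> lowers it, so \<open>q = g\<close>
  works.\<close>

lemma ex_simple_root_poly:
  assumes r: "0 \<le> r"
  shows "\<exists>q. poly q R \<noteq> 0 \<and> V.poly_op \<Phi> ([:-R, 1:] * q) p = 0"
proof -
  obtain B where B: "finite B" "M = V.span B" using dim_bound by auto
  then obtain m0 where m0: "m0 \<noteq> 0" "V.poly_op \<Phi> m0 p = 0"
    using L.ex_annihilating_poly[OF B(1), of p] p by auto
  obtain g where g: "m0 = [:-R, 1:] ^ order R m0 * g" "\<not> [:-R, 1:] dvd g"
    using order_decomp[OF m0(1)] by blast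
  define w where "w j = V.poly_op \<Phi> ([:-R, 1:] ^ j * g) p" for j
  have wM: "w j \<in> M" for j using p by (auto simp: w_def)
  have wS: "w (Suc j) = \<Phi> (w j) - R \<cdot> w j" for j
  proof -
    have "w (Suc j) = V.poly_op \<Phi> ([:-R, 1:] * ([:-R, 1:] ^ j * g)) p"
      by (simp only: w_def power_Suc mult.assoc)
    also have "\<dots> = V.poly_op \<Phi> [:-R, 1:] (w j)"
      unfolding w_def by (rule L.poly_op_mult[OF p(2)])
    finally show ?thesis by (simp only: V.poly_op_linear_factor)
  qed
  have desc: "w (Suc j) = 0 \<Longrightarrow> w (Suc 0) = 0" for j
  proof (induction j)
    case (Suc j)
    have "\<Phi> (w (Suc j)) = R \<cdot> w (Suc j)" using Suc.prems wS[of "Suc j"] by simp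
    then have "w (Suc j) = 0" using no_jordan_block[OF r w_def[of j] wS[of j]] by blast
    then show ?case by (rule Suc.IH)
  qed
  have "w (order R m0) = 0" using m0(2) g(1) by (simp add: w_def)
  \<comment> \<open>If \<open>R\<close> is no root at all, then already \<open>w 0 = 0\<close>, and
    \<open>w 1\<close> vanishes with it.\<close>
  then have "w (Suc 0) = 0"
    using desc wS[of 0] by (cases "order R m0") auto
  then show ?thesis using g(2) by (auto simp: w_def poly_eq_0_iff_dvd)
qed

section \<open>The resolvent of the map near \<open>r\<close> and its residue\<close>

definition partial :: "real \<Rightarrow> nat \<Rightarrow> 'a" where
  "partial z N = (\<Sum>j<N. complex_of_real (1 / z ^ (j + 1)) \<cdot> (\<Phi> ^^ j) p)"

lemma partial_closed [simp, intro]: "partial z N \<in> M"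
  using p by (auto simp: partial_def)

text \<open>Telescoping of the Neumann series, where \<open>w\<close> solves
  \<open>(z - \<Phi>) w = p\<close>.\<close>

lemma partial_resolvent:
  assumes z: "z \<noteq> 0" and w: "w \<in> M" "\<Phi> w = complex_of_real z \<cdot> w - p"
  shows "partial z N = w - complex_of_real (1 / z ^ N) \<cdot> (\<Phi> ^^ N) w"
proof (induction N)
  case (Suc N)
  have "(\<Phi> ^^ Suc N) w = (\<Phi> ^^ N) (complex_of_real z \<cdot> w - p)"
    using w(2) by (simp add: funpow_swap1)
  also have "\<dots> = complex_of_real z \<cdot> (\<Phi> ^^ N) w - (\<Phi> ^^ N) p"
    using w(1) p by (simp add: L.funpow_diff L.funpow_scale)
  finally have "complex_of_real (1 / z ^ Suc N) \<cdot> (\<Phi> ^^ Suc N) w =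
      complex_of_real (1 / z ^ N) \<cdot> (\<Phi> ^^ N) w - complex_of_real (1 / z ^ (N + 1)) \<cdot> (\<Phi> ^^ N) p"
    using z by (simp add: V.scale_right_diff_distrib)
  then show ?case using Suc by (simp add: partial_def)
qed (simp add: partial_def)

text \<open>The resolvent \<open>w z\<close> of \<open>p\<close> is a polynomial in
  \<open>\<Phi>\<close> applied to \<open>p\<close>, with coefficients rational in \<open>z\<close>,
  so the limit is algebraic: the simple factor \<open>X - R\<close> of \<open>m\<close> cancels
  against \<open>z - r\<close>. Positivity and support come from \<open>c y0 <= p\<close>: term by
  term, the series is at least \<open>c y0\<close> times a geometric series with sum
  \<open>1 / (z - r)\<close>.\<close>

lemma ex_zeta:
  assumes r: "0 \<le> r"
  shows "\<exists>\<zeta>\<in>cone r. (\<exists>c>0. below A (complex_of_real c \<cdot> y0) \<zeta>) \<and>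
    norm_limit A (at_right r) (\<lambda>z. complex_of_real (z - r) \<cdot>
      norm_suminf A (\<lambda>j. complex_of_real (1 / z ^ (j + 1)) \<cdot> (\<Phi> ^^ j) p)) = \<zeta>"
proof -
  obtain q where q: "poly q R \<noteq> 0" "V.poly_op \<Phi> ([:-R, 1:] * q) p = 0"
    using ex_simple_root_poly[OF r] by blast
  define m where "m = [:-R, 1:] * q"
  define \<zeta> where "\<zeta> = (1 / poly q R) \<cdot> V.poly_op \<Phi> q p"
  \<comment> \<open>Excludes the roots of \<open>q\<close>, where the formula for \<open>w z\<close>
    divides by zero; close to \<open>r\<close> there are none.\<close>
  define good where "good z \<longleftrightarrow> r < z \<and> poly q (complex_of_real z) \<noteq> 0" for z
  \<comment> \<open>From \<open>m = (X - z) s + m(z)\<close> and \<open>m(\<Phi>) p = 0\<close>: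
    dividing \<open>s(\<Phi>) p\<close> by \<open>m(z)\<close> solves
    \<open>(z - \<Phi>) w = p\<close>.\<close>
  define w where "w z = V.poly_op \<Phi> (smult (1 / poly m (complex_of_real z))
    (synthetic_div m (complex_of_real z))) p" for z
  have wM: "w z \<in> M" for z using p by (auto simp: w_def)
  have \<zeta>M: "\<zeta> \<in> M" using p by (auto simp: \<zeta>_def)
  have good: "eventually good (at_right r)"
  proof -
    have "((\<lambda>z. poly q (complex_of_real z)) \<longlongrightarrow> poly q R) (at_right r)"
      by (intro tendsto_intros)
    then have "eventually (\<lambda>z. poly q (complex_of_real z) \<noteq> 0) (at_right r)"
      using q(1) by (rule tendsto_imp_eventually_ne)
    then show ?thesis unfolding good_def
      using eventually_at_right_less[of r] by eventually_elim auto
  qed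
  have mz: "poly m (complex_of_real z) = complex_of_real (z - r) * poly q (complex_of_real z)" for z
    by (simp add: m_def algebra_simps)
  have mz0: "poly m (complex_of_real z) \<noteq> 0" if "good z" for z
    using that unfolding mz by (simp add: good_def)
  have res: "\<Phi> (w z) = complex_of_real z \<cdot> w z - p" if z: "good z" for z
  proof -
    let ?z = "complex_of_real z" and ?s = "synthetic_div m (complex_of_real z)"
    let ?W = "V.poly_op \<Phi> ?s p"
    have "V.poly_op \<Phi> ([:-?z, 1:] * ?s + [:poly m ?z:]) p = 0"
      using q(2) by (simp only: synthetic_div_correct' m_def)
    then have "V.poly_op \<Phi> ([:-?z, 1:] * ?s) p + poly m ?z \<cdot> p = 0"
      by (simp only: V.poly_op_add) (simp add: V.poly_op_pCons)
    then have "\<Phi> ?W - ?z \<cdot> ?W + poly m ?z \<cdot> p = 0"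
      by (simp only: L.poly_op_mult[OF p(2)] V.poly_op_linear_factor)
    then have "\<Phi> ?W = ?z \<cdot> ?W - poly m ?z \<cdot> p" by (simp add: algebra_simps)
    then show ?thesis
      using mz0[OF z] p by (simp add: w_def V.poly_op_smult map_scale V.scale_right_diff_distrib
        mult.commute)
  qed
  have part: "partial z N = w z - complex_of_real (1 / z ^ N) \<cdot> (\<Phi> ^^ N) (w z)" if z: "good z" for z
    N
    by (rule partial_resolvent) (use z r wM res[OF z] in \<open>auto simp: good_def\<close>)
  have lim1: "(\<lambda>N. \<nu> (partial z N - w z)) \<longlonglongrightarrow> 0" if nu: "dominated \<nu>" and z: "good z" for \<nu> z
  proof -
    have zr: "r < z" using z by (simp add: good_def)
    obtain K where K: "\<And>n. \<nu> ((\<Phi> ^^ n) (w z)) \<le> K * r ^ n"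
      using dominated_iter[OF nu] unfolding w_def by blast
    have "(\<lambda>N. K * (r / z) ^ N) \<longlonglongrightarrow> K * 0"
      using r zr by (intro tendsto_intros LIMSEQ_realpow_zero) auto
    then have lim: "(\<lambda>N. K * (r / z) ^ N) \<longlonglongrightarrow> 0" by simp
    show ?thesis
    proof (rule tendsto_sandwich[OF _ _ tendsto_const lim])
      show "\<forall>\<^sub>F N in sequentially. 0 \<le> \<nu> (partial z N - w z)"
        using nu wM by (simp add: dominated_def)
      have "\<nu> (partial z N - w z) \<le> K * (r / z) ^ N" for N
      proof -
        have "partial z N - w z = (- complex_of_real (1 / z ^ N)) \<cdot> (\<Phi> ^^ N) (w z)"
          using part[OF z, of N] by simp
        then have "\<nu> (partial z N - w z) = 1 / z ^ N * \<nu> ((\<Phi> ^^ N) (w z))"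
          using nu wM r zr by (simp add: dominated_def norm_divide norm_power del:
            V.scale_minus_left)
        also have "\<dots> \<le> 1 / z ^ N * (K * r ^ N)"
          using K r zr by (intro mult_left_mono) auto
        finally show ?thesis by (simp add: power_divide)
      qed
      then show "\<forall>\<^sub>F N in sequentially. \<nu> (partial z N - w z) \<le> K * (r / z) ^ N" by simp
    qed
  qed
  have sums: "norm_suminf A (\<lambda>j. complex_of_real (1 / z ^ (j + 1)) \<cdot> (\<Phi> ^^ j) p) = w z"
    if z: "good z" for z
    unfolding norm_suminf_def partial_def[symmetric]
    by (rule norm_limit_eq[OF wM lim1[OF dominated_nrm[OF r] z]]) auto
  have lim2: "((\<lambda>z. \<nu> (complex_of_real (z - r) \<cdot> w z - \<zeta>)) \<longlongrightarrow> 0) (at_right r)"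
    if nu: "dominated \<nu>" for \<nu>
  proof -
    \<comment> \<open>Difference of the coefficients of \<open>(z - r) w z\<close> and of
      \<open>\<zeta>\<close>. It vanishes at \<open>R\<close> because dividing \<open>m\<close> by
      \<open>X - R\<close> returns \<open>q\<close>.\<close>
    define h where "h i z = coeff (synthetic_div m z) i / poly q z - coeff q i / poly q R" for i z
    have synR: "synthetic_div m R = q"
      using synthetic_div_unique[of m R q 0] by (simp add: m_def)
    have "((\<lambda>z. \<Sum>i\<le>degree q. cmod (h i (complex_of_real z)) * \<nu> ((\<Phi> ^^ i) p)) \<longlongrightarrow>
        (\<Sum>i\<le>degree q. cmod (h i R) * \<nu> ((\<Phi> ^^ i) p))) (at_right r)"
    proof (intro tendsto_intros)
      fix i
      have "isCont (h i) R"
        unfolding h_def using q(1) isCont_coeff_synthetic_div by (intro continuous_intros) auto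
      then show "((\<lambda>z. h i (complex_of_real z)) \<longlongrightarrow> h i R) (at_right r)"
        by (rule isCont_tendsto_compose) (intro tendsto_intros)
    qed
    then have lim: "((\<lambda>z. \<Sum>i\<le>degree q. cmod (h i (complex_of_real z)) * \<nu> ((\<Phi> ^^ i) p)) \<longlongrightarrow> 0)
      (at_right r)"
      by (simp add: h_def synR)
    show ?thesis
    proof (rule tendsto_sandwich[OF _ _ tendsto_const lim])
      show "\<forall>\<^sub>F z in at_right r. 0 \<le> \<nu> (complex_of_real (z - r) \<cdot> w z - \<zeta>)"
        using nu wM \<zeta>M by (simp add: dominated_def)
      show "\<forall>\<^sub>F z in at_right r. \<nu> (complex_of_real (z - r) \<cdot> w z - \<zeta>) \<le>
          (\<Sum>i\<le>degree q. cmod (h i (complex_of_real z)) * \<nu> ((\<Phi> ^^ i) p))"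
        using good
      proof eventually_elim
        case (elim z)
        let ?z = "complex_of_real z"
        have "degree (synthetic_div m ?z) \<le> degree q"
          using degree_mult_le[of "[:-R, 1:]" q] by (simp add: degree_synthetic_div m_def)
        then have "V.poly_op \<Phi> (synthetic_div m ?z) p =
            (\<Sum>i\<le>degree q. coeff (synthetic_div m ?z) i \<cdot> (\<Phi> ^^ i) p)"
          by (rule V.poly_op_bound)
        moreover have "complex_of_real (z - r) \<cdot> w z =
            (1 / poly q ?z) \<cdot> V.poly_op \<Phi> (synthetic_div m ?z) p"
          using elim unfolding w_def V.poly_op_smult V.scale_scale mz by (simp add: good_def)
        ultimately have "complex_of_real (z - r) \<cdot> w z - \<zeta> = (\<Sum>i\<le>degree q. h i ?z \<cdot> (\<Phi> ^^ i) p)"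
          by (simp add: \<zeta>_def V.poly_op_def h_def V.scale_sum_right V.scale_left_diff_distrib
            sum_subtractf)
        moreover have "\<nu> (\<Sum>i\<le>degree q. h i ?z \<cdot> (\<Phi> ^^ i) p) \<le>
            (\<Sum>i\<le>degree q. \<nu> (h i ?z \<cdot> (\<Phi> ^^ i) p))"
          using p by (intro dominated_sum[OF nu]) auto
        moreover have "\<nu> (h i ?z \<cdot> (\<Phi> ^^ i) p) = cmod (h i ?z) * \<nu> ((\<Phi> ^^ i) p)" for i
          using nu p by (simp add: dominated_def)
        ultimately show ?case by simp
      qed
    qed
  qed
  have limit: "norm_limit A (at_right r) (\<lambda>z. complex_of_real (z - r) \<cdot>
      norm_suminf A (\<lambda>j. complex_of_real (1 / z ^ (j + 1)) \<cdot> (\<Phi> ^^ j) p)) = \<zeta>"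
  proof (rule norm_limit_eq[OF \<zeta>M])
    show "((\<lambda>z. nrm A (complex_of_real (z - r) \<cdot>
        norm_suminf A (\<lambda>j. complex_of_real (1 / z ^ (j + 1)) \<cdot> (\<Phi> ^^ j) p) - \<zeta>)) \<longlongrightarrow> 0) (at_right r)"
      by (rule Lim_transform_eventually[OF lim2[OF dominated_nrm[OF r]]])
        (use good in eventually_elim, simp only: sums)
    show "\<forall>\<^sub>F z in at_right r. complex_of_real (z - r) \<cdot>
        norm_suminf A (\<lambda>j. complex_of_real (1 / z ^ (j + 1)) \<cdot> (\<Phi> ^^ j) p) \<in> M"
      using good by eventually_elim (simp only: sums scale_closed wM)
  qed simp
  have eig: "\<Phi> \<zeta> = R \<cdot> \<zeta>"
  proof -
    have "\<Phi> (V.poly_op \<Phi> q p) - R \<cdot> V.poly_op \<Phi> q p = 0"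
      using q(2) by (simp only: L.poly_op_mult[OF p(2)] V.poly_op_linear_factor)
    then show ?thesis using p by (simp add: \<zeta>_def map_scale mult.commute)
  qed
  obtain c where c: "0 < c" "below A (complex_of_real c \<cdot> y0) p" using below_y0_p by blast
  have below: "below A (complex_of_real c \<cdot> y0) \<zeta>"
    unfolding below_def
  proof (rule positiveI)
    fix d assume d: "d \<in> M"
    \<comment> \<open>Positivity of \<open>\<zeta> - c y0\<close> is tested on one functional at a
      time; its modulus is dominated, so both limits pass through \<open>F\<close>.\<close>
    define F where "F v = \<tau> (d\<^sup>\<star> \<odot> v \<odot> d)" for v
    have F_add: "F (u + v) = F u + F v" and F_diff: "F (u - v) = F u - F v"
      and F_scale: "F (l \<cdot> u) = l * F u" if "u \<in> M" "v \<in> M" for u v l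
      using that d by (simp_all add: F_def distrib tr_add tr_diff tr_scale)
    have F_pos: "positive A v \<Longrightarrow> 0 \<le> F v" for v
      unfolding F_def using d by (rule tr_conj_nonneg[rotated])
    have dom: "dominated (\<lambda>v. cmod (F v))" unfolding F_def by (rule dominated_functional[OF r d])
    \<comment> \<open>The coefficient of \<open>y0\<close> that results when \<open>p\<close> is
      replaced by \<open>y0\<close> in the partial sum.\<close>
    define geo where "geo z N = (\<Sum>j<N. r ^ j / z ^ (j + 1))" for z N
    have ineq: "0 \<le> F (partial z N) - complex_of_real (c * geo z N) * F y0" if "good z" for z N
    proof -
      have z: "0 < z" using that r by (simp add: good_def)
      have "F (partial z N) - complex_of_real (c * geo z N) * F y0 =
          (\<Sum>j<N. complex_of_real (1 / z ^ (j + 1)) * F ((\<Phi> ^^ j) (p - complex_of_real c \<cdot> y0)))"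
      proof (induction N)
        case 0
        show ?case using F_scale[of 0 0 0] by (simp add: partial_def geo_def)
      next
        case (Suc N)
        have "(\<Phi> ^^ N) (p - complex_of_real c \<cdot> y0) = (\<Phi> ^^ N) p - complex_of_real (c * r ^ N) \<cdot> y0"
          using p y0 by (simp add: L.funpow_diff L.funpow_scale iter_y0)
        then have 1: "F ((\<Phi> ^^ N) (p - complex_of_real c \<cdot> y0)) =
            F ((\<Phi> ^^ N) p) - complex_of_real (c * r ^ N) * F y0"
          using F_diff[of "(\<Phi> ^^ N) p" "complex_of_real (c * r ^ N) \<cdot> y0"]
            F_scale[OF y0(2) y0(2)] p y0 by simp
        have 2: "F (partial z (Suc N)) = F (partial z N) + complex_of_real (1 / z ^ (N + 1)) * F
          ((\<Phi> ^^ N) p)"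
          using F_add[of "partial z N" "complex_of_real (1 / z ^ (N + 1)) \<cdot> (\<Phi> ^^ N) p"]
            F_scale[of "(\<Phi> ^^ N) p" 0 "complex_of_real (1 / z ^ (N + 1))"] p
          by (simp add: partial_def)
        have 3: "geo z (Suc N) = geo z N + r ^ N / z ^ (N + 1)" by (simp add: geo_def)
        show ?case unfolding sum.lessThan_Suc Suc[symmetric] 1 2 3
          by (simp add: algebra_simps)
      qed
      also have "0 \<le> \<dots>"
      proof (rule sum_nonneg)
        fix j
        have "0 \<le> F ((\<Phi> ^^ j) (p - complex_of_real c \<cdot> y0))"
          using c(2) by (intro F_pos iter_positive) (simp add: below_def)
        moreover have "0 \<le> complex_of_real (1 / z ^ (j + 1))"
          using z by (simp add: less_eq_complex_def del: of_real_divide)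
        ultimately show "0 \<le> complex_of_real (1 / z ^ (j + 1)) * F
          ((\<Phi> ^^ j) (p - complex_of_real c \<cdot> y0))"
          by (rule mult_nonneg_nonneg[rotated])
      qed
      finally show ?thesis .
    qed
    have wz: "0 \<le> F (complex_of_real (z - r) \<cdot> w z) - complex_of_real c * F y0" if z: "good z" for z
    proof -
      have zr: "0 < z" "r < z" using z r by (auto simp: good_def)
      have "(\<lambda>j. (r / z) ^ j) sums (1 / (1 - r / z))" using r zr by (intro geometric_sums) auto
      then have "(\<lambda>j. 1 / z * (r / z) ^ j) sums (1 / z * (1 / (1 - r / z)))" by (rule sums_mult)
      moreover have "1 / z * (r / z) ^ j = r ^ j / z ^ (j + 1)" for j by (simp add: power_divide)
      moreover have "1 / z * (1 / (1 - r / z)) = 1 / (z - r)" using zr by (simp add: field_simps)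
      ultimately have geo: "geo z \<longlonglongrightarrow> 1 / (z - r)" 
        by (simp add: sums_def geo_def[abs_def])
      have "(\<lambda>N. cmod (F (partial z N - w z))) \<longlonglongrightarrow> 0" by (rule lim1[OF dom z])
      then have "(\<lambda>N. F (partial z N) - F (w z)) \<longlonglongrightarrow> 0"
        using F_diff wM by (simp add: tendsto_norm_zero_iff)
      then have "(\<lambda>N. F (partial z N)) \<longlonglongrightarrow> F (w z)" by (simp add: LIM_zero_iff)
      then have "(\<lambda>N. F (partial z N) - complex_of_real (c * geo z N) * F y0) \<longlonglongrightarrow>
          F (w z) - complex_of_real (c * (1 / (z - r))) * F y0"
        by (intro tendsto_intros geo)
      then have "0 \<le> F (w z) - complex_of_real (c * (1 / (z - r))) * F y0"
        by (rule tendsto_complex_nonneg) (use ineq[OF z] in auto)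
      moreover have "0 \<le> complex_of_real (z - r)" using zr by (simp add: less_eq_complex_def)
      ultimately have "0 \<le> complex_of_real (z - r) *
        (F (w z) - complex_of_real (c * (1 / (z - r))) * F y0)"
        by (rule mult_nonneg_nonneg[rotated])
      also have "\<dots> = F (complex_of_real (z - r) \<cdot> w z) - complex_of_real c * F y0"
      proof -
        have "complex_of_real (z - r) * complex_of_real (c * (1 / (z - r))) = complex_of_real c"
          using zr unfolding of_real_mult[symmetric] by (intro arg_cong[of _ _ complex_of_real])
            simp
        then show ?thesis using F_scale[OF wM wM] by
          (simp add: right_diff_distrib mult.assoc[symmetric] del: of_real_mult of_real_divide
          of_real_diff)
      qed
      finally show ?thesis .
    qed
    have "((\<lambda>z. cmod (F (complex_of_real (z - r) \<cdot> w z - \<zeta>))) \<longlongrightarrow> 0) (at_right r)"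
      by (rule lim2[OF dom])
    then have "((\<lambda>z. F (complex_of_real (z - r) \<cdot> w z) - F \<zeta>) \<longlongrightarrow> 0) (at_right r)"
      using F_diff wM \<zeta>M by (simp add: tendsto_norm_zero_iff)
    then have "((\<lambda>z. F (complex_of_real (z - r) \<cdot> w z)) \<longlongrightarrow> F \<zeta>) (at_right r)"
      by (simp add: LIM_zero_iff)
    then have "((\<lambda>z. F (complex_of_real (z - r) \<cdot> w z) - complex_of_real c * F y0) \<longlongrightarrow>
        F \<zeta> - complex_of_real c * F y0) (at_right r)"
      by (intro tendsto_intros)
    then have "0 \<le> F \<zeta> - complex_of_real c * F y0"
      by (rule tendsto_complex_nonneg) (use good wz in \<open>auto elim: eventually_mono\<close>)
    also have "\<dots> = F (\<zeta> - complex_of_real c \<cdot> y0)"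
      using F_diff[of \<zeta> "complex_of_real c \<cdot> y0"] F_scale[OF y0(2) y0(2)] \<zeta>M y0 by simp
    finally show "0 \<le> \<tau> (d\<^sup>\<star> \<odot> (\<zeta> - complex_of_real c \<cdot> y0) \<odot> d)" by (simp add: F_def)
  qed (use \<zeta>M y0 in auto)
  have "positive A (complex_of_real c \<cdot> y0 + (\<zeta> - complex_of_real c \<cdot> y0))"
    using below c y0 by (intro positive_add positive_scale) (auto simp: below_def)
  then have "\<zeta> \<in> cone r" using eig by (simp add: cone_def)
  then show ?thesis using below c limit by blast
qed

text \<open>The two projections lie below each other: \<open>c y0 <= \<zeta>\<close> gives one
  inequality, maximality of the support of \<open>y0\<close> the other.\<close>

theorem zeta_cone_support:
  defines "\<zeta> \<equiv> norm_limit A (at_right r) (\<lambda>z. complex_of_real (z - r) \<cdot>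
      norm_suminf A (\<lambda>j. complex_of_real (1 / z ^ (j + 1)) \<cdot> (\<Phi> ^^ j) p))"
  shows "\<zeta> \<in> cone r" and "rp \<zeta> = p"
proof -
  have *: "\<zeta> \<in> cone r \<and> (\<exists>c>0. below A (complex_of_real c \<cdot> y0) \<zeta>)"
  proof (cases "y0 = 0")
    \<comment> \<open>Here \<open>r_nonneg\<close> says nothing about \<open>r\<close>, but
      \<open>p = 0\<close> and the whole series vanishes.\<close>
    case True
    have p0: "p = 0" using mul_pinv[OF y0(2,3)] pinv_closed[OF y0(2,3)] True by simp
    have it: "(\<Phi> ^^ j) p = 0" for j by (induction j) (simp_all add: p0)
    have "norm_suminf A (\<lambda>j. complex_of_real (1 / z ^ (j + 1)) \<cdot> (\<Phi> ^^ j) p) = 0" for z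
      unfolding norm_suminf_def it using nrm_eq_0[of 0] by (intro norm_limit_eq) auto
    then have "\<zeta> = norm_limit A (at_right r) (\<lambda>z. 0)" unfolding \<zeta>_def by simp
    also have "\<dots> = 0" using nrm_eq_0[of 0] by (intro norm_limit_eq) auto
    finally show ?thesis
      using True cone_zero by (auto simp: below_def positive_zero intro: exI[of _ 1])
  next
    case False
    obtain z where z: "z \<in> cone r" "\<exists>c>0. below A (complex_of_real c \<cdot> y0) z"
      and "norm_limit A (at_right r) (\<lambda>z. complex_of_real (z - r) \<cdot>
        norm_suminf A (\<lambda>j. complex_of_real (1 / z ^ (j + 1)) \<cdot> (\<Phi> ^^ j) p)) = z"
      using ex_zeta[OF r_nonneg[OF False]] by blast
    then have "\<zeta> = z" by (simp only: \<zeta>_def)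
    with z show ?thesis by blast
  qed
  then show c: "\<zeta> \<in> cone r" by blast
  then have pos: "positive A \<zeta>" by (simp add: cone_def)
  then have h: "\<zeta> \<in> M" "\<zeta>\<^sup>\<star> = \<zeta>" using positive_adj by auto
  have R: "projection A (rp \<zeta>)" "rp \<zeta> \<odot> \<zeta> = \<zeta>" using rp_projection[OF h] rp_mul[OF h] by auto
  obtain c where c: "c > 0" "below A (complex_of_real c \<cdot> y0) \<zeta>" using * by blast
  have "rp \<zeta> \<odot> (complex_of_real c \<cdot> y0) = complex_of_real c \<cdot> y0"
    using c y0 R h by (intro below_absorb(1)[OF _ c(2)] positive_scale) auto
  then have "complex_of_real c \<cdot> (rp \<zeta> \<odot> y0) = complex_of_real c \<cdot> y0"
    using R y0 by (simp add: projection_def)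
  then have "rp \<zeta> \<odot> y0 = y0" using c(1) by (simp add: V.scale_cancel_left)
  then have 1: "rp \<zeta> \<odot> p = p" using rp_absorb[OF y0(2,3)] R by (auto simp: projection_def)
  have "p \<odot> \<zeta> = \<zeta>" using y0_max * by blast
  then have "p \<odot> rp \<zeta> = rp \<zeta>" using rp_absorb[OF h] p by blast
  then show "rp \<zeta> = p"
    using 1 R(1) p(1) projection_below_iff below_antisym by blast
qed

end

section \<open>The cone of eigenvectors\<close>

context pf_data
begin

text \<open>\<open>Y <= t p <= t C y0\<close>, and \<open>\<Phi>\<close> maps the right end to a
  multiple of \<open>y0\<close>, which \<open>p\<close> supports.\<close>

lemma support_map:
  assumes Y: "positive A Y" "p \<odot> Y = Y"
  shows "p \<odot> \<Phi> Y = \<Phi> Y" and "\<Phi> Y \<odot> p = \<Phi> Y"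
proof -
  have YM: "Y \<in> M" "Y\<^sup>\<star> = Y" using Y positive_adj by auto
  have Yp: "Y \<odot> p = Y" using arg_cong[OF Y(2), of "adj A"] YM p by simp
  obtain t where t: "t \<ge> 0" "below A Y (complex_of_real t \<cdot> \<one>)"
    using positive_le_scalar[OF Y(1)] by blast
  have "positive A (p\<^sup>\<star> \<odot> (complex_of_real t \<cdot> \<one> - Y) \<odot> p)"
    using t(2) p by (intro positive_conj) (auto simp: below_def)
  then have 1: "below A Y (complex_of_real t \<cdot> p)"
    using p YM Y Yp by (simp add: below_def distrib)
  obtain C where C: "C > 0" "below A p (complex_of_real C \<cdot> y0)" using below_p_y0 by blast
  have "below A Y (complex_of_real t \<cdot> complex_of_real C \<cdot> y0)"
    using 1 below_scale[OF C(2) t(1)] by (rule below_trans)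
  then have "below A (\<Phi> Y) (\<Phi> (complex_of_real t \<cdot> complex_of_real C \<cdot> y0))"
    using YM y0 by (intro map_below) auto
  then have b: "below A (\<Phi> Y) ((complex_of_real t * complex_of_real C * R) \<cdot> y0)"
    using y0 by (simp add: map_scale mult.assoc)
  show "p \<odot> \<Phi> Y = \<Phi> Y" "\<Phi> Y \<odot> p = \<Phi> Y"
    by (rule below_absorb[OF map_positive[OF Y(1)] b p(1)]; use y0 p p_y0 in simp)+
qed

text \<open>In the application \<open>A\<close> and \<open>B\<close> hold the 1-boxes and the
  2-boxes, \<open>\<iota> a\<close> is \<open>a\<close> with a through string on its right,
  \<open>\<kappa>\<close> is the Kraus operator of the conjugated map and \<open>h\<close> the
  rotated right eigenvector. The factorisation \<open>q = k \<odot> h\<close> says that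
  \<open>q\<close> kills whatever \<open>h\<close> kills. \<open>C\<close> stays abstract, given by
  a criterion for membership and a consequence of it.\<close>

theorem cone_eq_image:
  fixes B :: "'b::ab_group_add star_algebra"
  assumes \<zeta>: "\<zeta> \<in> cone r" "rp \<zeta> = p"
    and h: "positive A h" "\<And>y. y \<in> M \<Longrightarrow> \<tau> (h \<odot> \<Phi> y) = R * \<tau> (h \<odot> y)"
    and q: "projection A q" "k \<in> M" "q = k \<odot> h" "proj_meet A p (\<one> - q) = 0"
    and B: "traced_algebra B \<sigma>"
    and \<iota>: "\<And>a. a \<in> M \<Longrightarrow> \<iota> a \<in> carr B" "\<And>a b. \<lbrakk>a \<in> M; b \<in> M\<rbrakk> \<Longrightarrow> \<iota> (a \<odot> b) = mul B (\<iota> a) (\<iota> b)"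
      "\<And>a. a \<in> M \<Longrightarrow> \<iota> (a\<^sup>\<star>) = adj B (\<iota> a)" "\<iota> \<one> = unit B"
    and \<kappa>: "\<kappa> \<in> carr B" "mul B (\<iota> p) \<kappa> = \<kappa>"
    and kraus: "\<And>y m. \<lbrakk>y \<in> M; m \<in> M\<rbrakk> \<Longrightarrow>
      \<tau> (isq \<zeta> \<odot> \<Phi> (sq \<zeta> \<odot> y \<odot> sq \<zeta>) \<odot> isq \<zeta> \<odot> m) =
      \<sigma> (mul B (mul B (mul B \<kappa> (\<iota> y)) (adj B \<kappa>)) (\<iota> m))"
    and C_I: "\<And>c. \<lbrakk>c \<in> M; c\<^sup>\<star> = c; mul B \<kappa> (\<iota> c) = mul B (\<iota> c) \<kappa>\<rbrakk> \<Longrightarrow> c \<in> C"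
    and C_D: "\<And>c. c \<in> C \<Longrightarrow> c \<in> M"
      "\<And>c. c \<in> C \<Longrightarrow> isq \<zeta> \<odot> \<Phi> (sq \<zeta> \<odot> c \<odot> sq \<zeta>) \<odot> isq \<zeta> =
         isq \<zeta> \<odot> \<Phi> (sq \<zeta> \<odot> sq \<zeta>) \<odot> isq \<zeta> \<odot> c"
  shows "cone r = (\<lambda>c. sq \<zeta> \<odot> c \<odot> sq \<zeta>) ` {c \<in> C. positive A c}"
proof -
  let ?s = "sq \<zeta>" and ?t = "isq \<zeta>"
  have pos: "positive A \<zeta>" and eig: "\<Phi> \<zeta> = R \<cdot> \<zeta>" using \<zeta>(1) by (auto simp: cone_def)
  have st: "?s \<in> M" "?t \<in> M" "?s\<^sup>\<star> = ?s" "?t\<^sup>\<star> = ?t"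
    using pos by (simp_all add: sq_closed isq_closed sq_adj isq_adj)
  have rel: "?s \<odot> ?t = p" "?t \<odot> ?s = p" "p \<odot> ?s = ?s" "?s \<odot> p = ?s" "p \<odot> ?t = ?t" "?t \<odot> p = ?t"
    using sq_isq[OF pos] isq_sq[OF pos] rp_sq[OF pos] sq_rp[OF pos] rp_isq[OF pos] isq_rp[OF pos]
      \<zeta>(2)
    by simp_all
  have rel': "?s \<odot> (?t \<odot> a) = p \<odot> a" "?t \<odot> (?s \<odot> a) = p \<odot> a" "p \<odot> (?s \<odot> a) = ?s \<odot> a"
    "?s \<odot> (p \<odot> a) = ?s \<odot> a" "p \<odot> (?t \<odot> a) = ?t \<odot> a" "?t \<odot> (p \<odot> a) = ?t \<odot> a"
    "p \<odot> (p \<odot> a) = p \<odot> a" if "a \<in> M" for a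
    using that st p rel by (simp_all flip: mul_assoc)
  note corner = st rel rel' p(2-4)
  have hM: "h \<in> M" "h\<^sup>\<star> = h" using h(1) positive_adj by auto
  have sss: "?s \<odot> ?s = \<zeta>" using sq_sq[OF pos] .
  have one: "?t \<odot> \<Phi> (?s \<odot> ?s) \<odot> ?t = R \<cdot> p"
  proof -
    have "?t \<odot> \<Phi> (?s \<odot> ?s) \<odot> ?t = ?t \<odot> (R \<cdot> (?s \<odot> ?s)) \<odot> ?t" using eig by (simp only: sss)
    then show ?thesis using corner by simp
  qed
  have supp: "positive A (?s \<odot> c \<odot> ?s)" "p \<odot> \<Phi> (?s \<odot> c \<odot> ?s) = \<Phi> (?s \<odot> c \<odot> ?s)"
    "\<Phi> (?s \<odot> c \<odot> ?s) \<odot> p = \<Phi> (?s \<odot> c \<odot> ?s)" if c: "positive A c" for c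
  proof -
    show Y: "positive A (?s \<odot> c \<odot> ?s)" using positive_conj[OF c, of ?s] st by simp
    have "c \<in> M" using c by auto
    then have "p \<odot> (?s \<odot> c \<odot> ?s) = ?s \<odot> c \<odot> ?s" using corner by simp
    then show "p \<odot> \<Phi> (?s \<odot> c \<odot> ?s) = \<Phi> (?s \<odot> c \<odot> ?s)" "\<Phi> (?s \<odot> c \<odot> ?s) \<odot> p = \<Phi> (?s \<odot> c \<odot> ?s)"
      using support_map[OF Y] by blast+
  qed
  show ?thesis
  proof (intro equalityI subsetI)
    fix y assume "y \<in> (\<lambda>c. ?s \<odot> c \<odot> ?s) ` {c \<in> C. positive A c}"
    then obtain c where c: "c \<in> C" "positive A c" "y = ?s \<odot> c \<odot> ?s" by auto
    have cM: "c \<in> M" using c by auto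
    have yM: "y \<in> M" using c cM st by auto
    note sup = supp[OF c(2), folded c(3)]
    have "?t \<odot> \<Phi> y \<odot> ?t = R \<cdot> (p \<odot> c)"
      using C_D(2)[OF c(1), folded c(3), unfolded one] p cM by simp
    \<comment> \<open>Undoing the conjugation leaves the compression of \<open>\<Phi> y\<close> by
      \<open>p\<close>, which is \<open>\<Phi> y\<close> itself by
      \<open>support_map\<close>.\<close>
    then have "?s \<odot> (?t \<odot> \<Phi> y \<odot> ?t) \<odot> ?s = ?s \<odot> (R \<cdot> (p \<odot> c)) \<odot> ?s" by simp
    then have "p \<odot> \<Phi> y \<odot> p = R \<cdot> y" using corner cM yM c(3) by simp
    then have "\<Phi> y = R \<cdot> y" using sup by simp
    then show "y \<in> cone r" using sup by (simp add: cone_def)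
  next
    fix y assume y: "y \<in> cone r"
    then have ypos: "positive A y" and yeig: "\<Phi> y = R \<cdot> y" by (auto simp: cone_def)
    then have yM: "y \<in> M" "y\<^sup>\<star> = y" using positive_adj by auto
    have py: "p \<odot> y = y" using y0_max[OF y] .
    have yp: "y \<odot> p = y" using arg_cong[OF py, of "adj A"] yM p by simp
    define c where "c = ?t \<odot> y \<odot> ?t"
    have cpos: "positive A c" using positive_conj[OF ypos, of ?t] st by (simp add: c_def)
    then have c: "c \<in> M" "c\<^sup>\<star> = c" using positive_adj by auto
    have pc: "p \<odot> c = c" "c \<odot> p = c" using corner yM by (simp_all add: c_def)
    have scs: "?s \<odot> c \<odot> ?s = y" using corner yM py yp by (simp add: c_def)
    have \<Phi>c: "?t \<odot> \<Phi> (?s \<odot> c \<odot> ?s) \<odot> ?t = R \<cdot> c"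
      unfolding scs yeig using st yM by (simp add: c_def)
    \<comment> \<open>Density of the invariant functional for the conjugated map. Cyclicity of the
      trace moves \<open>?s\<close> and \<open>?t\<close> between \<open>h\<close> and the map,
      which gives the invariance \<open>sq\<close> at \<open>c \<odot> c\<close>.\<close>
    define h' where "h' = ?s \<odot> h \<odot> ?s"
    have h'pos: "positive A h'" using positive_conj[OF h(1), of ?s] st by (simp add: h'_def)
    then have h': "h' \<in> M" "h'\<^sup>\<star> = h'" using positive_adj by auto
    have ph': "p \<odot> h' = h'" "h' \<odot> p = h'" using corner hM by (simp_all add: h'_def)
    have sq: "\<tau> (?t \<odot> \<Phi> (?s \<odot> (c \<odot> c) \<odot> ?s) \<odot> ?t \<odot> h') = R * \<tau> (c \<odot> c \<odot> h')"
    proof -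
      let ?Y = "?s \<odot> (c \<odot> c) \<odot> ?s"
      have cc: "positive A (c \<odot> c)" using positive_square[OF c(1)] c by simp
      have YM: "?Y \<in> M" using st c by auto
      define F where "F = \<Phi> ?Y"
      have F: "F \<in> M" "p \<odot> F = F" "F \<odot> p = F" using supp[OF cc] YM by
        (simp_all only: F_def map_closed)
      have F': "p \<odot> (F \<odot> a) = F \<odot> a" "F \<odot> (p \<odot> a) = F \<odot> a" if "a \<in> M" for a
        using F p(2) that by (simp_all flip: mul_assoc)
      have "?t \<odot> F \<odot> ?t \<odot> h' = (?t \<odot> (F \<odot> h)) \<odot> ?s"
        using st hM F(1) rel' F' p(2) by (simp add: h'_def)
      also have "\<tau> \<dots> = \<tau> (?s \<odot> (?t \<odot> (F \<odot> h)))"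
        using st hM F(1) by (intro tr_commute) auto
      also have "?s \<odot> (?t \<odot> (F \<odot> h)) = F \<odot> h"
        using hM F(1) rel' F' by simp
      finally have "\<tau> (?t \<odot> \<Phi> ?Y \<odot> ?t \<odot> h') = \<tau> (\<Phi> ?Y \<odot> h)" by (simp only: F_def)
      also have "\<tau> (\<Phi> ?Y \<odot> h) = R * \<tau> (h \<odot> ?Y)"
        using tr_commute[of "\<Phi> ?Y" h] h(2)[OF YM] YM hM by simp
      also have "\<tau> (h \<odot> ?Y) = \<tau> (?Y \<odot> h)" using YM hM by (intro tr_commute) auto
      also have "?Y \<odot> h = ?s \<odot> (c \<odot> c \<odot> ?s \<odot> h)" using st c hM by simp
      also have "\<tau> \<dots> = \<tau> ((c \<odot> c \<odot> ?s \<odot> h) \<odot> ?s)" using st c hM by (intro tr_commute) auto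
      also have "(c \<odot> c \<odot> ?s \<odot> h) \<odot> ?s = c \<odot> c \<odot> h'" using st c hM by (simp add: h'_def)
      finally show ?thesis .
    qed
    \<comment> \<open>If \<open>e\<close> is the part of \<open>p\<close> missed by the support of
      \<open>h'\<close>, then \<open>h\<close> kills \<open>g = ?s \<odot> e \<odot> ?s\<close>, and
      so does \<open>q\<close>. The support of \<open>g\<close> lies under both \<open>p\<close> and
      \<open>\<one> - q\<close>, so the meet condition forces \<open>g = 0\<close> and with it
      \<open>e = 0\<close>.\<close>
    have rph': "rp h' = p"
    proof -
      have R: "projection A (rp h')" "rp h' \<odot> h' = h'" using rp_projection[OF h'] rp_mul[OF h'] by
        auto
      then have RM: "rp h' \<in> M" "(rp h')\<^sup>\<star> = rp h'" "rp h' \<odot> rp h' = rp h'" by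
        (auto simp: projection_def)
      have pR: "p \<odot> rp h' = rp h'" using rp_absorb[OF h'] ph' p by blast
      then have Rp: "rp h' \<odot> p = rp h'" by (metis adj_mul pR RM(1,2) p(2,3))
      define e where "e = p - rp h'"
      have eM: "e \<in> M" using p RM by (simp add: e_def)
      have pe: "p \<odot> e = e" "e \<odot> p = e" using p RM pR Rp by (simp_all add: e_def distrib)
      have "projection A e" unfolding projection_def using p RM pR Rp by (simp add: e_def distrib)
      then have epos: "positive A e" by (rule projection_positive)
      have eh': "e \<odot> h' = 0" using p RM R ph' h' by (simp add: e_def distrib)
      define g where "g = ?s \<odot> e \<odot> ?s"
      have gpos: "positive A g" using positive_conj[OF epos, of ?s] st by (simp add: g_def)
      then have g: "g \<in> M" "g\<^sup>\<star> = g" using positive_adj by auto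
      have "\<tau> (h \<odot> g) = \<tau> ((h \<odot> ?s \<odot> e) \<odot> ?s)" using st hM eM by (simp add: g_def)
      also have "\<dots> = \<tau> (?s \<odot> (h \<odot> ?s \<odot> e))" using st hM eM by (intro tr_commute) auto
      also have "\<dots> = \<tau> (h' \<odot> e)" using st hM eM by (simp add: h'_def)
      also have "\<dots> = \<tau> (e \<odot> h')" using h' eM by (intro tr_commute) auto
      finally have "\<tau> (h \<odot> g) = 0" using eh' by simp
      then have "h \<odot> g = 0" by (rule positive_mul_zero[OF h(1) gpos])
      then have "q \<odot> g = 0" using q(2,3) hM g by simp
      moreover have qM: "q \<in> M" using q(1) by (simp add: projection_def)
      ultimately have "q \<odot> rp g = 0" using rp_annihilate[OF g] by blast
      moreover have "p \<odot> g = g" using corner eM by (simp add: g_def)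
      then have "p \<odot> rp g = rp g" using rp_absorb[OF g] p by blast
      moreover have Rg: "projection A (rp g)" "rp g \<odot> g = g" using rp_projection[OF g] rp_mul[OF g]
        by auto
      ultimately have "rp g = 0"
        using proj_meet_eq_0D[OF p(1) projection_complement[OF q(1)] q(4), of "rp g"] qM
        by (simp add: distrib projection_def)
      then have "g = 0" using Rg g by simp
      then have "?t \<odot> g \<odot> ?t = 0" using st by simp
      then have "e = 0" using corner eM pe by (simp add: g_def)
      then show ?thesis by (simp add: e_def)
    qed
    interpret N: traced_algebra B \<sigma> by (rule B)
    define D where "D = mul B \<kappa> (\<iota> c) - mul B (\<iota> c) \<kappa>"
    have DN: "D \<in> carr B" using \<kappa> \<iota> c by (simp add: D_def)
    have ic: "adj B (\<iota> c) = \<iota> c" using \<iota>(3)[OF c(1)] c(2) by simp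
    obtain e where e: "e \<in> M" "h' = mul A (adj A e) e" using h'pos by (auto simp: positive_def)
    \<comment> \<open>The four products are arranged towards the right side of \<open>kraus\<close>,
      two of them up to cyclicity of the trace. The unit is inserted so that the product without
      \<open>c\<close> between the Kraus operators becomes the value at \<open>\<one>\<close>, known
      from \<open>one\<close>.\<close>
    have "mul B (mul B D (adj B D)) (\<iota> h') =
        (mul B (mul B (mul B \<kappa> (\<iota> (mul A c c))) (adj B \<kappa>)) (\<iota> h')
          - mul B (mul B (mul B \<kappa> (\<iota> c)) (adj B \<kappa>)) (\<iota> (mul A c h')))
        - (mul B (\<iota> c) (mul B (mul B (mul B \<kappa> (\<iota> c)) (adj B \<kappa>)) (\<iota> h'))
          - mul B (\<iota> c) (mul B (mul B (mul B \<kappa> (\<iota> (unit A))) (adj B \<kappa>)) (\<iota> (mul A c h'))))"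
      using \<kappa> \<iota> c h' by (simp add: D_def ic N.distrib)
    then have "\<sigma> (mul B (mul B D (adj B D)) (\<iota> h')) =
        \<sigma> (mul B (mul B (mul B \<kappa> (\<iota> (mul A c c))) (adj B \<kappa>)) (\<iota> h'))
          - \<sigma> (mul B (mul B (mul B \<kappa> (\<iota> c)) (adj B \<kappa>)) (\<iota> (mul A c h')))
        - (\<sigma> (mul B (\<iota> c) (mul B (mul B (mul B \<kappa> (\<iota> c)) (adj B \<kappa>)) (\<iota> h')))
          - \<sigma> (mul B (\<iota> c) (mul B (mul B (mul B \<kappa> (\<iota> (unit A))) (adj B \<kappa>)) (\<iota> (mul A c h')))))"
      using \<kappa> \<iota> c h' by (simp only: N.tr_diff N.algebra_closed N.diff_closed algebra_closed)
    also have "\<sigma> (mul B (\<iota> c) (mul B (mul B (mul B \<kappa> (\<iota> c)) (adj B \<kappa>)) (\<iota> h'))) =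
        \<sigma> (mul B (mul B (mul B \<kappa> (\<iota> c)) (adj B \<kappa>)) (\<iota> (mul A h' c)))"
      using N.tr_commute[of "\<iota> c" "mul B (mul B (mul B \<kappa> (\<iota> c)) (adj B \<kappa>)) (\<iota> h')"] \<kappa> \<iota> c h' by simp
    also have "\<sigma> (mul B (\<iota> c) (mul B (mul B (mul B \<kappa> (\<iota> (unit A))) (adj B \<kappa>)) (\<iota> (mul A c h')))) =
        \<sigma> (mul B (mul B (mul B \<kappa> (\<iota> (unit A))) (adj B \<kappa>)) (\<iota> (mul A (mul A c h') c)))"
      using N.tr_commute[of "\<iota> c" "mul B (mul B (mul B \<kappa> (\<iota> (unit A))) (adj B \<kappa>)) (\<iota> (mul A c h'))"]
        \<kappa> \<iota> c h'
      by simp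
    finally have "\<sigma> (mul B (mul B D (adj B D)) (\<iota> h')) =
        R * \<tau> (mul A (mul A c c) h') - R * \<tau> (mul A c (mul A c h'))
        - (R * \<tau> (mul A c (mul A h' c)) - R * \<tau> (mul A p (mul A (mul A c h') c)))"
      using kraus[of "mul A c c" h', unfolded sq] kraus[of c "mul A c h'", unfolded \<Phi>c]
        kraus[of c "mul A h' c", unfolded \<Phi>c] kraus[of "unit A" "mul A (mul A c h') c"] one c h' p
          st
      by (simp add: tr_scale del: mul_assoc)
    \<comment> \<open>The terms cancel in pairs, the first pair by associativity, the second because
      \<open>p \<odot> c = c\<close>.\<close>
    also have "\<dots> = 0"
    proof -
      have "mul A p (mul A (mul A c h') c) = mul A (mul A (mul A p c) h') c"
        using p c h' by simp
      then have "mul A p (mul A (mul A c h') c) = mul A c (mul A h' c)" using pc c h' by simp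
      then show ?thesis using c h' by simp
    qed
    finally have zero: "\<sigma> (mul B (mul B D (adj B D)) (\<iota> h')) = 0" .
    \<comment> \<open>\<open>?G\<close> is the adjoint of \<open>mul B (\<iota> e) D\<close>. As
      \<open>h'\<close> is \<open>adj A e\<close> times \<open>e\<close>, the vanishing trace is
      that of \<open>adj B ?G\<close> times \<open>?G\<close>.\<close>
    let ?G = "mul B (adj B D) (adj B (\<iota> e))"
    have iM: "\<iota> e \<in> carr B" "\<iota> h' = mul B (adj B (\<iota> e)) (\<iota> e)" using e \<iota> by simp_all
    have "\<sigma> (mul B (adj B ?G) ?G) = \<sigma> (mul B (\<iota> e) (mul B (mul B D (adj B D)) (adj B (\<iota> e))))"
      using DN iM by simp
    also have "\<dots> = \<sigma> (mul B (mul B (mul B D (adj B D)) (adj B (\<iota> e))) (\<iota> e))"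
      using DN iM by (intro N.tr_commute) auto
    also have "\<dots> = 0" using zero DN iM by simp
    finally have "?G = 0" using N.tr_faithful[of ?G] DN iM by simp
    then have "adj B ?G = 0" by simp
    then have "mul B (\<iota> e) D = 0" using DN iM by simp
    then have ih: "mul B (\<iota> h') D = 0" using DN iM by simp
    \<comment> \<open>The support of \<open>h'\<close> is \<open>p\<close>, so the pseudo-inverse
      turns \<open>\<iota> h'\<close> into \<open>\<iota> p\<close>, which fixes
      \<open>D\<close>.\<close>
    have "mul B (\<iota> p) D = mul B (\<iota> (pinv h')) (mul B (\<iota> h') D)"
    proof -
      have pih: "pinv h' \<in> M" "mul A (pinv h') h' = p"
        using pinv_closed[OF h'] pinv_mul[OF h'] rph' by auto
      then have "\<iota> p = mul B (\<iota> (pinv h')) (\<iota> h')" using \<iota>(2)[of "pinv h'" h'] h' by simp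
      then show ?thesis using \<iota>(1)[OF pih(1)] \<iota>(1)[OF h'(1)] DN by simp
    qed
    also have "\<dots> = 0" using ih \<iota>(1) pinv_closed[OF h'] by simp
    finally have "mul B (\<iota> p) D = 0" .
    moreover have "mul B (\<iota> p) D = D"
    proof -
      have "mul B (\<iota> p) (mul B \<kappa> (\<iota> c)) = mul B \<kappa> (\<iota> c)"
        using N.mul_assoc[of "\<iota> p" \<kappa> "\<iota> c"] \<kappa> \<iota>(1) p c by simp
      moreover have "mul B (\<iota> p) (mul B (\<iota> c) \<kappa>) = mul B (\<iota> c) \<kappa>"
        by (metis N.mul_assoc \<iota>(1,2) p(2) c(1) pc(1) \<kappa>(1))
      ultimately show ?thesis using \<kappa> \<iota>(1) p c by (simp add: D_def N.mul_diff_right)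
    qed
    ultimately have "D = 0" by simp
    then have "c \<in> C" using C_I c by (simp add: D_def)
    then show "y \<in> (\<lambda>c. mul A (mul A ?s c) ?s) ` {c \<in> C. positive A c}"
      using scs cpos by blast
  qed
qed

end

section \<open>Calculus of boxes in a C*-planar algebra\<close>

text \<open>The box types contain the numeral \<open>1\<close>, which must not be rewritten to \<open>Suc 0\<close>.\<close>

declare One_nat_def [simp del]

lemma opp_opp [simp]: "opp (opp s) = s"
  by (cases s) auto

context cstar_planar_algebra
begin

lemma carr_box: "carr (box_alg P b) = box_space P b"
  and smul_box: "smul (box_alg P b) = box_smul P"
  and adj_box: "adj (box_alg P b) = box_adj P b"
  by (simp_all add: box_alg_def)

lemmas box_closed [simp, intro] = fd_cstar_algebra.algebra_closed[OF box_alg_cstar]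
lemmas box_rules [simp] = fd_cstar_algebra.algebra_rules[OF box_alg_cstar]
  fd_cstar_algebra.adj_unit[OF box_alg_cstar]

lemma fourier_closed0: "x \<in> carr (box_alg P (2, s)) \<Longrightarrow> fourier P s x \<in> carr (box_alg P (2, opp s))"
proof -
  assume x: "x \<in> carr (box_alg P (2, s))"
  have "is_tangle (Tangle [(2, s)] (2, opp s) [Cup 0, Box 1 0, Cap 2])" by
    (cases s; simp; code_simp)
  from act_closed[OF this, of "[x]"] x show ?thesis by (simp add: fourier_def fits_def carr_box)
qed

lemma left_conv_tangle: "is_tangle (Tangle [(1, s), (2, opp s)] (1, s)
  [Cup 0, Box 0 0, Box 1 1, Cap 0])"
  by (cases s; simp; code_simp)

lemma left_conv_closed [simp, intro]:
  "\<lbrakk>y \<in> carr (box_alg P (1, s)); u \<in> carr (box_alg P (2, opp s))\<rbrakk> \<Longrightarrow>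
    left_conv P s y u \<in> carr (box_alg P (1, s))"
  using act_closed[OF left_conv_tangle[of s], of "[y, u]"] by
    (simp add: left_conv_def fits_def carr_box)

lemma left_conv_add:
  "\<lbrakk>y \<in> carr (box_alg P (1, s)); y' \<in> carr (box_alg P (1, s)); u \<in> carr (box_alg P (2, opp s))\<rbrakk> \<Longrightarrow>
    left_conv P s (y + y') u = left_conv P s y u + left_conv P s y' u"
  using act_add[OF left_conv_tangle[of s], of "[]" y "[u]" y'] by
    (simp add: left_conv_def fits_def carr_box)

lemma left_conv_scale:
  "\<lbrakk>y \<in> carr (box_alg P (1, s)); u \<in> carr (box_alg P (2, opp s))\<rbrakk> \<Longrightarrow>
    left_conv P s (box_smul P c y) u = box_smul P c (left_conv P s y u)"
  using act_smul[OF left_conv_tangle[of s], of "[]" y "[u]" c] by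
    (simp add: left_conv_def fits_def carr_box)

lemma conv_closed [simp, intro]:
  "\<lbrakk>u \<in> carr (box_alg P (2, s)); v \<in> carr (box_alg P (2, s))\<rbrakk> \<Longrightarrow> conv P s u v \<in> carr
    (box_alg P (2, s))"
proof -
  have "is_tangle (Tangle [(2, s), (2, s)] (2, s) [Cup 1, Box 0 0, Box 2 1, Cap 1])"
    by (cases s; simp; code_simp)
  from act_closed[OF this, of "[u, v]"] show "\<lbrakk>u \<in> carr (box_alg P (2, s)); v \<in> carr
    (box_alg P (2, s))\<rbrakk> \<Longrightarrow>
    conv P s u v \<in> carr (box_alg P (2, s))" by (simp add: conv_def fits_def carr_box)
qed

lemma conv_power_closed [simp, intro]:
  "u \<in> carr (box_alg P (2, s)) \<Longrightarrow> conv_power P s u j \<in> carr (box_alg P (2, s))"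
  by (induction j) auto

lemma rot180_tangle: "is_tangle (Tangle [(1, s)] (1, opp s) [Cup 1, Box 1 0, Cap 0])"
  by (cases s; simp; code_simp)

lemma rot180_closed0: "y \<in> carr (box_alg P (1, s)) \<Longrightarrow> rot180 P s y \<in> carr (box_alg P (1, opp s))"
  using act_closed[OF rot180_tangle[of s], of "[y]"] by (simp add: rot180_def fits_def carr_box)

lemma rot180_scale:
  "y \<in> carr (box_alg P (1, s)) \<Longrightarrow> rot180 P s (box_smul P c y) = box_smul P c (rot180 P s y)"
  using act_smul[OF rot180_tangle[of s], of "[]" y "[]" c] by
    (simp add: rot180_def fits_def carr_box)

lemma juxtapose_tangle: "is_tangle (Tangle [(1, s), (1, opp s)] (2, s) [Box 0 0, Box 1 1])"
  by (cases s; simp; code_simp)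

lemma juxtapose_closed0: "\<lbrakk>a \<in> carr (box_alg P (1, s)); e \<in> carr (box_alg P (1, opp s))\<rbrakk> \<Longrightarrow>
    juxtapose P s a e \<in> carr (box_alg P (2, s))"
  using act_closed[OF juxtapose_tangle[of s], of "[a, e]"] by
    (simp add: juxtapose_def fits_def carr_box)

text \<open>Such rules are stored a second time at \<open>opp s\<close> with
  \<open>opp (opp s)\<close> contracted, because matching does not see that the double opposite is
  the sign itself.\<close>

lemmas fourier_closed [simp, intro] = fourier_closed0
  fourier_closed0[of _ "opp s" for s, unfolded opp_opp]
lemmas rot180_closed [simp, intro] = rot180_closed0
  rot180_closed0[of _ "opp s" for s, unfolded opp_opp]
lemmas juxtapose_closed [simp, intro] = juxtapose_closed0
  juxtapose_closed0[of _ "opp s" for s, unfolded opp_opp]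

text \<open>Reflection exchanges the heights of the two boxes, which \<open>juxtapose_flip\<close>
  undoes.\<close>

lemma juxtapose_adj0:
  assumes "a \<in> carr (box_alg P (1, s))" "e \<in> carr (box_alg P (1, opp s))"
  shows "adj (box_alg P (2, s)) (juxtapose P s a e) =
    juxtapose P s (adj (box_alg P (1, s)) a) (adj (box_alg P (1, opp s)) e)"
  using act_reflect[OF juxtapose_tangle[of s], of "[a, e]"] assms
    juxtapose_flip[of "adj (box_alg P (1, s)) a" s "adj (box_alg P (1, opp s)) e"]
    box_closed(3)[OF assms(1)] box_closed(3)[OF assms(2)]
  by (simp add: reflect_def fits_def carr_box adj_box juxtapose_def)

lemma rot180_adj0:
  assumes "a \<in> carr (box_alg P (1, s))"
  shows "adj (box_alg P (1, opp s)) (rot180 P s a) = rot180 P s (adj (box_alg P (1, s)) a)"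
  using act_reflect[OF rot180_tangle[of s], of "[a]"] assms
    rot180_flip[of "adj (box_alg P (1, s)) a" s] box_closed(3)[OF assms]
  by (simp add: reflect_def fits_def carr_box adj_box rot180_def)

text \<open>Seen in a horizontal mirror, the quarter turn goes the other way.\<close>

lemma fourier_adj0:
  assumes x: "x \<in> carr (box_alg P (2, s))"
  shows "adj (box_alg P (2, opp s)) (fourier P s x) = fourier_inv P s (adj (box_alg P (2, s)) x)"
proof -
  have "is_tangle (Tangle [(2, s)] (2, opp s) [Cup 0, Box 1 0, Cap 2])" by
    (cases s; simp; code_simp)
  from act_reflect[OF this, of "[x]"] x show ?thesis
    by (simp add: reflect_def fits_def carr_box adj_box fourier_def fourier_inv_def)
qed

lemmas juxtapose_adj [simp] = juxtapose_adj0 juxtapose_adj0[of _ "opp s" for s, unfolded opp_opp]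
lemmas rot180_adj [simp] = rot180_adj0 rot180_adj0[of _ "opp s" for s, unfolded opp_opp]

lemmas juxtapose_mul_box [simp] = juxtapose_mul[folded carr_box]
  juxtapose_mul[folded carr_box, of _ "opp s" for s, unfolded opp_opp]
lemmas juxtapose_unit_box [simp] = juxtapose_unit juxtapose_unit[of "opp s" for s, unfolded opp_opp]
lemmas rot180_mul_box [simp] = rot180_mul[folded carr_box]
  rot180_mul[folded carr_box, of _ "opp s" for s, unfolded opp_opp]
lemmas rot180_unit_box [simp] = rot180_unit rot180_unit[of "opp s" for s, unfolded opp_opp]
lemmas rot180_rot180_box [simp] = rot180_rot180[folded carr_box]
  rot180_rot180[folded carr_box, of _ "opp s" for s, unfolded opp_opp]

lemma fourier_inject:
  assumes "x \<in> carr (box_alg P (2, s))" "x' \<in> carr (box_alg P (2, s))" "fourier P s x = fourier P s x'"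
   
  shows "x = x'"
  by (metis fourier_inv_fourier carr_box assms)

lemma fourier_mul_left:
  assumes "x \<in> carr (box_alg P (2, s))" "a \<in> carr (box_alg P (1, s))" "e \<in> carr (box_alg P (1, opp s))"
   
  shows "fourier P s (box_mul P (2, s) (juxtapose P s a e) x) =
    box_mul P (2, opp s) (box_mul P (2, opp s) (juxtapose P (opp s) e (box_unit P (1, s)))
      (fourier P s x))
      (juxtapose P (opp s) (rot180 P s a) (box_unit P (1, s)))"
  using fourier_corners[folded carr_box, of x s a e "box_unit P (1, s)" "box_unit P (1, opp s)"]
    assms
  by simp

lemma fourier_mul_right:
  assumes "x \<in> carr (box_alg P (2, s))" "d \<in> carr (box_alg P (1, s))" "f \<in> carr (box_alg P (1, opp s))"
   
  shows "fourier P s (box_mul P (2, s) x (juxtapose P s d f)) =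
    box_mul P (2, opp s) (box_mul P (2, opp s)
      (juxtapose P (opp s) (box_unit P (1, opp s)) (rot180 P (opp s) f))
      (fourier P s x)) (juxtapose P (opp s) (box_unit P (1, opp s)) d)"
  using fourier_corners[folded carr_box, of x s "box_unit P (1, s)" "box_unit P (1, opp s)" d f]
    assms
  by simp

text \<open>The half turn reverses products and commutes with adjoints, so a square of
  \<open>b\<close> becomes a square of the half turn of \<open>adj b\<close>.\<close>

lemma rot180_positive:
  assumes "positive (box_alg P (1, s)) y"
  shows "positive (box_alg P (1, opp s)) (rot180 P s y)"
proof -
  obtain b where b: "b \<in> carr (box_alg P (1, s))" "y = box_mul P (1, s) (adj (box_alg P (1, s)) b)
    b"
    using assms by (auto simp: positive_def)
  have "rot180 P s y = box_mul P (1, opp s)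
      (adj (box_alg P (1, opp s)) (rot180 P s (adj (box_alg P (1, s)) b)))
        (rot180 P s (adj (box_alg P (1, s)) b))"
    using b by simp
  then show ?thesis unfolding positive_def using b(1) rot180_closed0 box_closed(3) by blast
qed

lemma left_conv_power_iterate:
  assumes "y \<in> carr (box_alg P (1, s))" "u \<in> carr (box_alg P (2, opp s))"
  shows "left_conv_power P s y u j = ((\<lambda>y. left_conv P s y u) ^^ j) y"
proof (cases j)
  case (Suc i)
  have "left_conv P s y (conv_power P (opp s) u i) = ((\<lambda>y. left_conv P s y u) ^^ Suc i) y"
  proof (induction i)
    case (Suc i)
    then show ?case
      using left_conv_conv[folded carr_box, of y s "conv_power P (opp s) u i" u] assms by simp
  qed simp
  then show ?thesis using Suc by simp
qed simp

end

section \<open>Trace identities for convolution and the final assembly\<close>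

locale traced_planar_algebra = cstar_planar_algebra P for P :: "'a::ab_group_add planar_data" +
  fixes tr :: "box_type \<Rightarrow> 'a \<Rightarrow> complex"
  assumes tr_trace: "positive_faithful_trace (box_alg P b) (tr b)"
    and tr_closure: "a \<in> carr (box_alg P (n, s)) \<Longrightarrow> tr (n, s) a = tr (0, s) (box_closure P (n, s) a)"
begin

lemma traced: "traced_algebra (box_alg P b) (tr b)"
  using box_alg_cstar tr_trace by (simp add: traced_algebra_def traced_algebra_axioms_def)

text \<open>\<open>tr_closure\<close> sends both traces to the 0-boxes, where
  \<open>conv_kraus\<close> compares the closed diagrams; reflection identifies the second rotated
  box as the adjoint of the first.\<close>

lemma tr_left_conv_kraus:
  assumes y: "y \<in> carr (box_alg P (1, s))" and m: "m \<in> carr (box_alg P (1, s))"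
    and u: "u \<in> carr (box_alg P (2, opp s))"
  defines "k \<equiv> fourier P (opp s) u"
  shows "tr (1, s) (box_mul P (1, s)
      (left_conv P s y (box_mul P (2, opp s) u (adj (box_alg P (2, opp s)) u))) m) =
    tr (2, s) (box_mul P (2, s) (box_mul P (2, s) (box_mul P (2, s) k
      (juxtapose P s y (box_unit P (1, opp s)))) (adj (box_alg P (2, s)) k))
      (juxtapose P s m (box_unit P (1, opp s))))"
proof -
  have k: "k \<in> carr (box_alg P (2, s))" using u by (simp add: k_def)
  have "adj (box_alg P (2, s)) k = fourier_inv P (opp s) (adj (box_alg P (2, opp s)) u)"
    using fourier_adj0[of u "opp s"] u by (simp add: k_def)
  then have "box_closure P (1, s) (box_mul P (1, s)
      (left_conv P s y (box_mul P (2, opp s) u (adj (box_alg P (2, opp s)) u))) m) =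
    box_closure P (2, s) (box_mul P (2, s) (box_mul P (2, s) (box_mul P (2, s) k
      (juxtapose P s y (box_unit P (1, opp s)))) (adj (box_alg P (2, s)) k))
      (juxtapose P s m (box_unit P (1, opp s))))"
    using conv_kraus[folded carr_box, of y s u "adj (box_alg P (2, opp s)) u" m] y m u
    by (simp add: k_def del: box_rules)
  moreover have "box_mul P (1, s)
      (left_conv P s y (box_mul P (2, opp s) u (adj (box_alg P (2, opp s)) u))) m \<in> carr
        (box_alg P (1, s))"
    using y m u by (intro box_closed left_conv_closed)
  moreover have "box_mul P (2, s) (box_mul P (2, s) (box_mul P (2, s) k
      (juxtapose P s y (box_unit P (1, opp s)))) (adj (box_alg P (2, s)) k))
      (juxtapose P s m (box_unit P (1, opp s))) \<in> carr (box_alg P (2, s))"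
    using y m k by (intro box_closed juxtapose_closed)
  ultimately show ?thesis by (simp only: tr_closure)
qed

text \<open>By the Kraus form, the trace form of the result at \<open>d\<close> is the trace of
  \<open>?G\<close> times its adjoint, with \<open>?G\<close> built from \<open>k\<close> and from
  the factors of \<open>y\<close> and of the test element.\<close>

lemma left_conv_positive:
  assumes y: "positive (box_alg P (1, s)) y" and X: "positive (box_alg P (2, opp s)) X"
  shows "positive (box_alg P (1, s)) (left_conv P s y X)"
proof -
  let ?M = "box_alg P (1, s)" and ?N = "box_alg P (2, s)" and ?N' = "box_alg P (2, opp s)"
  let ?i = "\<lambda>a. juxtapose P s a (box_unit P (1, opp s))"
  obtain b where b: "b \<in> carr ?M" "y = mul ?M (adj ?M b) b" using y by (auto simp: positive_def)
  obtain v where v: "v \<in> carr ?N'" "X = mul ?N' (adj ?N' v) v" using X by (auto simp: positive_def)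
  define u where "u = adj ?N' v"
  have u: "u \<in> carr ?N'" "X = mul ?N' u (adj ?N' u)" using v by (simp_all add: u_def)
  define k where "k = fourier P (opp s) u"
  have k: "k \<in> carr ?N" using u by (simp add: k_def)
  have yM: "y \<in> carr ?M" and XM: "X \<in> carr ?N'" using b u by simp_all
  show ?thesis
  proof (rule traced_algebra.positiveI[OF traced])
    show "left_conv P s y X \<in> carr ?M" using yM XM by simp
    fix d assume d: "d \<in> carr ?M"
    define \<beta> where "\<beta> = ?i b"
    define \<delta> where "\<delta> = ?i d"
    have bd: "\<beta> \<in> carr ?N" "\<delta> \<in> carr ?N" using b d by (simp_all add: \<beta>_def \<delta>_def)
    have iy: "?i y = mul ?N (adj ?N \<beta>) \<beta>" using b by (simp add: \<beta>_def)
    have id: "?i (mul ?M d (adj ?M d)) = mul ?N \<delta> (adj ?N \<delta>)" using d by (simp add: \<delta>_def)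
    let ?G = "mul ?N (mul ?N (adj ?N \<delta>) k) (adj ?N \<beta>)"
    have "tr (1, s) (mul ?M (mul ?M (adj ?M d) (left_conv P s y X)) d) =
        tr (1, s) (mul ?M (adj ?M d) (mul ?M (left_conv P s y X) d))"
      using d yM XM by simp
    also have "\<dots> = tr (1, s) (mul ?M (mul ?M (left_conv P s y X) d) (adj ?M d))"
      using d yM XM by (intro traced_algebra.tr_commute[OF traced]) auto
    also have "\<dots> = tr (1, s) (mul ?M (left_conv P s y X) (mul ?M d (adj ?M d)))"
      using d yM XM by simp
    also have "\<dots> = tr (2, s) (mul ?N (mul ?N (mul ?N k (?i y)) (adj ?N k))
      (?i (mul ?M d (adj ?M d))))"
      unfolding u(2) k_def using yM u(1) d by (intro tr_left_conv_kraus) auto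
    also have "\<dots> = tr (2, s) (mul ?N (mul ?N (mul ?N (mul ?N k (mul ?N (adj ?N \<beta>) \<beta>)) (adj ?N k)) \<delta>)
        (adj ?N \<delta>))"
      unfolding iy id using k bd by simp
    also have "\<dots> = tr (2, s) (mul ?N (adj ?N \<delta>)
        (mul ?N (mul ?N (mul ?N k (mul ?N (adj ?N \<beta>) \<beta>)) (adj ?N k)) \<delta>))"
      using k bd by (intro traced_algebra.tr_commute[OF traced] box_closed)
    also have "\<dots> = tr (2, s) (mul ?N (adj ?N (adj ?N ?G)) (adj ?N ?G))"
      using k bd by simp
    also have "0 \<le> \<dots>" using k bd by (intro traced_algebra.tr_pos[OF traced] box_closed)
    finally show "0 \<le> tr (1, s) (mul ?M (mul ?M (adj ?M d) (left_conv P s y X)) d)" .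
  qed
qed

lemma positive_map_left_conv:
  assumes "positive (box_alg P (2, opp s)) X"
  shows "positive_map (box_alg P (1, s)) (tr (1, s)) (\<lambda>y. left_conv P s y X)"
proof -
  have "X \<in> carr (box_alg P (2, opp s))" using assms traced_algebra.positive_closed[OF traced] by
    blast
  then show ?thesis
    using traced assms left_conv_positive
    by (simp add: positive_map_def positive_map_axioms_def left_conv_add left_conv_scale smul_box)
qed

text \<open>The quarter turn moves a factor of \<open>x\<close> to another corner: commutation with
  a box on the right string becomes an identity of left multiples of the transform, commutation with
  a box on the left string one of right multiples. In this form they can be read off from the Kraus
  operator.\<close>

lemma commute_corners:
  assumes x: "x \<in> carr (box_alg P (2, s))" and c: "c \<in> carr (box_alg P (1, s))"
  shows "box_mul P (2, s) x (juxtapose P s (box_unit P (1, s)) (rot180 P s c)) =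
      box_mul P (2, s) (juxtapose P s (box_unit P (1, s)) (rot180 P s c)) x \<longleftrightarrow>
    box_mul P (2, opp s) (juxtapose P (opp s) (box_unit P (1, opp s)) c) (fourier P s x) =
      box_mul P (2, opp s) (juxtapose P (opp s) (rot180 P s c) (box_unit P (1, s))) (fourier P s x)"
    (is "?x1 = ?x2 \<longleftrightarrow> ?f1 = ?f2")
    and "box_mul P (2, s) x (juxtapose P s c (box_unit P (1, opp s))) =
      box_mul P (2, s) (juxtapose P s c (box_unit P (1, opp s))) x \<longleftrightarrow>
    box_mul P (2, opp s) (fourier P s x) (juxtapose P (opp s) (box_unit P (1, opp s)) c) =
      box_mul P (2, opp s) (fourier P s x) (juxtapose P (opp s) (rot180 P s c) (box_unit P (1, s)))"
    (is "?x3 = ?x4 \<longleftrightarrow> ?f3 = ?f4")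
proof -
  have "fourier P s ?x1 = ?f1" "fourier P s ?x2 = ?f2" "fourier P s ?x3 = ?f3" "fourier P s ?x4 =
    ?f4"
    using x c by (simp_all add: fourier_mul_left fourier_mul_right)
  then show "?x1 = ?x2 \<longleftrightarrow> ?f1 = ?f2" "?x3 = ?x4 \<longleftrightarrow> ?f3 = ?f4"
    using fourier_inject[of ?x1 s ?x2] fourier_inject[of ?x3 s ?x4] x c by auto
qed

text \<open>Duality of the two convolutions moves the map onto \<open>y1\<close>, where the
  eigenvalue equation applies.\<close>

lemma tr_left_conv_right_eigenvector:
  assumes y1: "y1 \<in> carr (box_alg P (1, opp s))" and X: "X \<in> carr (box_alg P (2, opp s))"
    and eig: "right_conv P (opp s) X y1 = box_smul P l y1" and y: "y \<in> carr (box_alg P (1, s))"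
  shows "tr (1, s) (box_mul P (1, s) (rot180 P (opp s) y1) (left_conv P s y X)) =
    l * tr (1, s) (box_mul P (1, s) (rot180 P (opp s) y1) y)"
proof -
  let ?h = "rot180 P (opp s) y1"
  have h: "?h \<in> carr (box_alg P (1, s))" using y1 by simp
  have sc: "rot180 P (opp s) (box_smul P l y1) = smul (box_alg P (1, s)) l ?h"
    using rot180_scale[of y1 "opp s"] y1 by (simp add: smul_box)
  have hl: "smul (box_alg P (1, s)) l ?h \<in> carr (box_alg P (1, s))"
    using fd_cstar_algebra.scale_closed[OF box_alg_cstar h] .
  have "tr (1, s) (box_mul P (1, s) ?h (left_conv P s y X)) =
      tr (1, s) (box_mul P (1, s) y (smul (box_alg P (1, s)) l ?h))"
    using left_right_conv_dual[folded carr_box, of y s X y1] y1 X y h hl sc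
    by (simp add: tr_closure eig del: box_rules)
  also have "\<dots> = l * tr (1, s) (box_mul P (1, s) y ?h)"
    using y h by (simp add: traced_algebra.tr_scale[OF traced])
  also have "tr (1, s) (box_mul P (1, s) y ?h) = tr (1, s) (box_mul P (1, s) ?h y)"
    using y h by (rule traced_algebra.tr_commute[OF traced])
  finally show ?thesis .
qed

theorem pf_cone_eq:
  assumes x: "x \<in> carr (box_alg P (2, s))" and pos: "F_positive P s x"
    and right: "right_pf_eigenvector P s x y1"
    and meet: "proj_meet (box_alg P (1, s)) (p_max P s x)
        (proj_compl (box_alg P (1, s))
          (rot180 P (opp s) (range_proj (box_alg P (1, opp s)) y1))) = 0"
  shows "pf_cone P s x =
    (\<lambda>c. box_mul P (1, s) (box_mul P (1, s) (zeta_sqrt P s x) c) (zeta_sqrt P s x)) ` C_zeta_pos P s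
      x"
proof -
  define A where "A = box_alg P (1, s)"
  define X where "X = fourier P s x"
  define \<Phi> where "\<Phi> = (\<lambda>y. left_conv P s y X)"
  define r where "r = pf_radius P s x"
  have Xpos: "positive (box_alg P (2, opp s)) X" using pos by (simp add: X_def F_positive_def)
  have XM: "X \<in> carr (box_alg P (2, opp s))" using x by (simp add: X_def)
  interpret PM: positive_map A "tr (1, s)" \<Phi>
    unfolding A_def \<Phi>_def by (rule positive_map_left_conv[OF Xpos])
  have cone: "pf_cone P s x = PM.cone r"
    unfolding PM.cone_def pf_cone_def pf_space_def using PM.positive_closed
    by (auto simp: A_def \<Phi>_def X_def r_def smul_box carr_box)
  obtain y0 where y0: "y0 \<in> PM.cone r" "\<forall>z\<in>PM.cone r. mul A (PM.rp y0) z = z"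
    using PM.ex_maximal_support by blast
  interpret PF: pf_data A "tr (1, s)" \<Phi> r y0
    by unfold_locales (use y0 in auto)
  have rpc: "range_proj A z = PM.rp z" "projection A (PM.rp z)" if "z \<in> PM.cone r" for z
    using that PM.range_proj_eq[of z] PM.rp_projection[of z] PM.positive_adj[of z]
      PM.positive_closed[of z]
    by (auto simp: PM.cone_def)
  have pmax: "p_max P s x = PM.rp y0"
    unfolding p_max_def cone A_def[symmetric]
  proof (rule the_equality)
    have "below A (PM.rp z) (PM.rp y0)" if z: "z \<in> PM.cone r" for z
    proof -
      have "z \<in> carr A" "adj A z = z" using z PM.positive_adj by (auto simp: PM.cone_def)
      then have "mul A (PM.rp y0) (PM.rp z) = PM.rp z"
        using PM.rp_absorb[of z "PM.rp y0"] y0(2) z PF.p(2) by blast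
      then show ?thesis using PM.projection_below_iff rpc(2) z y0(1) by blast
    qed
    then show *: "PM.rp y0 \<in> range_proj A ` PM.cone r \<and>
        (\<forall>q\<in>range_proj A ` PM.cone r. below A q (PM.rp y0))"
      using y0(1) rpc(1) by auto
    fix p assume "p \<in> range_proj A ` PM.cone r \<and> (\<forall>q\<in>range_proj A ` PM.cone r. below A q p)"
    then show "p = PM.rp y0" using * PM.below_antisym by blast
  qed
  define \<zeta> where "\<zeta> = zeta P s x"
  have zeta: "\<zeta> \<in> PM.cone r" "PM.rp \<zeta> = PM.rp y0"
  proof -
    have p: "PM.rp y0 \<in> carr (box_alg P (1, s))" using PF.p(2) by (simp add: A_def)
    have it: "left_conv_power P s (PM.rp y0) X j = (\<Phi> ^^ j) (PM.rp y0)" for j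
      using left_conv_power_iterate[OF p XM] by (simp add: \<Phi>_def)
    have eq: "\<zeta> = norm_limit A (at_right r) (\<lambda>z. smul A (complex_of_real (z - r))
        (norm_suminf A (\<lambda>j. smul A (complex_of_real (1 / z ^ (j + 1))) ((\<Phi> ^^ j) (PM.rp y0)))))"
      unfolding \<zeta>_def zeta_def pmax r_def[symmetric] X_def[symmetric] it
      unfolding A_def smul_box ..
    show "\<zeta> \<in> PM.cone r" "PM.rp \<zeta> = PM.rp y0"
      unfolding eq by (rule PF.zeta_cone_support)+
  qed
  have \<zeta>pos: "positive A \<zeta>" using zeta(1) by (simp add: PM.cone_def)
  define \<sigma> where "\<sigma> = PM.sq \<zeta>"
  define \<theta> where "\<theta> = PM.isq \<zeta>"
  have sqrt: "zeta_sqrt P s x = \<sigma>"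
    unfolding zeta_sqrt_def \<sigma>_def \<zeta>_def[symmetric] A_def[symmetric] by
      (rule PM.pos_sqrt_eq[OF \<zeta>pos])
  have isqrt: "zeta_inv_sqrt P s x = \<theta>"
    unfolding zeta_inv_sqrt_def sqrt pmax A_def[symmetric] zeta(2)[symmetric] \<sigma>_def \<theta>_def
    by (rule PM.corner_inverse_eq[OF \<zeta>pos])
  let ?M = "box_alg P (1, s)" and ?M' = "box_alg P (1, opp s)"
  let ?N = "box_alg P (2, s)" and ?N' = "box_alg P (2, opp s)"
  let ?\<iota> = "\<lambda>a. juxtapose P s a (unit ?M')" and ?rot = "rot180 P s" and ?F = "fourier P (opp s)"
  have st: "\<sigma> \<in> carr ?M" "\<theta> \<in> carr ?M" "adj ?M \<sigma> = \<sigma>" "adj ?M \<theta> = \<theta>"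
    using PM.sq_closed[OF \<zeta>pos] PM.isq_closed[OF \<zeta>pos] PM.sq_adj[OF \<zeta>pos] PM.isq_adj[OF \<zeta>pos]
    by (simp_all add: \<sigma>_def \<theta>_def A_def)
  have p\<theta>: "PM.rp y0 \<in> carr ?M" "mul ?M (PM.rp y0) \<theta> = \<theta>"
    using PF.p(2) PM.rp_isq[OF \<zeta>pos] zeta(2) by (simp_all add: \<theta>_def A_def)
  define x' where "x' = x_zeta P s x"
  have x'_eq: "x' = mul ?N (mul ?N (juxtapose P s \<sigma> (?rot \<sigma>)) x) (juxtapose P s \<theta> (?rot \<theta>))"
    by (simp only: x'_def x_zeta_def Let_def sqrt isqrt)
  have x'M: "x' \<in> carr ?N" unfolding x'_eq using st x by simp
  \<comment> \<open>After the quarter turn the four corner factors of \<open>x_zeta\<close> form the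
    same self-adjoint \<open>w\<close> on both sides of \<open>X\<close>; so \<open>X'\<close> is
    again a square, with factor \<open>u\<close> made of \<open>w\<close> and
    \<open>adj ?N' b\<close>.\<close>
  define w where "w = juxtapose P (opp s) (?rot \<sigma>) \<theta>"
  have w: "w \<in> carr ?N'" "adj ?N' w = w" using st by (simp_all add: w_def)
  define X' where "X' = fourier P s x'"
  have X': "X' = mul ?N' (mul ?N' w X) w"
    using fourier_corners[folded carr_box, of x s \<sigma> "?rot \<sigma>" \<theta> "?rot \<theta>"] x st
    by (simp add: X'_def x'_eq w_def X_def del: box_rules)
  have X'M: "X' \<in> carr ?N'" using x'M by (simp add: X'_def)
  obtain b where b: "b \<in> carr ?N'" "X = mul ?N' (adj ?N' b) b" using Xpos by
    (auto simp: positive_def)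
  define u where "u = mul ?N' w (adj ?N' b)"
  have u: "u \<in> carr ?N'" "X' = mul ?N' u (adj ?N' u)" using b w by (simp_all add: u_def X')
  define \<kappa> where "\<kappa> = ?F u"
  have \<kappa>: "\<kappa> \<in> carr ?N" using u by (simp add: \<kappa>_def)
  have \<Phi>': "left_conv P s y X' = mul ?M (mul ?M \<theta> (\<Phi> (mul ?M (mul ?M \<sigma> y) \<sigma>))) \<theta>"
    if y: "y \<in> carr ?M" for y
    using left_conv_corners[folded carr_box, of y s X "?rot \<sigma>" \<theta> "?rot \<sigma>" \<theta>] y XM st
    by (simp add: X' w_def \<Phi>_def del: box_rules)
  have \<kappa>_left: "?F (mul ?N' (juxtapose P (opp s) (unit ?M') c) u) = mul ?N (?\<iota> c) \<kappa>"
    and \<kappa>_right: "?F (mul ?N' (juxtapose P (opp s) (?rot c) (unit ?M)) u) = mul ?N \<kappa> (?\<iota> c)"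
    if c: "c \<in> carr ?M" for c
    using fourier_mul_left[of u "opp s" "unit ?M'" c]
      fourier_mul_left[of u "opp s" "?rot c" "unit ?M"]
      c u \<kappa> by (simp_all add: \<kappa>_def)
  have y1: "y1 \<in> carr ?M'" "positive ?M' y1"
    "right_conv P (opp s) X y1 = box_smul P (complex_of_real r) y1"
    using right by (simp_all add: right_pf_eigenvector_def carr_box X_def r_def)
  define h where "h = rot180 P (opp s) y1"
  have hpos: "positive A h" using rot180_positive[OF y1(2)] by (simp add: h_def A_def)
  define R where "R = range_proj ?M' y1"
  define q where "q = rot180 P (opp s) R"
  have y1h: "adj ?M' y1 = y1" using traced_algebra.positive_adj[OF traced y1(2)] .
  have R: "R = traced_algebra.rp ?M' y1"
    unfolding R_def by (rule traced_algebra.range_proj_eq[OF traced y1(1) y1h])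
  have Rproj: "projection ?M' R" unfolding R by
    (rule traced_algebra.rp_projection[OF traced y1(1) y1h])
  \<comment> \<open>The half turn reverses products, so \<open>R = y1 l\<close> becomes the
    factorisation of \<open>q\<close> through \<open>h\<close> that \<open>cone_eq_image\<close>
    asks for.\<close>
  define l where "l = traced_algebra.pinv ?M' y1"
  have l: "l \<in> carr ?M'" "R = mul ?M' y1 l"
    using traced_algebra.pinv_closed[OF traced y1(1) y1h]
      traced_algebra.mul_pinv[OF traced y1(1) y1h]
    by (simp_all add: l_def R)
  have qproj: "projection A q"
  proof -
    have RM: "R \<in> carr ?M'" "adj ?M' R = R" "mul ?M' R R = R" using Rproj by
      (auto simp: projection_def)
    have "mul ?M q q = q" using rot180_mul_box(2)[of R s R] RM by (simp add: q_def)
    then show ?thesis using RM by (simp add: projection_def q_def A_def)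
  qed
  have qk: "rot180 P (opp s) l \<in> carr A" "q = mul A (rot180 P (opp s) l) h"
    using l y1 by (simp_all add: q_def h_def A_def)
  have "PM.cone r = (\<lambda>c. mul A (mul A (PM.sq \<zeta>) c) (PM.sq \<zeta>)) ` {c \<in> C_zeta P s x. positive A c}"
  proof (rule PF.cone_eq_image[OF zeta hpos _ qproj qk _ traced[of "(2, s)"]])
    show "proj_meet A (PM.rp y0) (unit A - q) = 0"
      using meet by (simp add: pmax proj_compl_def A_def q_def R_def)
    show "tr (1, s) (mul A h (\<Phi> y)) = complex_of_real r * tr (1, s) (mul A h y)" if "y \<in> carr A" for
      y
      unfolding A_def h_def \<Phi>_def
      by (rule tr_left_conv_right_eigenvector[OF y1(1) XM y1(3)]) (use that in \<open>simp add: A_def\<close>)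
    show "?\<iota> a \<in> carr ?N" "?\<iota> (adj A a) = adj ?N (?\<iota> a)" if "a \<in> carr A" for a
      using that by (simp_all add: A_def)
    show "?\<iota> (mul A a b) = mul ?N (?\<iota> a) (?\<iota> b)" if "a \<in> carr A" "b \<in> carr A" for a b
      using that by (simp add: A_def)
    show "?\<iota> (unit A) = unit ?N" by (simp add: A_def)
    show "\<kappa> \<in> carr ?N" by (rule \<kappa>)
    show "mul ?N (?\<iota> (PM.rp y0)) \<kappa> = \<kappa>"
    proof -
      \<comment> \<open>The right factor \<open>\<theta>\<close> of \<open>w\<close> absorbs the
        projection, and \<open>?F\<close> turns a box below the right string of \<open>u\<close>
        into a left factor of \<open>\<kappa>\<close>.\<close>
      let ?j = "juxtapose P (opp s) (unit ?M') (PM.rp y0)"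
      have "mul ?N' ?j w = w" using p\<theta> st by (simp add: w_def)
      moreover have "mul ?N' ?j u = mul ?N' (mul ?N' ?j w) (adj ?N' b)"
        using p\<theta> w b by (simp add: u_def)
      ultimately have "mul ?N' ?j u = u" by (simp only: u_def)
      then show ?thesis using \<kappa>_left[OF p\<theta>(1)] by (simp add: \<kappa>_def)
    qed
    show "tr (1, s) (mul A (mul A (mul A (PM.isq \<zeta>) (\<Phi> (mul A (mul A (PM.sq \<zeta>) y) (PM.sq \<zeta>))))
      (PM.isq \<zeta>)) m) =
        tr (2, s) (mul ?N (mul ?N (mul ?N \<kappa> (?\<iota> y)) (adj ?N \<kappa>)) (?\<iota> m))"
      if "y \<in> carr A" "m \<in> carr A" for y m
      using tr_left_conv_kraus[of y s m u] that u \<Phi>'[of y]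
      by (simp only: A_def \<kappa>_def \<sigma>_def \<theta>_def)
    show "c \<in> C_zeta P s x"
      if c: "c \<in> carr A" "adj A c = c" and com: "mul ?N \<kappa> (?\<iota> c) = mul ?N (?\<iota> c) \<kappa>" for c
    proof -
      let ?jl = "juxtapose P (opp s) (?rot c) (unit ?M)" and ?jr = "juxtapose P (opp s) (unit ?M')
        c"
      have cM: "c \<in> carr ?M" "adj ?M c = c" using c by (simp_all add: A_def)
      have jM: "?jl \<in> carr ?N'" "?jr \<in> carr ?N'" "adj ?N' ?jl = ?jl" "adj ?N' ?jr = ?jr" using cM by
        simp_all
      \<comment> \<open>Before the rotation, commutation of \<open>\<kappa>\<close> with
        \<open>c\<close> is a relation for \<open>u\<close>. Multiplying by the adjoint of
        \<open>u\<close> gives it for \<open>X'\<close> on one side, and taking adjoints gives the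
        other side.\<close>
      have "?F (mul ?N' ?jl u) = ?F (mul ?N' ?jr u)"
        using com \<kappa>_left[OF cM(1)] \<kappa>_right[OF cM(1)] by simp
      then have "mul ?N' ?jl u = mul ?N' ?jr u"
        by (rule fourier_inject[rotated 2]) (use jM u in auto)
      then have "mul ?N' (mul ?N' ?jl u) (adj ?N' u) = mul ?N' (mul ?N' ?jr u) (adj ?N' u)" by simp
      then have 1: "mul ?N' ?jr X' = mul ?N' ?jl X'" using jM u by simp
      have "adj ?N' X' = X'" using u by simp
      then have 2: "mul ?N' X' ?jr = mul ?N' X' ?jl"
        using arg_cong[OF 1, of "adj ?N'"] jM X'M by simp
      show ?thesis
        using commute_corners[OF x'M cM(1)] 1 2 cM by
          (simp add: C_zeta_def Let_def x'_def X'_def carr_box)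
    qed
    show cM: "c \<in> carr A" if "c \<in> C_zeta P s x" for c
      using that by (simp add: C_zeta_def A_def carr_box)
    show "mul A (mul A (PM.isq \<zeta>) (\<Phi> (mul A (mul A (PM.sq \<zeta>) c) (PM.sq \<zeta>)))) (PM.isq \<zeta>) =
        mul A (mul A (mul A (PM.isq \<zeta>) (\<Phi> (mul A (PM.sq \<zeta>) (PM.sq \<zeta>)))) (PM.isq \<zeta>)) c"
      if cC: "c \<in> C_zeta P s x" for c
    proof -
      let ?jl = "juxtapose P (opp s) (?rot c) (unit ?M)" and ?jr = "juxtapose P (opp s) (unit ?M')
        c"
      have c: "c \<in> carr ?M" using cM[OF cC] by (simp add: A_def)
      have "mul ?N' X' ?jr = mul ?N' X' ?jl"
        using commute_corners(2)[OF x'M c] cC by (simp add: C_zeta_def Let_def x'_def X'_def)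
      \<comment> \<open>The same product with \<open>X'\<close> is read twice: with \<open>c\<close>
        on the left strings it slides onto the unit, with \<open>c\<close> on the right strings it
        stays outside.\<close>
      moreover have "left_conv P s (unit ?M) (mul ?N' X' ?jl) = left_conv P s c X'"
        using left_conv_corners[folded carr_box, of "unit ?M" s X' "unit ?M'" "unit ?M" "?rot c"
          "unit ?M"] c X'M
        by simp
      moreover have "left_conv P s (unit ?M) (mul ?N' X' ?jr) = mul ?M (left_conv P s (unit ?M) X')
        c"
        using left_conv_corners[folded carr_box, of "unit ?M" s X' "unit ?M'" "unit ?M" "unit ?M'"
          c] c X'M
        by simp
      ultimately have "left_conv P s c X' = mul ?M (left_conv P s (unit ?M) X') c" by simp
      then show ?thesis
        using \<Phi>'[OF c] \<Phi>'[of "unit ?M"] st by (simp add: A_def \<sigma>_def \<theta>_def del: box_rules(1))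
    qed
  qed
  then show ?thesis
    by (simp only: cone sqrt \<sigma>_def A_def C_zeta_pos_def)
qed

end

theorem theorem5p11:
  fixes P :: "'a::ab_group_add planar_data" and s :: sign and x :: 'a
  assumes "cstar_planar_algebra P"
    and "x \<in> box_space P (2, s)" and "F_positive P s x"
    and "\<exists>y1. right_pf_eigenvector P s x y1 \<and>
      proj_meet (box_alg P (1, s)) (p_max P s x)
        (proj_compl (box_alg P (1, s))
          (rot180 P (opp s) (range_proj (box_alg P (1, opp s)) y1))) = 0"
  shows "pf_cone P s x =
    (\<lambda>c. mul (box_alg P (1, s)) (mul (box_alg P (1, s)) (zeta_sqrt P s x) c) (zeta_sqrt P s x))
      ` C_zeta_pos P s x"
proof -
  interpret cstar_planar_algebra P by (rule assms(1))
  obtain tr where "\<forall>b. positive_faithful_trace (box_alg P b) (tr b)"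
    "\<forall>n s. \<forall>a\<in>box_space P (n, s). tr (n, s) a = tr (0, s) (act P (closure_tangle (n, s)) [a])"
    using traces by blast
  then interpret traced_planar_algebra P tr
    by unfold_locales (auto simp: carr_box box_closure_def)
  show ?thesis using pf_cone_eq assms(2-4) carr_box by blast
qed

end
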